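(* Let $m\ge2$ and let $S^m=\{x\in\mathbb{R}^{m+1}:|x|=1\}$ be the standard (round) sphere. For any $\frac{2m}{m-1}<p<\infty$, the relatively sparse condition is necessary and sufficient for a family $\mu=\{\mu_\lambda\}_{\lambda\ge1}$ of measures on $S^m$ to be $L^p$-Carleson for eigenfunctions on $S^m$.
   Context: $-\Delta$ is the nonnegative Laplace-Beltrami operator on the round sphere, $dV$ and $\mathrm{vol}$ are the Riemannian volume element and volume, and $B(z,r)$ is the geodesic ball centered at $z$ of radius $r$. The $\mu_\lambda$ are (nonnegative Borel) measures on $S^m$. $\mu$ is $L^p$-Carleson for eigenfunctions on $S^m$ if there exists $C>0$ such that for all $\lambda\ge1$ and all eigenfunctions $e_\lambda$ satisfying $-\Delta e_\lambda=\lambda^2e_\lambda$, we have $\int_{S^m}|e_\lambda|^p\,d\mu_\lambda\le C\int_{S^m}|e_\lambda|^p\,dV$. $\mu$ is relatively sparse if there exist $r>0$ and $C>0$ such that for all $\lambda\ge1$ and $z\in S^m$, $\dfrac{\mu_\lambda(B(z,r/\lambda))}{\mathrm{vol}(B(z,r/\lambda))}\le C$.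
   Formalization: In the relatively sparse condition, λ ranges only over those λ ≥ 1 for which λ² is an eigenvalue of −Δ; with all λ ≥ 1 necessity fails, since the Carleson condition does not constrain μ_λ at other λ. *)

theory Defs
  imports "HOL-Analysis.Analysis"
begin

text \<open>
  The unit sphere \<^term>\<open>sphere 0 1\<close> of a Euclidean space, with the Riemannian metric
  induced by the inner product; the tangent space at \<open>x\<close> is the orthogonal complement of \<open>x\<close>.
\<close>

text \<open>
  Differentiability within the sphere determines a derivative only on tangent vectors.  The
  conditions \<open>g \<bullet> x = 0\<close> and \<open>D x = 0\<close> below remove the remaining freedom in the normal
  direction.  With \<open>D x = 0\<close>, the trace of \<open>D\<close> is the trace over the tangent space of
  the Levi-Civita derivative, that is, of the tangential part of \<open>D\<close>.
\<close>

definition sphere_grad :: "('a::euclidean_space \<Rightarrow> real) \<Rightarrow> 'a \<Rightarrow> 'a" where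
  "sphere_grad f x =
     (THE g. g \<bullet> x = 0 \<and> (f has_derivative (\<lambda>v. g \<bullet> v)) (at x within sphere 0 1))"

definition sphere_div :: "('a::euclidean_space \<Rightarrow> 'a) \<Rightarrow> 'a \<Rightarrow> real" where
  "sphere_div X x =
     (THE d. \<exists>D. (X has_derivative D) (at x within sphere 0 1) \<and> D x = 0 \<and>
                 d = (\<Sum>b\<in>Basis. D b \<bullet> b))"

definition laplace_beltrami :: "('a::euclidean_space \<Rightarrow> real) \<Rightarrow> 'a \<Rightarrow> real" where
  "laplace_beltrami f x = sphere_div (sphere_grad f) x"

definition sphere_C2 :: "('a::euclidean_space \<Rightarrow> real) \<Rightarrow> bool" where
  "sphere_C2 f \<longleftrightarrow>
     f differentiable_on sphere 0 1 \<and>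
     (\<exists>H :: 'a \<Rightarrow> 'a \<Rightarrow>\<^sub>L 'a. continuous_on (sphere 0 1) H \<and>
        (\<forall>x\<in>sphere 0 1.
           (sphere_grad f has_derivative blinfun_apply (H x)) (at x within sphere 0 1)))"

text \<open>
  Complex-valued eigenfunctions; the Laplacian acts on the real and imaginary parts.  By elliptic
  regularity, asking for \<open>C\<^sup>2\<close> or for smooth eigenfunctions is the same.
\<close>

definition eigenfunction :: "real \<Rightarrow> ('a::euclidean_space \<Rightarrow> complex) \<Rightarrow> bool" where
  "eigenfunction lam e \<longleftrightarrow>
     sphere_C2 (\<lambda>x. Re (e x)) \<and> sphere_C2 (\<lambda>x. Im (e x)) \<and>
     (\<forall>x\<in>sphere 0 1.
        - Complex (laplace_beltrami (\<lambda>y. Re (e y)) x) (laplace_beltrami (\<lambda>y. Im (e y)) x)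
          = of_real (lam\<^sup>2) * e x) \<and>
     (\<exists>x\<in>sphere 0 1. e x \<noteq> 0)"

text \<open>
  The Riemannian volume of the sphere, through polar coordinates \<open>dx = t\<^sup>m dt dV\<close> in dimension
  \<open>m + 1\<close>: the volume of \<open>A\<close> is \<open>m + 1\<close> times the Lebesgue measure of the cone
  \<open>{t x | x \<in> A, 0 < t \<le> 1}\<close>.
\<close>

definition sphere_volume :: "'a::euclidean_space measure" where
  "sphere_volume =
     scale_measure (of_nat DIM('a))
       (distr (restrict_space lborel (cball 0 1 - {0})) (restrict_space borel (sphere 0 1))
          (\<lambda>x. x /\<^sub>R norm x))"

text \<open>
  Using \<open>has_integral\<close> rather than \<open>integral\<close> excludes curves of infinite length, for
  which the value of \<open>integral\<close> would be \<open>0\<close>.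
\<close>

definition geodesic_dist :: "'a::euclidean_space \<Rightarrow> 'a \<Rightarrow> real" where
  "geodesic_dist x y =
     Inf {L. \<exists>\<gamma>. \<gamma> piecewise_C1_differentiable_on {0..1} \<and> path_image \<gamma> \<subseteq> sphere 0 1 \<and>
                 pathstart \<gamma> = x \<and> pathfinish \<gamma> = y \<and>
                 ((\<lambda>t. norm (vector_derivative \<gamma> (at t))) has_integral L) {0..1}}"

definition geodesic_ball :: "'a::euclidean_space \<Rightarrow> real \<Rightarrow> 'a set" where
  "geodesic_ball z r = {x \<in> sphere 0 1. geodesic_dist z x < r}"

definition Lp_Carleson :: "real \<Rightarrow> (real \<Rightarrow> 'a::euclidean_space measure) \<Rightarrow> bool" where
  "Lp_Carleson p \<mu> \<longleftrightarrow>
     (\<exists>C>0. \<forall>lam\<ge>1. \<forall>e. eigenfunction lam e \<longrightarrow>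
        (\<integral>\<^sup>+x. ennreal (cmod (e x) powr p) \<partial>\<mu> lam)
          \<le> ennreal C * (\<integral>\<^sup>+x. ennreal (cmod (e x) powr p) \<partial>sphere_volume))"

text \<open>
  The parameter \<open>lam\<close> runs over the frequencies, the \<open>lam \<ge> 1\<close> for which \<open>lam\<^sup>2\<close> is an eigenvalue.
  For other \<open>lam\<close> the Carleson condition says nothing about \<open>\<mu> lam\<close>, so it could not imply
  a bound on it.
\<close>

definition frequencies :: "'a::euclidean_space itself \<Rightarrow> real set" where
  "frequencies _ = {lam. lam \<ge> 1 \<and> (\<exists>e :: 'a \<Rightarrow> complex. eigenfunction lam e)}"

definition relatively_sparse :: "(real \<Rightarrow> 'a::euclidean_space measure) \<Rightarrow> bool" where
  "relatively_sparse \<mu> \<longleftrightarrow>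
     (\<exists>r>0. \<exists>C>0. \<forall>lam\<in>frequencies TYPE('a). \<forall>z\<in>sphere 0 1.
        emeasure (\<mu> lam) (geodesic_ball z (r / lam))
          / emeasure sphere_volume (geodesic_ball z (r / lam)) \<le> ennreal C)"

end

theory Submission
  imports Defs
begin

text \<open>
  Throughout, \<open>n = m + 1\<close> is the dimension of the ambient space, \<open>f \<circ> sgn\<close> is the extension of
  a function \<open>f\<close> on the sphere that is constant along rays, and \<open>lam\<^sup>2\<close> is an eigenvalue.  The
  Laplacian of \<open>f \<circ> sgn\<close> at \<open>x\<close> is \<open>\<bar>x\<bar>\<^sup>-\<^sup>2\<close> times the spherical Laplacian of \<open>f\<close> at \<open>sgn x\<close>, so all
  questions about eigenfunctions become questions in Euclidean space, where the main tool
  is that a compactly supported divergence has integral zero.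

  Sufficiency.  If \<open>\<alpha> (\<alpha> + n - 2) = lam\<^sup>2\<close>, then \<open>\<bar>x\<bar> powr \<alpha> * f (sgn x)\<close> is harmonic away from the
  origin.  Since \<open>\<alpha> \<le> lam\<close>, the factor \<open>\<bar>x\<bar> powr \<alpha>\<close> is bounded in the shell of width \<open>1 / lam\<close> about the
  sphere.  The mean value property in balls of radius \<open>\<epsilon> / lam\<close> and Jensen's inequality bound
  \<open>\<bar>f z\<bar> powr p\<close> by a multiple of the average of \<open>\<bar>f \<circ> sgn\<bar> powr p\<close> over such a ball.  Integrating this in \<open>z\<close>
  and exchanging the integrals leaves the mass of a ball of radius comparable to \<open>1 / lam\<close>, which
  the sparseness condition bounds by a multiple of \<open>lam\<^sup>-\<^sup>m\<close> (lemmas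
  \<open>weighted_mean_value\<close>, \<open>eigenfunction_sub_mean_value\<close> and \<open>carleson_of_ball_bound\<close>).

  Necessity.  The Carleson inequality is tested on the zonal eigenfunction \<open>P (x \<bullet> z)\<close>, where \<open>P\<close> is
  a Gegenbauer polynomial with \<open>P 1 = 1\<close>.  It is at least \<open>1 / 2\<close> on the geodesic ball of radius
  \<open>1 / (2 lam)\<close> about \<open>z\<close>.  An energy argument in Liouville normal form shows that it decays like
  \<open>(lam d) powr - ((m - 1) / 2)\<close> in the distance \<open>d\<close> to the poles \<open>z\<close> and \<open>- z\<close>.  As caps of radius \<open>d\<close>
  have volume of order \<open>d\<^sup>m\<close>, the dyadic sum for the integral of its \<open>p\<close>-th power converges
  exactly when \<open>p > 2 m / (m - 1)\<close>, and then the integral is at most a multiple of \<open>lam\<^sup>-\<^sup>m\<close>.  The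
  measure of the ball is therefore bounded by a multiple of its volume (lemmas
  \<open>gegenbauer_near_pole\<close>, \<open>gegenbauer_decay\<close> and \<open>zonal_powr_integral\<close>).

  The zonal eigenfunction exists because every eigenvalue is of the form \<open>j (j + n - 2)\<close>.  For an
  eigenfunction \<open>f\<close>, symmetry of the Laplacian gives a two-term recurrence for the moments of \<open>f\<close>
  against the powers \<open>(x \<bullet> w)\<^sup>j\<close>.  If \<open>lam\<^sup>2\<close> is none of these numbers, then all moments vanish, and
  \<open>f = 0\<close> by the Stone-Weierstrass theorem (proposition \<open>eigenvalue_quantised\<close>).
\<close>

section \<open>Gradient, divergence and Laplacian through the radial extension\<close>

abbreviation (input) sphere_borel :: "'a::euclidean_space measure" where
  "sphere_borel \<equiv> restrict_space borel (sphere 0 1)"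

lemma sgn_on_sphere [simp]: "norm x = 1 \<Longrightarrow> sgn (x::'a::real_normed_vector) = x"
  by (simp add: sgn_div_norm)

lemma has_derivative_sgn:
  fixes x :: "'a::euclidean_space"
  assumes "x \<noteq> 0"
  shows "(sgn has_derivative (\<lambda>v. (v - (sgn x \<bullet> v) *\<^sub>R sgn x) /\<^sub>R norm x)) (at x)"
proof -
  have "((\<lambda>y. inverse (norm y) *\<^sub>R y) has_derivative
          (\<lambda>v. inverse (norm x) *\<^sub>R v + (- (inverse (norm x) * (sgn x \<bullet> v) * inverse (norm x))) *\<^sub>R x)) (at x)"
    using assms
    by (auto intro!: derivative_eq_intros has_derivative_norm simp: inner_commute)
  moreover have "(\<lambda>v. inverse (norm x) *\<^sub>R v + (- (inverse (norm x) * (sgn x \<bullet> v) * inverse (norm x))) *\<^sub>R x)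
      = (\<lambda>v. (v - (sgn x \<bullet> v) *\<^sub>R sgn x) /\<^sub>R norm x)"
    by (auto simp: sgn_div_norm scaleR_diff_right fun_eq_iff mult_ac)
  ultimately show ?thesis by (simp add: sgn_div_norm[abs_def])
qed

text \<open>
  The radial projection maps a full neighbourhood of \<open>x\<close> into the sphere, so a derivative within the
  sphere turns into an ordinary derivative.  This is the bridge from the sphere to Euclidean space.
\<close>

lemma has_derivative_compose_sgn:
  fixes x :: "'a::euclidean_space" and f :: "'a \<Rightarrow> 'b::real_normed_vector"
  assumes "x \<noteq> 0" and "(f has_derivative D) (at (sgn x) within sphere 0 1)"
  shows "((\<lambda>y. f (sgn y)) has_derivative
            (\<lambda>v. D ((v - (sgn x \<bullet> v) *\<^sub>R sgn x) /\<^sub>R norm x))) (at x)"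
proof -
  have 1: "(sgn has_derivative (\<lambda>v. (v - (sgn x \<bullet> v) *\<^sub>R sgn x) /\<^sub>R norm x)) (at x within -{0})"
    using has_derivative_sgn[OF assms(1)] has_derivative_at_withinI by blast
  have "(f has_derivative D) (at (sgn x) within sgn ` (-{0}))"
    by (rule has_derivative_subset[OF assms(2)]) (auto simp: norm_sgn split: if_splits)
  from has_derivative_in_compose[OF 1 this] show ?thesis
    using assms(1) by (subst (asm) at_within_open) auto
qed

text \<open>
  Ordinary derivatives are unique, and the derivative of \<open>f \<circ> sgn\<close> at a point of the sphere is \<open>D\<close>
  after the projection to the tangent space.
\<close>

lemma sphere_derivative_tangential_unique:
  fixes x :: "'a::euclidean_space"
  assumes x: "norm x = 1" and "(f has_derivative D) (at x within sphere 0 1)"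
    and "(f has_derivative D') (at x within sphere 0 1)"
  shows "D (v - (x \<bullet> v) *\<^sub>R x) = D' (v - (x \<bullet> v) *\<^sub>R x)"
proof -
  have "x \<noteq> 0" using x by auto
  then have "(\<lambda>v. D ((v - (sgn x \<bullet> v) *\<^sub>R sgn x) /\<^sub>R norm x))
      = (\<lambda>v. D' ((v - (sgn x \<bullet> v) *\<^sub>R sgn x) /\<^sub>R norm x))"
    using assms by (intro has_derivative_unique[OF has_derivative_compose_sgn has_derivative_compose_sgn]) auto
  then show ?thesis using x by (auto dest: fun_cong[of _ _ v])
qed

lemma has_derivative_sphere_tangential:
  fixes x :: "'a::euclidean_space" and f :: "'a \<Rightarrow> 'b::real_normed_vector"
  assumes x: "norm x = 1" and "(f has_derivative D) (at x within sphere 0 1)"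
  shows "(f has_derivative (\<lambda>v. D (v - (x \<bullet> v) *\<^sub>R x))) (at x within sphere 0 1)"
proof -
  have "x \<noteq> 0" using x by auto
  then have "((\<lambda>y. f (sgn y)) has_derivative (\<lambda>v. D (v - (x \<bullet> v) *\<^sub>R x))) (at x within sphere 0 1)"
    using has_derivative_compose_sgn[of x f D] assms by (auto intro: has_derivative_at_withinI)
  then show ?thesis
    by (rule has_derivative_transform[rotated 2]) (use x in auto)
qed

lemma sphere_grad_unique:
  fixes x :: "'a::euclidean_space"
  assumes x: "norm x = 1" and g: "g \<bullet> x = 0" "(f has_derivative (\<lambda>v. g \<bullet> v)) (at x within sphere 0 1)"
  shows "sphere_grad f x = g"
  unfolding sphere_grad_def
proof (rule the_equality)
  fix h assume h: "h \<bullet> x = 0 \<and> (f has_derivative (\<lambda>v. h \<bullet> v)) (at x within sphere 0 1)"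
  have "h \<bullet> v = g \<bullet> v" for v
    using sphere_derivative_tangential_unique[OF x g(2) conjunct2[OF h], of v] h g(1)
    by (simp add: inner_diff_right)
  then show "h = g" by (metis vector_eq_rdot)
qed (use g in auto)

text \<open>
  The projected derivative kills \<open>x\<close>, and it is represented by a vector orthogonal to \<open>x\<close>.
\<close>

lemma sphere_grad_properties:
  fixes x :: "'a::euclidean_space"
  assumes x: "norm x = 1" and f: "f differentiable (at x within sphere 0 1)"
  shows "sphere_grad f x \<bullet> x = 0"
    and "(f has_derivative (\<lambda>v. sphere_grad f x \<bullet> v)) (at x within sphere 0 1)"
proof -
  obtain D where D: "(f has_derivative D) (at x within sphere 0 1)"
    using f by (auto simp: differentiable_def)
  define D' where "D' v = D (v - (x \<bullet> v) *\<^sub>R x)" for v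
  have D': "(f has_derivative D') (at x within sphere 0 1)"
    using has_derivative_sphere_tangential[OF x D] by (simp add: D'_def[abs_def])
  then interpret linear D' by (rule has_derivative_linear)
  define g where "g = (\<Sum>b\<in>Basis. D' b *\<^sub>R b)"
  have g: "g \<bullet> v = D' v" for v
  proof -
    have "D' v = D' (\<Sum>b\<in>Basis. (v \<bullet> b) *\<^sub>R b)" by (simp add: euclidean_representation)
    also have "\<dots> = (\<Sum>b\<in>Basis. (v \<bullet> b) * D' b)" by (simp add: sum scale)
    also have "\<dots> = g \<bullet> v" by (simp add: g_def inner_sum_left inner_commute[of v] mult.commute)
    finally show ?thesis by simp
  qed
  interpret D: linear D using D by (rule has_derivative_linear)
  have "x \<bullet> x = 1" using x by (simp add: dot_square_norm)
  then have "g \<bullet> x = 0" by (simp add: g D'_def D.zero)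
  moreover have "(f has_derivative (\<lambda>v. g \<bullet> v)) (at x within sphere 0 1)"
    using D' by (simp add: g)
  moreover from calculation have "sphere_grad f x = g" using sphere_grad_unique[OF x] by blast
  ultimately show "sphere_grad f x \<bullet> x = 0"
    "(f has_derivative (\<lambda>v. sphere_grad f x \<bullet> v)) (at x within sphere 0 1)" by auto
qed

text \<open>
  Among the derivatives of \<open>X\<close> within the sphere, the one that kills \<open>x\<close> is \<open>D\<close> after the projection
  to the tangent space, so the definite description is a trace of \<open>D\<close>.
\<close>

lemma sphere_div_eq:
  fixes x :: "'a::euclidean_space"
  assumes x: "norm x = 1" and X: "(X has_derivative D) (at x within sphere 0 1)"
  shows "sphere_div X x = (\<Sum>b\<in>Basis. D (b - (x \<bullet> b) *\<^sub>R x) \<bullet> b)"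
  unfolding sphere_div_def
proof (rule the_equality)
  interpret linear D using X by (rule has_derivative_linear)
  have xx: "x \<bullet> x = 1" using x by (simp add: dot_square_norm)
  show "\<exists>D'. (X has_derivative D') (at x within sphere 0 1) \<and> D' x = 0 \<and>
        (\<Sum>b\<in>Basis. D (b - (x \<bullet> b) *\<^sub>R x) \<bullet> b) = (\<Sum>b\<in>Basis. D' b \<bullet> b)"
    by (rule exI[of _ "\<lambda>v. D (v - (x \<bullet> v) *\<^sub>R x)"])
       (use has_derivative_sphere_tangential[OF x X] xx in \<open>simp add: zero\<close>)
  fix d assume "\<exists>D'. (X has_derivative D') (at x within sphere 0 1) \<and> D' x = 0 \<and>
        d = (\<Sum>b\<in>Basis. D' b \<bullet> b)"
  then obtain D' where D': "(X has_derivative D') (at x within sphere 0 1)" "D' x = 0"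
    and d: "d = (\<Sum>b\<in>Basis. D' b \<bullet> b)" by auto
  interpret D': linear D' using D'(1) by (rule has_derivative_linear)
  have "D' v = D (v - (x \<bullet> v) *\<^sub>R x)" for v
    using sphere_derivative_tangential_unique[OF x X D'(1), of v] D'(2)
    by (simp add: D'.diff D'.scale)
  then show "d = (\<Sum>b\<in>Basis. D (b - (x \<bullet> b) *\<^sub>R x) \<bullet> b)" by (simp add: d)
qed

definition trace_map :: "('a::euclidean_space \<Rightarrow> 'a) \<Rightarrow> real" where
  "trace_map D = (\<Sum>b\<in>Basis. D b \<bullet> b)"

lemma trace_map_add: "trace_map (\<lambda>v. A v + B v) = trace_map A + trace_map B"
  by (simp add: trace_map_def inner_add_left sum.distrib)
lemma trace_map_diff: "trace_map (\<lambda>v. A v - B v) = trace_map A - trace_map B"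
  by (simp add: trace_map_def inner_diff_left sum_subtractf)
lemma trace_map_scaleR: "trace_map (\<lambda>v. c *\<^sub>R A v) = c * trace_map A"
  by (simp add: trace_map_def sum_distrib_left)
lemma trace_map_rank_one: "trace_map (\<lambda>v. (c \<bullet> v) *\<^sub>R w) = c \<bullet> w"
  by (subst euclidean_inner) (simp add: trace_map_def inner_commute mult.commute)
lemma trace_map_id: "trace_map (\<lambda>v::'a::euclidean_space. v) = DIM('a)"
  by (simp add: trace_map_def inner_same_Basis)

lemmas trace_map_simps = trace_map_add trace_map_diff trace_map_scaleR trace_map_rank_one trace_map_id

text \<open>
  The Euclidean gradient of \<open>f \<circ> sgn\<close> away from the origin.
\<close>

definition ext_grad :: "('a::euclidean_space \<Rightarrow> real) \<Rightarrow> 'a \<Rightarrow> 'a" where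
  "ext_grad f x = sphere_grad f (sgn x) /\<^sub>R norm x"

lemma continuous_on_sgn_punctured:
  "continuous_on (-{0}) (sgn :: 'a::euclidean_space \<Rightarrow> 'a)"
  by (auto intro!: continuous_at_imp_continuous_on has_derivative_continuous[OF has_derivative_sgn])

lemma sphere_C2_continuous: "sphere_C2 f \<Longrightarrow> continuous_on (sphere 0 1) f"
  by (simp add: sphere_C2_def differentiable_imp_continuous_on)

lemma sphere_C2_ext_continuous:
  assumes "sphere_C2 (f::'a::euclidean_space \<Rightarrow> real)"
  shows "continuous_on (-{0}) (\<lambda>x. f (sgn x))"
  using sphere_C2_continuous[OF assms]
  by (rule continuous_on_compose2[OF _ continuous_on_sgn_punctured]) (auto simp: norm_sgn split: if_splits)

lemma sphere_C2_has_gradient: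
  fixes x :: "'a::euclidean_space"
  assumes "sphere_C2 f" "x \<noteq> 0"
  shows "x \<bullet> ext_grad f x = 0"
    and "((\<lambda>y. f (sgn y)) has_derivative (\<lambda>v. ext_grad f x \<bullet> v)) (at x)"
proof -
  have 1: "norm (sgn x) = 1" using assms(2) by (simp add: norm_sgn)
  have 2: "f differentiable (at (sgn x) within sphere 0 1)"
    using assms(1) 1 by (simp add: sphere_C2_def differentiable_on_def)
  note g = sphere_grad_properties[OF 1 2]
  show "x \<bullet> ext_grad f x = 0"
    using g(1) assms(2) by (simp add: ext_grad_def inner_commute sgn_div_norm)
  show "((\<lambda>y. f (sgn y)) has_derivative (\<lambda>v. ext_grad f x \<bullet> v)) (at x)"
    using has_derivative_compose_sgn[OF assms(2) g(2)] g(1)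
    by (simp add: ext_grad_def inner_diff_right)
qed

text \<open>
  The derivative of \<open>x \<mapsto> ext_grad f x\<close> is the tangential derivative of the spherical gradient, whose
  trace is the Laplacian, up to a rank-one term from the factor \<open>1 / \<bar>x\<bar>\<close>.  The latter has trace zero
  because the gradient is tangential.
\<close>

lemma sphere_C2_hessian:
  fixes f :: "'a::euclidean_space \<Rightarrow> real"
  assumes f: "sphere_C2 f"
  obtains G where
    "\<And>x. x \<noteq> 0 \<Longrightarrow> (ext_grad f has_derivative G x) (at x)"
    "\<And>b. continuous_on (-{0}) (\<lambda>x. G x b)"
    "\<And>x. x \<noteq> 0 \<Longrightarrow> trace_map (G x) = laplace_beltrami f (sgn x) / (norm x)\<^sup>2"
proof -
  from f obtain H :: "'a \<Rightarrow> 'a \<Rightarrow>\<^sub>L 'a" where Hc: "continuous_on (sphere 0 1) H"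
    and H: "\<And>x. norm x = 1 \<Longrightarrow>
           (sphere_grad f has_derivative blinfun_apply (H x)) (at x within sphere 0 1)"
    by (auto simp: sphere_C2_def)
  define G where "G x v = H (sgn x) ((v - (sgn x \<bullet> v) *\<^sub>R sgn x) /\<^sub>R norm x) /\<^sub>R norm x
        - (sgn x \<bullet> v) *\<^sub>R (sphere_grad f (sgn x) /\<^sub>R (norm x)\<^sup>2)" for x v
  have gradc: "continuous_on (sphere 0 1) (sphere_grad f)"
    by (rule has_derivative_continuous_on) (use H in auto)
  show ?thesis
  proof (rule that[of G])
    fix x :: 'a assume x: "x \<noteq> 0"
    then have 1: "norm (sgn x) = 1" by (simp add: norm_sgn)
    show "(ext_grad f has_derivative G x) (at x)"
      unfolding ext_grad_def[abs_def] G_def[abs_def]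
      using x
      by (auto intro!: derivative_eq_intros has_derivative_compose_sgn[OF x H[OF 1]] has_derivative_norm[OF x]
         simp: power2_eq_square fun_eq_iff inner_commute mult_ac)
    have 2: "f differentiable (at (sgn x) within sphere 0 1)"
      using f 1 by (simp add: sphere_C2_def differentiable_on_def)
    have "trace_map (G x) = trace_map (\<lambda>v. H (sgn x) (v - (sgn x \<bullet> v) *\<^sub>R sgn x)) /(norm x)\<^sup>2"
      unfolding G_def[abs_def] trace_map_simps
      using sphere_grad_properties(1)[OF 1 2]
      by (simp add: blinfun.scaleR_right trace_map_simps power2_eq_square inner_commute divide_inverse)
    then show "trace_map (G x) = laplace_beltrami f (sgn x) / (norm x)\<^sup>2"
      by (simp add: laplace_beltrami_def sphere_div_eq[OF 1 H[OF 1]] trace_map_def)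
  next
    fix b
    have c1: "continuous_on (-{0}) (\<lambda>x::'a. H (sgn x))"
      by (rule continuous_on_compose2[OF Hc continuous_on_sgn_punctured]) (auto simp: norm_sgn split: if_splits)
    have c2: "continuous_on (-{0}) (\<lambda>x::'a. sphere_grad f (sgn x))"
      by (rule continuous_on_compose2[OF gradc continuous_on_sgn_punctured]) (auto simp: norm_sgn split: if_splits)
    show "continuous_on (-{0}) (\<lambda>x. G x b)"
      unfolding G_def by (intro continuous_intros c1 c2 continuous_on_sgn_punctured) auto
  qed
qed

lemma has_derivative_poly_inner:
  "((\<lambda>x. poly q (x \<bullet> z)) has_derivative (\<lambda>v. poly (pderiv q) (x \<bullet> z) * (v \<bullet> z))) (at x within S)"
  using DERIV_compose_FDERIV[OF poly_DERIV has_derivative_inner_left[OF has_derivative_ident], of q z x S]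
  by (simp add: mult.commute)

text \<open>
  The gradient of \<open>q (x \<bullet> z)\<close> is \<open>q' (x \<bullet> z)\<close> times the tangential part of \<open>z\<close>; differentiating
  once more gives the Gegenbauer operator in the height \<open>x \<bullet> z\<close>.
\<close>

lemma zonal_calculus:
  fixes z :: "'a::euclidean_space" and q :: "real poly"
  assumes z: "norm z = 1"
  defines "f \<equiv> \<lambda>x. poly q (x \<bullet> z)"
  shows "sphere_C2 f"
    and "x \<in> sphere 0 1 \<Longrightarrow> laplace_beltrami f x =
      (1 - (x \<bullet> z)\<^sup>2) * poly (pderiv (pderiv q)) (x \<bullet> z)
        - (real DIM('a) - 1) * (x \<bullet> z) * poly (pderiv q) (x \<bullet> z)"
proof -
  define g where "g x = poly (pderiv q) (x \<bullet> z) *\<^sub>R (z - (x \<bullet> z) *\<^sub>R x)" for x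
  have df: "(f has_derivative (\<lambda>v. g x \<bullet> v)) (at x within sphere 0 1)" if "norm x = 1" for x
  proof -
    have "(f has_derivative (\<lambda>v. poly (pderiv q) (x \<bullet> z) * (v \<bullet> z))) (at x within sphere 0 1)"
      unfolding f_def by (rule has_derivative_poly_inner)
    from has_derivative_sphere_tangential[OF that this] show ?thesis
      by (rule has_derivative_eq_rhs)
         (auto simp: g_def fun_eq_iff inner_diff_left inner_commute algebra_simps)
  qed
  have gx: "g x \<bullet> x = 0" if "norm x = 1" for x
    using that by (simp add: g_def inner_commute[of _ x] inner_diff_right dot_square_norm)
  have grad: "sphere_grad f x = g x" if "norm x = 1" for x
    using sphere_grad_unique[OF that gx df] that by auto
  define D where "D x v = (poly (pderiv (pderiv q)) (x \<bullet> z) * (z \<bullet> v)) *\<^sub>R (z - (x \<bullet> z) *\<^sub>R x)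
      - poly (pderiv q) (x \<bullet> z) *\<^sub>R ((z \<bullet> v) *\<^sub>R x + (x \<bullet> z) *\<^sub>R v)" for x v
  have dg0: "(g has_derivative D x) (at x within sphere 0 1)" for x
    unfolding g_def[abs_def] D_def[abs_def]
    by (auto intro!: derivative_eq_intros has_derivative_poly_inner
        simp: inner_commute algebra_simps)
  have dg: "(sphere_grad f has_derivative D x) (at x within sphere 0 1)" if "norm x = 1" for x
    by (rule has_derivative_transform[OF _ _ dg0]) (use grad that in auto)
  have blD: "bounded_linear (D x)" for x using dg0 has_derivative_bounded_linear by blast
  have cH: "continuous_on (sphere 0 1) (\<lambda>x. Blinfun (D x))"
    unfolding continuous_on_eq_continuous_within
  proof (intro ballI continuous_blinfun_componentwiseI1)
    fix b x :: 'a assume "x \<in> sphere 0 1"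
    have "continuous_on (sphere 0 1) (\<lambda>x. D x b)"
      unfolding D_def by (intro continuous_intros)
    then show "continuous (at x within sphere 0 1) (\<lambda>x. blinfun_apply (Blinfun (D x)) b)"
      using \<open>x \<in> sphere 0 1\<close>
      by (simp add: bounded_linear_Blinfun_apply[OF blD] continuous_on_eq_continuous_within)
  qed
  show "sphere_C2 f"
    unfolding sphere_C2_def
  proof (intro conjI exI[of _ "\<lambda>x. Blinfun (D x)"] ballI)
    show "f differentiable_on sphere 0 1"
      using df by (fastforce simp: differentiable_on_def differentiable_def)
  qed (use cH dg in \<open>auto simp: bounded_linear_Blinfun_apply[OF blD]\<close>)
  assume "x \<in> sphere 0 1"
  then have x: "norm x = 1" by simp
  have xx: "x \<bullet> x = 1" "z \<bullet> z = 1" using x z by (simp_all add: dot_square_norm)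
  interpret bounded_linear "D x" by (rule blD)
  have "laplace_beltrami f x = trace_map (\<lambda>v. D x (v - (x \<bullet> v) *\<^sub>R x))"
    by (simp add: laplace_beltrami_def sphere_div_eq[OF x dg[OF x]] trace_map_def)
  also have "\<dots> = trace_map (D x) - D x x \<bullet> x"
    unfolding diff scaleR trace_map_simps by (simp add: inner_commute)
  also have "trace_map (D x) = poly (pderiv (pderiv q)) (x \<bullet> z) * (1 - (x \<bullet> z)\<^sup>2)
     - poly (pderiv q) (x \<bullet> z) * (x \<bullet> z + (x \<bullet> z) * DIM('a))"
    unfolding D_def[abs_def] scaleR_scaleR[symmetric] trace_map_simps
    using xx by (simp add: inner_diff_right inner_commute power2_eq_square)
  also have "D x x \<bullet> x = - poly (pderiv q) (x \<bullet> z) * 2 * (x \<bullet> z)"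
    using xx by (simp add: D_def inner_diff_left inner_add_left inner_commute[of z x])
  finally show "laplace_beltrami f x =
      (1 - (x \<bullet> z)\<^sup>2) * poly (pderiv (pderiv q)) (x \<bullet> z)
        - (real DIM('a) - 1) * (x \<bullet> z) * poly (pderiv q) (x \<bullet> z)"
    by (simp add: algebra_simps)
qed

section \<open>The divergence theorem for compactly supported fields\<close>

text \<open>
  By translation invariance the difference quotients of \<open>f\<close> have integral zero, and they converge
  to \<open>g\<close> boundedly on a fixed ball.
\<close>

lemma integral_directional_derivative_eq_0:
  fixes f g :: "'a::euclidean_space \<Rightarrow> real"
  assumes f: "\<And>x. ((\<lambda>t. f (x + t *\<^sub>R b)) has_real_derivative g x) (at 0)"
    and cont: "continuous_on UNIV f"
    and supp: "\<And>x. x \<notin> cball 0 R \<Longrightarrow> f x = 0"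
    and bound: "\<And>x. \<bar>g x\<bar> \<le> B"
  shows "integrable lborel g \<and> integral\<^sup>L lborel g = 0"
proof -
  have fi: "integrable lborel f"
  proof -
    have "integrable lborel (\<lambda>x. indicator (cball 0 R) x *\<^sub>R f x)"
      by (rule borel_integrable_compact) (auto intro: continuous_on_subset[OF cont])
    moreover have "(\<lambda>x. indicator (cball 0 R) x *\<^sub>R f x) = f"
      using supp by (auto simp: fun_eq_iff indicator_def)
    ultimately show ?thesis by simp
  qed
  have shift: "integrable lborel (\<lambda>x. f (v + x)) \<and> (\<integral>x. f (v + x) \<partial>lborel) = integral\<^sup>L lborel f" for v
  proof
    have "integrable (distr lborel borel ((+) v)) f" using fi by (simp add: lborel_distr_plus)
    then show "integrable lborel (\<lambda>x. f (v + x))" by (intro integrable_distr[of "(+) v" lborel borel f]) auto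
    show "(\<integral>x. f (v + x) \<partial>lborel) = integral\<^sup>L lborel f"
      using integral_distr[of "(+) v" lborel borel f] fi by (simp add: lborel_distr_plus)
  qed
  define h where "h i = inverse (real (Suc i))" for i
  define s where "s i x = (f (h i *\<^sub>R b + x) - f x) / h i" for i x
  have B0: "0 \<le> B" using bound[of 0] by linarith
  have hpos: "0 < h i" "h i \<le> 1" for i by (auto simp: h_def field_simps)
  have s0: "integral\<^sup>L lborel (s i) = 0" "integrable lborel (s i)" for i
    unfolding s_def[abs_def] using shift[of "h i *\<^sub>R b"] fi by auto
  have deriv: "((\<lambda>t. f (x + t *\<^sub>R b)) has_real_derivative g (x + t *\<^sub>R b)) (at t)" for x t
  proof -
    have "((\<lambda>u. (\<lambda>r. f (x + t *\<^sub>R b + r *\<^sub>R b)) (u - t)) has_real_derivative g (x + t *\<^sub>R b) * 1) (at t)"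
      by (rule DERIV_chain2[where g="\<lambda>u. u - t"]) (use f in \<open>auto intro!: derivative_eq_intros\<close>)
    then show ?thesis by (simp add: algebra_simps)
  qed
  have lim: "(\<lambda>i. s i x) \<longlonglongrightarrow> g x" for x
  proof -
    have "((\<lambda>t. (f (x + t *\<^sub>R b) - f x) / t) \<longlongrightarrow> g x) (at 0)"
      using f[of x] by (simp add: has_field_derivative_iff)
    moreover have "filterlim h (at 0) sequentially"
      unfolding filterlim_at using hpos(1) LIMSEQ_inverse_real_of_nat
      by (auto simp: h_def[abs_def])
    ultimately show ?thesis
      unfolding s_def[abs_def] using filterlim_compose[of "\<lambda>t. (f (x + t *\<^sub>R b) - f x) / t"] by (simp add: add.commute)
  qed
  \<comment> \<open>Both \<open>x\<close> and \<open>x + h b\<close> with \<open>h \<le> 1\<close> are outside the support once \<open>\<bar>x\<bar> > R + \<bar>b\<bar>\<close>.\<close>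
  have sb: "norm (s i x) \<le> indicator (cball 0 (R + norm b)) x * B" for i x
  proof (cases "x \<in> cball 0 (R + norm b)")
    case True
    obtain t where "f (x + h i *\<^sub>R b) - f (x + 0 *\<^sub>R b) = (h i - 0) * g (x + t *\<^sub>R b)"
      using MVT2[of 0 "h i" "\<lambda>t. f (x + t *\<^sub>R b)" "\<lambda>t. g (x + t *\<^sub>R b)"] hpos deriv by blast
    then have "s i x = g (x + t *\<^sub>R b)" using hpos(1)[of i] by (simp add: s_def add.commute)
    then show ?thesis using True bound by simp
  next
    case False
    then have 1: "norm x > R + norm b" by (simp add: dist_norm)
    have "norm (h i *\<^sub>R b) \<le> norm b" using hpos[of i] by (simp add: mult_left_le_one_le)
    then have "norm (h i *\<^sub>R b + x) > R"
      using norm_triangle_ineq2[of x "- (h i *\<^sub>R b)"] 1 by (simp add: add.commute)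
    moreover have "norm x > R" using 1 norm_ge_zero[of b] by linarith
    ultimately have "f (h i *\<^sub>R b + x) = 0" "f x = 0" using supp by (auto simp: dist_norm)
    then show ?thesis using B0 by (simp add: s_def)
  qed
  have gm: "g \<in> borel_measurable lborel"
    by (rule borel_measurable_LIMSEQ_real[OF lim]) (use s0 in auto)
  have Bi: "integrable lborel (\<lambda>x::'a. indicator (cball 0 (R + norm b)) x * B)"
    by (intro integrable_mult_left integrable_real_indicator)
       (use emeasure_lborel_cball_finite[of "0::'a" "R + norm b"] in auto)
  have "integrable lborel g" "(\<lambda>i. integral\<^sup>L lborel (s i)) \<longlonglongrightarrow> integral\<^sup>L lborel g"
    using integrable_dominated_convergence[OF gm _ Bi, of s] integral_dominated_convergence[OF gm _ Bi, of s]
      s0(2) lim sb by auto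
  then show ?thesis using s0(1) by (simp add: LIMSEQ_const_iff)
qed

text \<open>
  As \<open>F\<close> vanishes off \<open>K\<close>, it is differentiable everywhere even if the open set \<open>U\<close> is not the whole
  space; this permits fields that are singular at the origin.
\<close>

lemma integral_divergence_eq_0:
  fixes F :: "'a::euclidean_space \<Rightarrow> 'a"
  assumes U: "open U" and K: "compact K" "K \<subseteq> U"
    and dF: "\<And>x. x \<in> U \<Longrightarrow> (F has_derivative F' x) (at x)"
    and zero: "\<And>x. x \<notin> K \<Longrightarrow> F x = 0"
    and cont: "\<And>b. b \<in> Basis \<Longrightarrow> continuous_on K (\<lambda>x. F' x b \<bullet> b)"
  shows "((\<lambda>x. if x \<in> K then \<Sum>b\<in>Basis. F' x b \<bullet> b else 0) has_integral 0) UNIV"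
proof -
  have dF0: "(F has_derivative (\<lambda>_. 0)) (at x)" if "x \<notin> K" for x
  proof -
    have "((\<lambda>_. 0) has_derivative (\<lambda>_. 0)) (at x)" by simp
    then show ?thesis
      by (rule has_derivative_transform_within_open[of _ _ _ _ "-K"]) (use that K zero in \<open>auto simp: compact_imp_closed\<close>)
  qed
  obtain R where R: "K \<subseteq> cball 0 R"
    using compact_imp_bounded[OF K(1)] by (auto simp: bounded_iff subset_iff)
  have cF: "continuous_on UNIV F"
  proof (rule continuous_at_imp_continuous_on, rule ballI)
    fix x show "isCont F x"
      using dF[of x] dF0[of x] K(2) has_derivative_continuous[of F _ x UNIV] by (cases "x \<in> K") auto
  qed
  have *: "integrable lborel (\<lambda>x. if x \<in> K then F' x b \<bullet> b else 0) \<and>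
        integral\<^sup>L lborel (\<lambda>x. if x \<in> K then F' x b \<bullet> b else 0) = 0" if b: "b \<in> Basis" for b
  proof -
    obtain B where B: "\<And>x. x \<in> K \<Longrightarrow> \<bar>F' x b \<bullet> b\<bar> \<le> B"
      using compact_imp_bounded[OF compact_continuous_image[OF cont[OF b] K(1)]]
      by (auto simp: bounded_iff)
    show ?thesis
    proof (rule integral_directional_derivative_eq_0[where f="\<lambda>x. F x \<bullet> b" and b=b and R=R and B="max 0 B"])
      fix x
      define G where "G = (if x \<in> K then F' x else (\<lambda>_. 0))"
      have G: "(F has_derivative G) (at (x + 0 *\<^sub>R b))"
        using dF[of x] dF0[of x] K(2) by (auto simp: G_def)
      have line: "((\<lambda>t. x + t *\<^sub>R b) has_derivative (\<lambda>t. t *\<^sub>R b)) (at 0)"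
        by (auto intro!: derivative_eq_intros)
      have "((\<lambda>t. F (x + t *\<^sub>R b) \<bullet> b) has_derivative (\<lambda>t. G (t *\<^sub>R b) \<bullet> b)) (at 0)"
        using has_derivative_inner_left[OF has_derivative_compose[OF line, of F G], of b] G by simp
      moreover have "linear G" using G has_derivative_linear by blast
      then have "(\<lambda>t. G (t *\<^sub>R b) \<bullet> b) = (*) (G b \<bullet> b)"
        by (auto simp: linear_scale)
      ultimately show "((\<lambda>t. F (x + t *\<^sub>R b) \<bullet> b) has_real_derivative
              (if x \<in> K then F' x b \<bullet> b else 0)) (at 0)"
        by (simp add: has_field_derivative_def G_def split: if_splits)
    next
      show "continuous_on UNIV (\<lambda>x. F x \<bullet> b)" by (intro continuous_intros cF)
    next
      show "F x \<bullet> b = 0" if "x \<notin> cball 0 R" for x using that R zero by (metis inner_zero_left subsetD)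
    next
      show "\<bar>if x \<in> K then F' x b \<bullet> b else 0\<bar> \<le> max 0 B" for x using B[of x] by auto
    qed
  qed
  have eq: "(\<lambda>x. if x \<in> K then \<Sum>b\<in>Basis. F' x b \<bullet> b else 0)
      = (\<lambda>x. \<Sum>b\<in>Basis. if x \<in> K then F' x b \<bullet> b else 0)" by auto
  have "((\<lambda>x. \<Sum>b\<in>Basis. if x \<in> K then F' x b \<bullet> b else 0) has_integral (\<Sum>b::'a\<in>Basis. 0)) UNIV"
  proof (rule has_integral_sum)
    fix b :: 'a assume "b \<in> Basis"
    from *[OF this] has_integral_integral_lborel
    show "((\<lambda>x. if x \<in> K then F' x b \<bullet> b else 0) has_integral 0) UNIV" by metis
  qed simp
  then show ?thesis by (simp add: eq)
qed

text \<open>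
  The square of the positive part is the source of the continuously differentiable cut-offs below.
\<close>

lemma DERIV_max0_power2:
  "((\<lambda>s::real. (max 0 s)\<^sup>2) has_real_derivative 2 * max 0 s) (at s)"
proof -
  consider "s < 0" | "s > 0" | "s = 0" by linarith
  then show ?thesis
  proof cases
    case 1
    have "((\<lambda>s::real. 0) has_real_derivative 0) (at s)" by simp
    then have "((\<lambda>s::real. (max 0 s)\<^sup>2) has_real_derivative 0) (at s)"
      by (rule DERIV_cong_ev[THEN iffD1, rotated -1])
         (use 1 in \<open>auto simp: eventually_nhds intro!: exI[of _ "{..<0}"]\<close>)
    then show ?thesis using 1 by simp
  next
    case 2
    have "((\<lambda>s::real. s\<^sup>2) has_real_derivative 2 * s) (at s)" by (auto intro!: derivative_eq_intros)
    then have "((\<lambda>s::real. (max 0 s)\<^sup>2) has_real_derivative 2 * s) (at s)"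
      by (rule DERIV_cong_ev[THEN iffD1, rotated -1])
         (use 2 in \<open>auto simp: eventually_nhds intro!: exI[of _ "{0<..}"]\<close>)
    then show ?thesis using 2 by simp
  next
    case 3
    have "((\<lambda>t::real. (max 0 t)\<^sup>2 / t) \<longlongrightarrow> 0) (at 0)"
    proof (rule Lim_null_comparison[of _ "\<lambda>t. \<bar>t\<bar>"])
      show "\<forall>\<^sub>F t::real in at 0. norm ((max 0 t)\<^sup>2 / t) \<le> \<bar>t\<bar>"
        by (rule always_eventually) (auto simp: max_def power2_eq_square)
      show "((\<lambda>t::real. \<bar>t\<bar>) \<longlongrightarrow> 0) (at 0)" by (auto intro!: tendsto_eq_intros)
    qed
    then show ?thesis using 3 by (simp add: has_field_derivative_iff)
  qed
qed

section \<open>Harmonic extensions and a weighted mean value property\<close>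

text \<open>
  The Laplacian acts separately on real and imaginary parts, so it is enough to study real functions.
  The zero function is admitted, since one of the two parts may vanish.
\<close>

definition real_eigenfunction :: "real \<Rightarrow> ('a::euclidean_space \<Rightarrow> real) \<Rightarrow> bool" where
  "real_eigenfunction lam f \<longleftrightarrow> sphere_C2 f \<and> (\<forall>x\<in>sphere 0 1. laplace_beltrami f x = - (lam\<^sup>2) * f x)"

lemma has_derivative_norm_powr:
  fixes x :: "'a::euclidean_space"
  assumes "x \<noteq> 0"
  shows "((\<lambda>y. norm y powr \<beta>) has_derivative (\<lambda>v. \<beta> * norm x powr (\<beta> - 2) * (x \<bullet> v))) (at x)"
proof -
  have "((\<lambda>y. norm y powr \<beta>) has_derivative (\<lambda>v. (sgn x \<bullet> v) * (\<beta> * norm x powr (\<beta> - 1)))) (at x)"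
  proof -
    have "((\<lambda>z. z powr \<beta>) has_real_derivative \<beta> * norm x powr (\<beta> - 1)) (at (norm x))"
      using assms by (intro has_real_derivative_powr) simp
    from DERIV_compose_FDERIV[OF this has_derivative_norm[OF assms]] show ?thesis
      by (simp add: inner_commute)
  qed
  moreover have "norm x powr (\<beta> - 1) = norm x powr (\<beta> - 2) * norm x"
    using assms powr_add[of "norm x" "\<beta> - 2" 1] by simp
  then have "(sgn x \<bullet> v) * (\<beta> * norm x powr (\<beta> - 1)) = \<beta> * norm x powr (\<beta> - 2) * (x \<bullet> v)" for v
    using assms by (simp add: sgn_div_norm)
  ultimately show ?thesis by (simp only:)
qed

text \<open>
  The degree \<open>\<alpha>\<close> is chosen such that the Laplacian of \<open>\<bar>x\<bar> powr \<alpha>\<close>, which is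
  \<open>\<alpha> (\<alpha> + n - 2) \<bar>x\<bar> powr (\<alpha> - 2)\<close>, cancels the term \<open>- lam\<^sup>2 \<bar>x\<bar> powr (\<alpha> - 2)\<close> from the sphere.  The
  mixed term vanishes because the gradient of \<open>f \<circ> sgn\<close> is orthogonal to \<open>x\<close>.
\<close>

lemma harmonic_extension:
  fixes f :: "'a::euclidean_space \<Rightarrow> real"
  assumes f: "real_eigenfunction lam f" and \<alpha>: "\<alpha> * (\<alpha> + real DIM('a) - 2) = lam\<^sup>2"
  obtains G D where
    "\<And>x. x \<noteq> 0 \<Longrightarrow> ((\<lambda>y. norm y powr \<alpha> * f (sgn y)) has_derivative (\<lambda>v. G x \<bullet> v)) (at x)"
    "\<And>x. x \<noteq> 0 \<Longrightarrow> (G has_derivative D x) (at x)"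
    "\<And>b. continuous_on (-{0}) (\<lambda>x. D x b)"
    "\<And>x. x \<noteq> 0 \<Longrightarrow> trace_map (D x) = 0"
proof -
  have C2: "sphere_C2 f" and eig: "\<And>x. x \<in> sphere 0 1 \<Longrightarrow> laplace_beltrami f x = - (lam\<^sup>2) * f x"
    using f by (auto simp: real_eigenfunction_def)
  obtain H where H: "\<And>x. x \<noteq> 0 \<Longrightarrow> (ext_grad f has_derivative H x) (at x)"
    "\<And>b. continuous_on (-{0}) (\<lambda>x. H x b)"
    "\<And>x. x \<noteq> 0 \<Longrightarrow> trace_map (H x) = laplace_beltrami f (sgn x) / (norm x)\<^sup>2"
    using sphere_C2_hessian[OF C2] by blast
  note grad = sphere_C2_has_gradient[OF C2]
  define G where "G x = (\<alpha> * norm x powr (\<alpha> - 2) * f (sgn x)) *\<^sub>R x + norm x powr \<alpha> *\<^sub>R ext_grad f x" for x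
  define D where "D x v = ((\<alpha> * ((\<alpha> - 2) * norm x powr (\<alpha> - 4)) * f (sgn x)) *\<^sub>R ((x \<bullet> v) *\<^sub>R x)
      + (\<alpha> * norm x powr (\<alpha> - 2)) *\<^sub>R ((ext_grad f x \<bullet> v) *\<^sub>R x)
      + (\<alpha> * norm x powr (\<alpha> - 2) * f (sgn x)) *\<^sub>R v)
      + ((\<alpha> * norm x powr (\<alpha> - 2)) *\<^sub>R ((x \<bullet> v) *\<^sub>R ext_grad f x) + norm x powr \<alpha> *\<^sub>R H x v)" for x v
  show ?thesis
  proof (rule that[of G D])
    fix x :: 'a assume x: "x \<noteq> 0"
    show "((\<lambda>y. norm y powr \<alpha> * f (sgn y)) has_derivative (\<lambda>v. G x \<bullet> v)) (at x)"
      by (rule has_derivative_eq_rhs[OF has_derivative_mult[OF has_derivative_norm_powr[OF x] grad(2)[OF x]]])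
         (simp add: G_def fun_eq_iff inner_add_left mult_ac)
    have "((\<lambda>y. (\<alpha> * norm y powr (\<alpha> - 2) * f (sgn y)) *\<^sub>R y) has_derivative
        (\<lambda>v. (\<alpha> * norm x powr (\<alpha> - 2) * f (sgn x)) *\<^sub>R v
          + (\<alpha> * norm x powr (\<alpha> - 2) * (ext_grad f x \<bullet> v)
            + \<alpha> * ((\<alpha> - 2) * norm x powr (\<alpha> - 2 - 2) * (x \<bullet> v)) * f (sgn x)) *\<^sub>R x)) (at x)"
      by (intro has_derivative_scaleR has_derivative_mult has_derivative_mult_right has_derivative_norm_powr x
          grad(2) has_derivative_ident)
    moreover have "((\<lambda>y. norm y powr \<alpha> *\<^sub>R ext_grad f y) has_derivative
        (\<lambda>v. norm x powr \<alpha> *\<^sub>R H x v + (\<alpha> * norm x powr (\<alpha> - 2) * (x \<bullet> v)) *\<^sub>R ext_grad f x)) (at x)"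
      by (intro has_derivative_scaleR has_derivative_norm_powr x H(1))
    ultimately have "(G has_derivative (\<lambda>v. ((\<alpha> * norm x powr (\<alpha> - 2) * f (sgn x)) *\<^sub>R v
          + (\<alpha> * norm x powr (\<alpha> - 2) * (ext_grad f x \<bullet> v)
            + \<alpha> * ((\<alpha> - 2) * norm x powr (\<alpha> - 2 - 2) * (x \<bullet> v)) * f (sgn x)) *\<^sub>R x)
          + (norm x powr \<alpha> *\<^sub>R H x v + (\<alpha> * norm x powr (\<alpha> - 2) * (x \<bullet> v)) *\<^sub>R ext_grad f x))) (at x)"
      unfolding G_def[abs_def] by (rule has_derivative_add)
    then show "(G has_derivative D x) (at x)"
      by (rule has_derivative_eq_rhs) (simp add: D_def[abs_def] fun_eq_iff algebra_simps)
    have s: "sgn x \<in> sphere 0 1" using x by (simp add: norm_sgn)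
    have n4: "norm x powr (\<alpha> - 4) * (norm x)\<^sup>2 = norm x powr (\<alpha> - 2)"
      using x powr_add[of "norm x" "\<alpha> - 4" 2] by simp
    have n2: "norm x powr (\<alpha> - 2) * (norm x)\<^sup>2 = norm x powr \<alpha>"
      using x powr_add[of "norm x" "\<alpha> - 2" 2] by simp
    have eg: "x \<bullet> ext_grad f x = 0" "ext_grad f x \<bullet> x = 0"
      using grad(1)[OF x] by (simp_all add: inner_commute)
    have xx: "x \<bullet> x = (norm x)\<^sup>2" by (rule dot_square_norm)
    have "trace_map (D x) = \<alpha> * (\<alpha> - 2) * f (sgn x) * (norm x powr (\<alpha> - 4) * (norm x)\<^sup>2)
        + \<alpha> * norm x powr (\<alpha> - 2) * f (sgn x) * real DIM('a)
        + norm x powr \<alpha> * (- (lam\<^sup>2) * f (sgn x) / (norm x)\<^sup>2)"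
      unfolding D_def[abs_def] trace_map_simps H(3)[OF x] eig[OF s] eg xx by simp
    also have "norm x powr \<alpha> * (- (lam\<^sup>2) * f (sgn x) / (norm x)\<^sup>2) = - (lam\<^sup>2) * f (sgn x) * norm x powr (\<alpha> - 2)"
      unfolding n2[symmetric] using x by simp
    finally have "trace_map (D x) = norm x powr (\<alpha> - 2) * f (sgn x) * (\<alpha> * (\<alpha> + real DIM('a) - 2) - lam\<^sup>2)"
      unfolding n4 by (simp add: algebra_simps)
    then show "trace_map (D x) = 0" using \<alpha> by simp
  next
    fix b
    have c: "continuous_on (-{0}) (ext_grad f)"
      by (auto intro!: continuous_at_imp_continuous_on has_derivative_continuous[OF H(1)])
    show "continuous_on (-{0}) (\<lambda>x. D x b)"
      unfolding D_def
      by (intro continuous_intros c H(2) sphere_C2_ext_continuous[OF C2]) auto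
  qed
qed

text \<open>
  A radial weight on the unit ball with the property that \<open>y\<close> times the weight is a multiple of the
  gradient of a compactly supported function, namely of its own square.
\<close>

definition parabola_weight :: "'a::euclidean_space \<Rightarrow> real" where
  "parabola_weight y = max 0 (1 - (norm y)\<^sup>2)"

lemma parabola_weight_continuous: "continuous_on S parabola_weight"
  unfolding parabola_weight_def[abs_def] by (intro continuous_intros)

lemma parabola_weight_bounds: "0 \<le> parabola_weight y" "parabola_weight y \<le> 1"
  by (auto simp: parabola_weight_def)

lemma parabola_weight_outside: "y \<notin> cball 0 1 \<Longrightarrow> parabola_weight y = 0"
  using one_less_power[of "norm y" 2] by (auto simp: parabola_weight_def)

lemma cball_subset_cbox_One: "cball (0::'a::euclidean_space) 1 \<subseteq> cbox (- One) One"
proof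
  fix x :: 'a assume "x \<in> cball 0 1"
  then have "\<bar>x \<bullet> i\<bar> \<le> 1" if "i \<in> Basis" for i
    using Basis_le_norm[OF that, of x] by simp
  then show "x \<in> cbox (- One) One" by (auto simp: mem_box abs_le_iff minus_le_iff)
qed

lemma has_derivative_parabola_weight_sq:
  "((\<lambda>y::'a::euclidean_space. (parabola_weight y)\<^sup>2) has_derivative (\<lambda>v. - 4 * parabola_weight y * (y \<bullet> v))) (at y)"
proof -
  have "((\<lambda>y::'a. 1 - (norm y)\<^sup>2) has_derivative (\<lambda>v. - 2 * (y \<bullet> v))) (at y)"
    unfolding power2_norm_eq_inner by (auto intro!: derivative_eq_intros simp: inner_commute)
  from DERIV_compose_FDERIV[OF DERIV_max0_power2 this] show ?thesis
    by (simp add: parabola_weight_def mult_ac)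
qed

text \<open>
  The \<open>t\<close>-derivative of the weighted mean of \<open>u (z + t y)\<close> is, up to a constant, the integral of the
  divergence of the squared weight times the gradient of \<open>u\<close> at \<open>z + t y\<close>; the remaining part of
  that divergence contains the Laplacian of \<open>u\<close>, which is zero.  So the mean does not depend on \<open>t\<close>.
\<close>

lemma weighted_mean_value:
  fixes u :: "'a::euclidean_space \<Rightarrow> real" and G :: "'a \<Rightarrow> 'a"
  assumes U: "open U" and \<delta>: "0 \<le> \<delta>"
    and inU: "\<And>t y. 0 \<le> t \<Longrightarrow> t \<le> \<delta> \<Longrightarrow> y \<in> cbox (- One) One \<Longrightarrow> z + t *\<^sub>R y \<in> U"
    and u: "\<And>x. x \<in> U \<Longrightarrow> (u has_derivative (\<lambda>v. G x \<bullet> v)) (at x)"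
    and G: "\<And>x. x \<in> U \<Longrightarrow> (G has_derivative D x) (at x)"
    and D: "\<And>b. continuous_on U (\<lambda>x. D x b)"
    and harm: "\<And>x. x \<in> U \<Longrightarrow> trace_map (D x) = 0"
  shows "integral (cbox (- One) One) (\<lambda>y. parabola_weight y * u (z + \<delta> *\<^sub>R y))
       = integral (cbox (- One) One) (parabola_weight :: 'a \<Rightarrow> real) * u z"
proof -
  let ?Q = "cbox (- One) One :: 'a set"
  have cu: "continuous_on U u" and cG: "continuous_on U G"
    by (auto intro!: continuous_at_imp_continuous_on has_derivative_continuous[OF u] has_derivative_continuous[OF G])
  define M where "M t = integral ?Q (\<lambda>y. parabola_weight y * u (z + t *\<^sub>R y))" for t
  \<comment> \<open>The divergence theorem in the variable \<open>y\<close>, on the set of \<open>y\<close> with \<open>z + t y\<close> in \<open>U\<close>.\<close>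
  have zero: "integral ?Q (\<lambda>y. parabola_weight y * (G (z + t *\<^sub>R y) \<bullet> y)) = 0" if t: "0 \<le> t" "t \<le> \<delta>" for t
  proof -
    define V where "V = (\<lambda>y. z + t *\<^sub>R y) -` U"
    have V: "open V" unfolding V_def by (intro continuous_open_vimage[OF U] continuous_intros)
    have KV: "cball 0 1 \<subseteq> V" using inU[OF t] cball_subset_cbox_One unfolding V_def by blast
    define F where "F y = (parabola_weight y)\<^sup>2 *\<^sub>R G (z + t *\<^sub>R y)" for y
    define F' where "F' y v = (parabola_weight y)\<^sup>2 *\<^sub>R (t *\<^sub>R D (z + t *\<^sub>R y) v)
         + (- 4 * parabola_weight y) *\<^sub>R ((y \<bullet> v) *\<^sub>R G (z + t *\<^sub>R y))" for y v
    have "((\<lambda>y. if y \<in> cball 0 1 then \<Sum>b\<in>Basis. F' y b \<bullet> b else 0) has_integral 0) UNIV"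
    proof (rule integral_divergence_eq_0[OF V compact_cball KV])
      fix y assume y: "y \<in> V"
      have "((\<lambda>y. z + t *\<^sub>R y) has_derivative (\<lambda>v. t *\<^sub>R v)) (at y)"
        by (auto intro!: derivative_eq_intros)
      moreover have GD: "(G has_derivative D (z + t *\<^sub>R y)) (at (z + t *\<^sub>R y))"
        using y by (intro G) (simp add: V_def)
      ultimately have "((\<lambda>y. G (z + t *\<^sub>R y)) has_derivative (\<lambda>v. D (z + t *\<^sub>R y) (t *\<^sub>R v))) (at y)"
        by (rule has_derivative_compose)
      moreover have "linear (D (z + t *\<^sub>R y))" using GD has_derivative_linear by blast
      ultimately have "((\<lambda>y. G (z + t *\<^sub>R y)) has_derivative (\<lambda>v. t *\<^sub>R D (z + t *\<^sub>R y) v)) (at y)"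
        by (simp add: linear_scale)
      from has_derivative_scaleR[OF has_derivative_parabola_weight_sq this]
      show "(F has_derivative F' y) (at y)"
        unfolding F_def[abs_def] F'_def[abs_def] by simp
    next
      show "F y = 0" if "y \<notin> cball 0 1" for y using parabola_weight_outside[OF that] by (simp add: F_def)
    next
      fix b :: 'a
      have 1: "continuous_on (cball 0 1) (\<lambda>y. G (z + t *\<^sub>R y))"
        by (rule continuous_on_compose2[OF cG]) (use KV in \<open>auto simp: V_def intro!: continuous_intros\<close>)
      have 2: "continuous_on (cball 0 1) (\<lambda>y. D (z + t *\<^sub>R y) b)"
        by (rule continuous_on_compose2[OF D]) (use KV in \<open>auto simp: V_def intro!: continuous_intros\<close>)
      show "continuous_on (cball 0 1) (\<lambda>y. F' y b \<bullet> b)"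
        unfolding F'_def by (intro continuous_intros 1 2 parabola_weight_continuous)
    qed
    moreover have "(if y \<in> cball 0 1 then \<Sum>b\<in>Basis. F' y b \<bullet> b else 0)
        = (if y \<in> ?Q then - 4 * (parabola_weight y * (G (z + t *\<^sub>R y) \<bullet> y)) else 0)" for y
    proof (cases "y \<in> cball 0 1")
      case True
      then have "z + t *\<^sub>R y \<in> U" using KV by (auto simp: V_def)
      then have "trace_map (F' y) = - 4 * parabola_weight y * (G (z + t *\<^sub>R y) \<bullet> y)"
        unfolding F'_def[abs_def] trace_map_simps by (simp add: harm inner_commute)
      then show ?thesis using True cball_subset_cbox_One by (auto simp: trace_map_def)
    qed (auto simp: parabola_weight_outside)
    ultimately have "((\<lambda>y. if y \<in> ?Q then - 4 * (parabola_weight y * (G (z + t *\<^sub>R y) \<bullet> y)) else 0) has_integral 0) UNIV"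
      by simp
    then have "((\<lambda>y. - 4 * (parabola_weight y * (G (z + t *\<^sub>R y) \<bullet> y))) has_integral 0) ?Q"
      unfolding has_integral_restrict_UNIV .
    from has_integral_mult_right[OF this, of "- 1 / 4"] show ?thesis
      by (simp add: integral_unique)
  qed
  have "(M has_field_derivative 0) (at t within {0..\<delta>})" if t: "t \<in> {0..\<delta>}" for t
  proof -
    have "((\<lambda>t. integral ?Q (\<lambda>y. parabola_weight y * u (z + t *\<^sub>R y))) has_field_derivative
       integral ?Q (\<lambda>y. parabola_weight y * (G (z + t *\<^sub>R y) \<bullet> y))) (at t within {0..\<delta>})"
    proof (rule leibniz_rule_field_derivative)
      fix s y assume s: "s \<in> {0..\<delta>}" and y: "y \<in> ?Q"
      have "((\<lambda>s. z + s *\<^sub>R y) has_derivative (\<lambda>h. h *\<^sub>R y)) (at s within {0..\<delta>})"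
        by (auto intro!: derivative_eq_intros)
      from has_derivative_compose[OF this u[OF inU]] s y
      have "((\<lambda>s. u (z + s *\<^sub>R y)) has_derivative (\<lambda>h. G (z + s *\<^sub>R y) \<bullet> (h *\<^sub>R y))) (at s within {0..\<delta>})"
        by simp
      then have "((\<lambda>s. u (z + s *\<^sub>R y)) has_field_derivative G (z + s *\<^sub>R y) \<bullet> y) (at s within {0..\<delta>})"
        by (simp add: has_field_derivative_def mult.commute[of _ "G (z + s *\<^sub>R y) \<bullet> y"])
      then show "((\<lambda>t. parabola_weight y * u (z + t *\<^sub>R y)) has_field_derivative
            parabola_weight y * (G (z + s *\<^sub>R y) \<bullet> y)) (at s within {0..\<delta>})"
        by (rule DERIV_cmult)
    next
      fix s assume s: "s \<in> {0..\<delta>}"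
      show "(\<lambda>y. parabola_weight y * u (z + s *\<^sub>R y)) integrable_on ?Q"
        by (intro integrable_continuous continuous_intros parabola_weight_continuous continuous_on_compose2[OF cu])
           (use s inU in auto)
    next
      have "continuous_on ({0..\<delta>} \<times> ?Q) (\<lambda>x. G (z + fst x *\<^sub>R snd x))"
        by (rule continuous_on_compose2[OF cG]) (use inU in \<open>auto intro!: continuous_intros\<close>)
      moreover have "continuous_on ({0..\<delta>} \<times> ?Q) (\<lambda>x. parabola_weight (snd x))"
        by (rule continuous_on_compose2[OF parabola_weight_continuous[of UNIV]]) (auto intro!: continuous_intros)
      ultimately show "continuous_on ({0..\<delta>} \<times> ?Q) (\<lambda>(t, y). parabola_weight y * (G (z + t *\<^sub>R y) \<bullet> y))"
        unfolding split_beta by (intro continuous_intros)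
    qed (use t in auto)
    then show ?thesis using zero t by (simp add: M_def[abs_def])
  qed
  from has_field_derivative_zero_constant[OF _ this] obtain c where "\<And>t. t \<in> {0..\<delta>} \<Longrightarrow> M t = c"
    by auto
  then have "M \<delta> = M 0" using \<delta> by simp
  then show ?thesis by (simp add: M_def)
qed

text \<open>
  Young's inequality gives \<open>s A powr (p - 1) \<le> s powr p / p + (1 - 1 / p) A powr p\<close>, with equality for
  \<open>s = A\<close>.  Integrating this with \<open>A\<close> equal to the weighted mean yields Jensen's inequality.
\<close>

lemma jensen_powr:
  fixes w v :: "'a::euclidean_space \<Rightarrow> real"
  assumes p: "1 < p" and w: "continuous_on (cbox a b) w" "\<And>y. 0 \<le> w y" and v: "continuous_on (cbox a b) v"
    and c: "integral (cbox a b) w = c" "0 < c"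
  shows "c * (\<bar>integral (cbox a b) (\<lambda>y. w y * v y)\<bar> / c) powr p \<le> integral (cbox a b) (\<lambda>y. w y * \<bar>v y\<bar> powr p)"
proof -
  let ?Q = "cbox a b"
  define A where "A = \<bar>integral ?Q (\<lambda>y. w y * v y)\<bar> / c"
  have A: "0 \<le> A" using c by (simp add: A_def)
  have cp: "continuous_on ?Q (\<lambda>y. \<bar>v y\<bar> powr p)"
    using p by (intro continuous_on_powr' continuous_intros v) auto
  have ip: "(\<lambda>y. w y * \<bar>v y\<bar> powr p) integrable_on ?Q" "(\<lambda>y. w y * \<bar>v y\<bar>) integrable_on ?Q"
      "w integrable_on ?Q" "(\<lambda>y. w y * v y) integrable_on ?Q"
    by (intro integrable_continuous continuous_intros w v cp)+
  \<comment> \<open>Young's inequality with the conjugate exponent \<open>p / (p - 1)\<close>.\<close>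
  have pt: "x * A powr (p - 1) \<le> x powr p / p + (1 - 1 / p) * A powr p" if "0 \<le> x" for x
  proof -
    have q: "1 < p / (p - 1)" "1 / p + 1 / (p / (p - 1)) = 1" using p by (auto simp: field_simps)
    have "x * A powr (p - 1) \<le> x powr p / p + (A powr (p - 1)) powr (p / (p - 1)) / (p / (p - 1))"
      using that by (intro Youngs_inequality p q) auto
    moreover have "(A powr (p - 1)) powr (p / (p - 1)) = A powr p" using p by (simp add: powr_powr)
    moreover have "A powr p / (p / (p - 1)) = (1 - 1 / p) * A powr p" using p by (simp add: field_simps)
    ultimately show ?thesis by simp
  qed
  have "integral ?Q (\<lambda>y. w y * \<bar>v y\<bar> * A powr (p - 1))
      \<le> integral ?Q (\<lambda>y. (w y * \<bar>v y\<bar> powr p) * (1 / p) + w y * ((1 - 1 / p) * A powr p))"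
  proof (intro integral_le integrable_add integrable_on_mult_left ip)
    fix y
    show "w y * \<bar>v y\<bar> * A powr (p - 1) \<le> (w y * \<bar>v y\<bar> powr p) * (1 / p) + w y * ((1 - 1 / p) * A powr p)"
      using mult_left_mono[OF pt[of "\<bar>v y\<bar>"] w(2)[of y]] by (simp add: distrib_left mult.assoc)
  qed
  also have "\<dots> = integral ?Q (\<lambda>y. w y * \<bar>v y\<bar> powr p) * (1 / p) + c * ((1 - 1 / p) * A powr p)"
    unfolding c(1)[symmetric] integral_mult_left[symmetric]
    by (intro integral_add integrable_on_mult_left ip)
  finally have 1: "integral ?Q (\<lambda>y. w y * \<bar>v y\<bar>) * A powr (p - 1)
      \<le> integral ?Q (\<lambda>y. w y * \<bar>v y\<bar> powr p) * (1 / p) + c * ((1 - 1 / p) * A powr p)"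
    unfolding integral_mult_left .
  have "c * A \<le> integral ?Q (\<lambda>y. w y * \<bar>v y\<bar>)"
    using integral_norm_bound_integral[OF ip(4) ip(2)] w(2) c by (auto simp: A_def abs_mult)
  then have "c * A * A powr (p - 1) \<le> integral ?Q (\<lambda>y. w y * \<bar>v y\<bar>) * A powr (p - 1)"
    by (rule mult_right_mono) simp
  moreover have "A * A powr (p - 1) = A powr p"
    using A powr_mult_base[of A "p - 1"] by simp
  ultimately have "c * A powr p \<le> integral ?Q (\<lambda>y. w y * \<bar>v y\<bar> powr p) * (1 / p) + c * ((1 - 1 / p) * A powr p)"
    using 1 by (simp add: mult.assoc)
  then have "c * A powr p * (1 / p) \<le> integral ?Q (\<lambda>y. w y * \<bar>v y\<bar> powr p) * (1 / p)"
    by (simp add: algebra_simps)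
  then show ?thesis using p by (simp add: A_def divide_le_cancel)
qed

section \<open>The geodesic distance\<close>

text \<open>
  A crude form of Jordan's inequality; the constant is irrelevant for what follows.
\<close>

lemma sin_ge_quarter:
  assumes "0 \<le> y" "y \<le> pi / 2"
  shows "y / 4 \<le> sin y"
proof -
  have small: "y / 2 \<le> sin y" if "0 < y" "y \<le> 1" for y :: real
  proof -
    obtain u where u: "0 < u" "u < y" "sin y - sin 0 = (y - 0) * cos u"
      using MVT2[of 0 y sin cos] \<open>0 < y\<close> by (auto intro: DERIV_sin)
    have "cos (pi / 3) \<le> cos u"
      using u that pi_gt3 by (intro cos_monotone_0_pi_le) auto
    then have "y * (1 / 2) \<le> y * cos u" using that by (intro mult_left_mono) (auto simp: cos_60)
    then show ?thesis using u by simp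
  qed
  show ?thesis
  proof (cases "y \<le> 1")
    case True then show ?thesis using small[of y] assms by (cases "y = 0") auto
  next
    case False
    then have "sin 1 \<le> sin y" using assms by (intro sin_monotone_2pi_le) auto
    moreover have "1 / 2 \<le> sin (1::real)" using small[of 1] by simp
    ultimately show ?thesis using assms(2) pi_less_4 by linarith
  qed
qed

lemma sphere_inner_bounds:
  assumes "norm x = 1" "norm y = 1" shows "-1 \<le> x \<bullet> y" "x \<bullet> y \<le> 1"
  using Cauchy_Schwarz_ineq2[of x y] assms by (auto simp: abs_le_iff)

lemma norm_diff_sphere:
  assumes "norm x = 1" "norm y = 1"
  shows "norm (x - y) = 2 * sin (arccos (x \<bullet> y) / 2)"
proof -
  define t where "t = arccos (x \<bullet> y)"
  have b: "-1 \<le> x \<bullet> y" "x \<bullet> y \<le> 1" by (rule sphere_inner_bounds[OF assms])+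
  have t: "0 \<le> t" "t \<le> pi" using b by (auto simp: t_def arccos_lbound arccos_ubound)
  have xx: "x \<bullet> x = 1" "y \<bullet> y = 1" using assms by (simp_all add: dot_square_norm)
  have "(norm (x - y))\<^sup>2 = 2 - 2 * cos t"
    unfolding power2_norm_eq_inner using xx b
    by (simp add: t_def inner_diff_left inner_diff_right inner_commute)
  also have "cos t = 1 - 2 * (sin (t / 2))\<^sup>2"
    using cos_double_sin[of "t / 2"] by simp
  finally have "(norm (x - y))\<^sup>2 = (2 * sin (t / 2))\<^sup>2" by (simp add: power_mult_distrib)
  moreover have "0 \<le> sin (t / 2)" using t by (intro sin_ge_zero) auto
  ultimately show ?thesis unfolding t_def[symmetric]
    by (metis norm_ge_zero mult_nonneg_nonneg zero_le_numeral power2_eq_iff_nonneg)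
qed

lemma norm_diff_le_arccos:
  assumes "norm x = 1" "norm y = 1"
  shows "norm (x - y) \<le> arccos (x \<bullet> y)"
  unfolding norm_diff_sphere[OF assms]
  using sin_x_le_x[of "arccos (x \<bullet> y) / 2"] sphere_inner_bounds[OF assms] by (simp add: arccos_lbound)

lemma arccos_le_norm_diff:
  assumes "norm x = 1" "norm y = 1"
  shows "arccos (x \<bullet> y) \<le> 4 * norm (x - y)"
  unfolding norm_diff_sphere[OF assms]
  using sin_ge_quarter[of "arccos (x \<bullet> y) / 2"] sphere_inner_bounds[OF assms]
  by (simp add: arccos_lbound arccos_ubound)

text \<open>
  Along a curve \<open>\<gamma>\<close> on the sphere, the angle to the starting point \<open>x\<close> changes at most with the speed of
  \<open>\<gamma>\<close>.  The angle is not differentiable where \<open>x \<bullet> \<gamma> = 1\<close> or \<open>x \<bullet> \<gamma> = - 1\<close>.  The function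
  \<open>arcsin (c (x \<bullet> \<gamma>))\<close> with \<open>c < 1\<close> has the same property and is smooth, and \<open>c\<close> tends to \<open>1\<close> at the end.
\<close>

lemma length_ge_arccos:
  fixes \<gamma> :: "real \<Rightarrow> 'a::euclidean_space"
  assumes pw: "\<gamma> piecewise_C1_differentiable_on {0..1}"
    and img: "path_image \<gamma> \<subseteq> sphere 0 1"
    and len: "((\<lambda>t. norm (vector_derivative \<gamma> (at t))) has_integral L) {0..1}"
  shows "arccos (\<gamma> 0 \<bullet> \<gamma> 1) \<le> L"
proof -
  define x where "x = \<gamma> 0"
  from pw obtain S where cont: "continuous_on {0..1} \<gamma>" and S: "finite S"
    and d0: "\<gamma> C1_differentiable_on ({0..1} - S)"
    by (auto simp: piecewise_C1_differentiable_on_def)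
  define d where "d t = vector_derivative \<gamma> (at t)" for t
  have d: "(\<gamma> has_vector_derivative d t) (at t)" if "t \<in> {0..1} - S" for t
    using d0 that vector_derivative_works[of \<gamma> "at t"] by (auto simp: C1_differentiable_on_eq d_def)
  have norm1: "norm (\<gamma> t) = 1" if "t \<in> {0..1}" for t
  proof -
    have "\<gamma> t \<in> sphere 0 1" using img that unfolding path_image_def by blast
    then show ?thesis by simp
  qed
  have x: "norm x = 1" unfolding x_def by (rule norm1) simp
  have w1: "-1 \<le> x \<bullet> \<gamma> t" "x \<bullet> \<gamma> t \<le> 1" if "t \<in> {0..1}" for t
    using sphere_inner_bounds[OF x norm1[OF that]] by auto
  have orth: "\<gamma> t \<bullet> d t = 0" if "t \<in> {0<..<1} - S" for t
  proof -
    have "(\<gamma> has_derivative (\<lambda>h. h *\<^sub>R d t)) (at t)"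
      using d[of t] that by (auto simp: has_vector_derivative_def)
    then have "((\<lambda>s. \<gamma> s \<bullet> \<gamma> s) has_derivative (\<lambda>h. h * (2 * (\<gamma> t \<bullet> d t)))) (at t)"
      by (auto intro!: derivative_eq_intros simp: fun_eq_iff inner_commute)
    then have 1: "((\<lambda>s. \<gamma> s \<bullet> \<gamma> s) has_derivative (\<lambda>h. h * (2 * (\<gamma> t \<bullet> d t)))) (at t)" .
    have "((\<lambda>s. 1::real) has_derivative (\<lambda>h. 0)) (at t)" by simp
    then have "((\<lambda>s. \<gamma> s \<bullet> \<gamma> s) has_derivative (\<lambda>h. 0)) (at t)"
      by (rule has_derivative_transform_within_open[of _ _ _ _ "{0<..<1}"])
         (use that norm1 in \<open>auto simp: dot_square_norm\<close>)
    from has_derivative_unique[OF 1 this] show ?thesis by (auto dest: fun_cong[of _ _ 1])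
  qed
  \<comment> \<open>As \<open>1 - w\<^sup>2 \<le> 1 - (c w)\<^sup>2\<close>, the derivative of \<open>arcsin (c w)\<close> is at most the speed of \<open>\<gamma>\<close>.\<close>
  have main: "arcsin c - arcsin (c * (x \<bullet> \<gamma> 1)) \<le> L" if c: "0 < c" "c < 1" for c
  proof -
    define w where "w t = x \<bullet> \<gamma> t" for t
    have cw: "\<bar>c * w t\<bar> < 1" if "t \<in> {0..1}" for t
    proof -
      have "\<bar>c * w t\<bar> \<le> c * 1" unfolding abs_mult w_def
        using w1[OF that] c by (intro mult_mono) auto
      then show ?thesis using c by simp
    qed
    define f' where "f' t = (if t \<in> {0<..<1} - S then c * (x \<bullet> d t) / sqrt (1 - (c * w t)\<^sup>2) else 0)" for t
    have "(f' has_integral (arcsin (c * w 1) - arcsin (c * w 0))) {0..1}"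
    proof (rule fundamental_theorem_of_calculus_interior_strong[OF S])
      fix t :: real assume t: "t \<in> {0<..<1} - S"
      have "(\<gamma> has_derivative (\<lambda>h. h *\<^sub>R d t)) (at t)"
        using d[of t] t by (auto simp: has_vector_derivative_def)
      then have "((\<lambda>s. c * w s) has_derivative (\<lambda>h. h * (c * (x \<bullet> d t)))) (at t)"
        unfolding w_def by (auto intro!: derivative_eq_intros)
      then have "((\<lambda>s. c * w s) has_real_derivative c * (x \<bullet> d t)) (at t)"
        by (simp add: has_field_derivative_def mult.commute[of _ "c * (x \<bullet> d t)"])
      moreover have "(arcsin has_real_derivative inverse (sqrt (1 - (c * w t)\<^sup>2))) (at (c * w t))"
        using cw[of t] t by (intro DERIV_arcsin) auto
      ultimately have "((\<lambda>s. arcsin (c * w s)) has_real_derivative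
            inverse (sqrt (1 - (c * w t)\<^sup>2)) * (c * (x \<bullet> d t))) (at t)"
        by (rule DERIV_chain2[rotated])
      then show "((\<lambda>s. arcsin (c * w s)) has_vector_derivative f' t) (at t)"
        using t by (simp add: f'_def has_real_derivative_iff_has_vector_derivative field_simps)
    next
      show "continuous_on {0..1} (\<lambda>s. arcsin (c * w s))"
        unfolding w_def
        by (intro continuous_intros cont ballI conjI)
           (use cw[unfolded w_def abs_less_iff] in \<open>force dest: less_imp_le\<close>)+
    qed simp
    from has_integral_neg[OF this]
    have "((\<lambda>t. - f' t) has_integral (arcsin (c * w 0) - arcsin (c * w 1))) {0..1}" by simp
    from this len[folded d_def] have "arcsin (c * w 0) - arcsin (c * w 1) \<le> L"
    proof (rule has_integral_le)
      fix t :: real assume t: "t \<in> {0..1}"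
      show "- f' t \<le> norm (d t)"
      proof (cases "t \<in> {0<..<1} - S")
        case True
        have wt: "\<bar>w t\<bar> \<le> 1" using w1[OF t] by (auto simp: w_def)
        have "x \<bullet> d t = (x - w t *\<^sub>R \<gamma> t) \<bullet> d t" using orth[OF True] by (simp add: inner_diff_left)
        then have "\<bar>x \<bullet> d t\<bar> \<le> norm (x - w t *\<^sub>R \<gamma> t) * norm (d t)"
          using Cauchy_Schwarz_ineq2 by metis
        also have "norm (x - w t *\<^sub>R \<gamma> t) = sqrt (1 - (w t)\<^sup>2)"
        proof -
          have "x \<bullet> x = 1" "\<gamma> t \<bullet> \<gamma> t = 1" using x norm1[OF t] by (auto simp: dot_square_norm)
          then have "(norm (x - w t *\<^sub>R \<gamma> t))\<^sup>2 = 1 - (w t)\<^sup>2"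
            unfolding power2_norm_eq_inner
            by (simp add: inner_diff_left inner_diff_right inner_commute w_def power2_eq_square)
          then show ?thesis by (metis norm_ge_zero real_sqrt_unique)
        qed
        also have "sqrt (1 - (w t)\<^sup>2) \<le> sqrt (1 - (c * w t)\<^sup>2)"
        proof -
          have "c\<^sup>2 * (w t)\<^sup>2 \<le> 1 * (w t)\<^sup>2" using c by (intro mult_right_mono) (auto simp: power_le_one)
          then show ?thesis by (simp add: power_mult_distrib)
        qed
        finally have 1: "\<bar>x \<bullet> d t\<bar> \<le> sqrt (1 - (c * w t)\<^sup>2) * norm (d t)" by (simp add: mult_right_mono)
        have pos: "0 < sqrt (1 - (c * w t)\<^sup>2)"
          using cw[OF t] by (simp add: abs_square_less_1)
        have "\<bar>f' t\<bar> = c * \<bar>x \<bullet> d t\<bar> / sqrt (1 - (c * w t)\<^sup>2)"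
          using True c pos by (simp add: f'_def abs_mult)
        also have "\<dots> \<le> \<bar>x \<bullet> d t\<bar> / sqrt (1 - (c * w t)\<^sup>2)"
          using c pos by (intro divide_right_mono) (auto simp: mult_left_le_one_le)
        also have "\<dots> \<le> norm (d t)" using 1 pos by (simp add: divide_le_eq mult.commute)
        finally show ?thesis by linarith
      next
        case False
        then have "f' t = 0" unfolding f'_def by (rule if_not_P)
        then show ?thesis by simp
      qed
    qed
    then show ?thesis using x by (simp add: w_def x_def dot_square_norm)
  qed
  define cn where "cn n = 1 - inverse (real (Suc (Suc n)))" for n
  have cn: "0 < cn n" "cn n < 1" for n by (auto simp: cn_def field_simps)
  have "(\<lambda>n. inverse (real (Suc (Suc n)))) \<longlonglongrightarrow> 0" using LIMSEQ_Suc[OF LIMSEQ_inverse_real_of_nat] .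
  then have cn1: "cn \<longlonglongrightarrow> 1" unfolding cn_def[abs_def] by (auto intro: tendsto_eq_intros)
  have w: "-1 \<le> x \<bullet> \<gamma> 1" "x \<bullet> \<gamma> 1 \<le> 1" using w1[of 1] by auto
  have l1: "(\<lambda>n. arcsin (cn n)) \<longlonglongrightarrow> arcsin 1"
    by (rule continuous_on_tendsto_compose[OF continuous_on_arcsin' cn1])
       (use cn in \<open>auto intro!: always_eventually simp: less_imp_le intro: order_trans[of _ 0]\<close>)
  have l2: "(\<lambda>n. arcsin (cn n * (x \<bullet> \<gamma> 1))) \<longlonglongrightarrow> arcsin (1 * (x \<bullet> \<gamma> 1))"
  proof (rule continuous_on_tendsto_compose[OF continuous_on_arcsin'])
    show "(\<lambda>n. cn n * (x \<bullet> \<gamma> 1)) \<longlonglongrightarrow> 1 * (x \<bullet> \<gamma> 1)" by (intro tendsto_intros cn1)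
    have "\<bar>cn n * (x \<bullet> \<gamma> 1)\<bar> \<le> 1 * 1" for n unfolding abs_mult
      using cn[of n] w by (intro mult_mono) auto
    then show "\<forall>\<^sub>F n in sequentially. cn n * (x \<bullet> \<gamma> 1) \<in> {-1..1}"
      by (auto intro!: always_eventually simp: abs_le_iff)
  qed (use w in auto)
  have "arcsin 1 - arcsin (1 * (x \<bullet> \<gamma> 1)) \<le> L"
    by (rule LIMSEQ_le_const2[OF tendsto_diff[OF l1 l2]]) (use main cn in auto)
  then show ?thesis using w by (simp add: arccos_arcsin_eq x_def)
qed

text \<open>
  If \<open>y\<close> is \<open>x\<close> or \<open>- x\<close>, any unit vector orthogonal to \<open>x\<close> will do, which needs dimension two.
\<close>

lemma great_circle_direction:
  fixes x y :: "'a::euclidean_space"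
  assumes x: "norm x = 1" and y: "norm y = 1" and dim: "2 \<le> DIM('a)"
  obtains v where "norm v = 1" "x \<bullet> v = 0"
    "y = cos (arccos (x \<bullet> y)) *\<^sub>R x + sin (arccos (x \<bullet> y)) *\<^sub>R v"
proof -
  define w where "w = x \<bullet> y"
  have w: "-1 \<le> w" "w \<le> 1" using sphere_inner_bounds[OF x y] by (auto simp: w_def)
  have xx: "x \<bullet> x = 1" "y \<bullet> y = 1" using x y by (simp_all add: dot_square_norm)
  have n2: "(norm (y - w *\<^sub>R x))\<^sup>2 = 1 - w\<^sup>2"
    unfolding power2_norm_eq_inner using xx
    by (simp add: inner_diff_left inner_diff_right inner_commute w_def power2_eq_square)
  have s: "sin (arccos w) = sqrt (1 - w\<^sup>2)" using w by (simp add: sin_arccos)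
  have n: "norm (y - w *\<^sub>R x) = sin (arccos w)" unfolding s using n2 by (metis norm_ge_zero real_sqrt_unique)
  show ?thesis
  proof (cases "sin (arccos w) = 0")
    case True
    then have "y = w *\<^sub>R x" using n by simp
    obtain u where u: "u \<noteq> 0" "orthogonal x u" using orthogonal_to_vector_exists[OF dim] by blast
    show ?thesis
    proof (rule that[of "sgn u"])
      show "norm (sgn u) = 1" "x \<bullet> sgn u = 0"
        using u by (simp_all add: norm_sgn orthogonal_def sgn_div_norm)
      show "y = cos (arccos (x \<bullet> y)) *\<^sub>R x + sin (arccos (x \<bullet> y)) *\<^sub>R sgn u"
        unfolding w_def[symmetric] True using \<open>y = w *\<^sub>R x\<close> w by (simp only: cos_arccos) simp
    qed
  next
    case False
    then have pos: "0 < sin (arccos w)" using n norm_ge_zero[of "y - w *\<^sub>R x"] by linarith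
    show ?thesis
    proof (rule that[of "(y - w *\<^sub>R x) /\<^sub>R sin (arccos w)"])
      show "norm ((y - w *\<^sub>R x) /\<^sub>R sin (arccos w)) = 1" using n pos by simp
      show "x \<bullet> ((y - w *\<^sub>R x) /\<^sub>R sin (arccos w)) = 0"
        using xx by (simp add: inner_diff_right w_def)
      show "y = cos (arccos (x \<bullet> y)) *\<^sub>R x + sin (arccos (x \<bullet> y)) *\<^sub>R ((y - w *\<^sub>R x) /\<^sub>R sin (arccos w))"
        unfolding w_def[symmetric] using pos w by simp
    qed
  qed
qed

text \<open>
  An arc of a great circle attains the lower bound for the length.
\<close>

lemma geodesic_dist_eq:
  fixes x y :: "'a::euclidean_space"
  assumes x: "norm x = 1" and y: "norm y = 1" and dim: "2 \<le> DIM('a)"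
  shows "geodesic_dist x y = arccos (x \<bullet> y)"
  unfolding geodesic_dist_def
proof (rule cInf_eq_minimum)
  define \<theta> where "\<theta> = arccos (x \<bullet> y)"
  obtain v where v: "norm v = 1" "x \<bullet> v = 0" "y = cos \<theta> *\<^sub>R x + sin \<theta> *\<^sub>R v"
    using great_circle_direction[OF x y dim] unfolding \<theta>_def by blast
  have "0 \<le> \<theta>" using sphere_inner_bounds[OF x y] by (simp add: \<theta>_def arccos_lbound)
  have unit: "norm (a *\<^sub>R x + b *\<^sub>R v) = sqrt (a\<^sup>2 + b\<^sup>2)" for a b
  proof -
    have "x \<bullet> x = 1" "v \<bullet> v = 1" using x v(1) by (simp_all add: dot_square_norm)
    then show ?thesis unfolding norm_eq_sqrt_inner using v(2)
      by (simp add: inner_add_left inner_add_right inner_commute power2_eq_square)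
  qed
  define \<gamma> where "\<gamma> t = cos (\<theta> * t) *\<^sub>R x + sin (\<theta> * t) *\<^sub>R v" for t
  define d where "d t = \<theta> *\<^sub>R ((- sin (\<theta> * t)) *\<^sub>R x + cos (\<theta> * t) *\<^sub>R v)" for t
  have d: "(\<gamma> has_vector_derivative d t) (at t)" for t
    unfolding \<gamma>_def d_def
    by (auto intro!: derivative_eq_intros simp: has_vector_derivative_def fun_eq_iff algebra_simps)
  have nd: "norm (d t) = \<theta>" for t unfolding d_def norm_scaleR unit using \<open>0 \<le> \<theta>\<close> by simp
  have "\<gamma> C1_differentiable_on {0..1}"
    unfolding C1_differentiable_on_def
    by (rule exI[of _ d]) (auto simp: d, auto simp: d_def intro!: continuous_intros)
  then have "\<gamma> piecewise_C1_differentiable_on {0..1}" by (rule C1_differentiable_imp_piecewise)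
  moreover have "path_image \<gamma> \<subseteq> sphere 0 1"
    by (auto simp: path_image_def \<gamma>_def unit)
  moreover have "pathstart \<gamma> = x" "pathfinish \<gamma> = y"
    by (simp_all add: pathstart_def pathfinish_def \<gamma>_def) (rule v(3)[symmetric])
  moreover have "((\<lambda>t. norm (vector_derivative \<gamma> (at t))) has_integral \<theta>) {0..1}"
    using has_integral_const_real[of \<theta> 0 1] by (simp add: vector_derivative_at[OF d] nd)
  ultimately show "arccos (x \<bullet> y) \<in> {L. \<exists>\<gamma>. \<gamma> piecewise_C1_differentiable_on {0..1} \<and> path_image \<gamma> \<subseteq> sphere 0 1 \<and>
                 pathstart \<gamma> = x \<and> pathfinish \<gamma> = y \<and>
                 ((\<lambda>t. norm (vector_derivative \<gamma> (at t))) has_integral L) {0..1}}"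
    unfolding \<theta>_def[symmetric] by blast
next
  fix L assume "L \<in> {L. \<exists>\<gamma>. \<gamma> piecewise_C1_differentiable_on {0..1} \<and> path_image \<gamma> \<subseteq> sphere 0 1 \<and>
                 pathstart \<gamma> = x \<and> pathfinish \<gamma> = y \<and>
                 ((\<lambda>t. norm (vector_derivative \<gamma> (at t))) has_integral L) {0..1}}"
  then obtain \<gamma> where "\<gamma> piecewise_C1_differentiable_on {0..1}" "path_image \<gamma> \<subseteq> sphere 0 1"
    "\<gamma> 0 = x" "\<gamma> 1 = y" "((\<lambda>t. norm (vector_derivative \<gamma> (at t))) has_integral L) {0..1}"
    by (auto simp: pathstart_def pathfinish_def)
  then show "arccos (x \<bullet> y) \<le> L" using length_ge_arccos[of \<gamma> L] by simp
qed

lemma geodesic_ball_eq: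
  fixes z :: "'a::euclidean_space"
  assumes "norm z = 1" "2 \<le> DIM('a)"
  shows "geodesic_ball z r = {x \<in> sphere 0 1. arccos (z \<bullet> x) < r}"
  unfolding geodesic_ball_def
  by (rule Collect_cong) (use assms in \<open>simp add: geodesic_dist_eq cong: conj_cong\<close>)

lemma geodesic_ball_measurable:
  fixes z :: "'a::euclidean_space"
  assumes z: "norm z = 1" and dim: "2 \<le> DIM('a)"
  shows "geodesic_ball z r \<in> sets sphere_borel"
proof -
  have "continuous_on (sphere 0 1) (\<lambda>x. arccos (z \<bullet> x))"
    using sphere_inner_bounds[OF z] by (intro continuous_intros) auto
  then obtain A where A: "open A" "A \<inter> sphere 0 1 = (\<lambda>x. arccos (z \<bullet> x)) -` {..<r} \<inter> sphere 0 1"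
    using continuous_on_open_invariant[THEN iffD1, rule_format, OF _ open_lessThan[of r]] by blast
  have "geodesic_ball z r = sphere 0 1 \<inter> A"
    unfolding geodesic_ball_eq[OF z dim] using A(2) by blast
  moreover have "A \<in> sets borel" using A(1) by simp
  ultimately show ?thesis by (simp add: sets_restrict_space)
qed

lemma geodesic_ball_subset_chordal:
  fixes z :: "'a::euclidean_space"
  assumes "norm z = 1" "2 \<le> DIM('a)"
  shows "geodesic_ball z r \<subseteq> {x \<in> sphere 0 1. norm (z - x) < r}"
  unfolding geodesic_ball_eq[OF assms]
proof safe
  fix x :: 'a assume "x \<in> sphere 0 1" "arccos (z \<bullet> x) < r"
  then show "norm (z - x) < r" using norm_diff_le_arccos[OF assms(1), of x] by simp
qed

text \<open>
  Together with the reverse inclusion, this allows caps cut out by Euclidean balls to replace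
  geodesic balls.
\<close>

lemma chordal_subset_geodesic_ball:
  fixes z :: "'a::euclidean_space"
  assumes "norm z = 1" "2 \<le> DIM('a)"
  shows "{x \<in> sphere 0 1. norm (z - x) < r / 4} \<subseteq> geodesic_ball z r"
  unfolding geodesic_ball_eq[OF assms]
proof safe
  fix x :: 'a assume "x \<in> sphere 0 1" "norm (z - x) < r / 4"
  then show "arccos (z \<bullet> x) < r" using arccos_le_norm_diff[OF assms(1), of x] by simp
qed

section \<open>Polar coordinates and the volume of caps\<close>

lemma sgn_measurable_sphere:
  "(\<lambda>x::'a::euclidean_space. sgn x) \<in> restrict_space borel (-{0}) \<rightarrow>\<^sub>M sphere_borel"
proof (rule measurable_restrict_space2)
  show "(\<lambda>x::'a. sgn x) \<in> space (restrict_space borel (-{0})) \<rightarrow> sphere 0 1"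
    by (auto simp: norm_sgn space_restrict_space)
  have "(\<lambda>x::'a. sgn x) \<in> borel_measurable borel" unfolding sgn_div_norm by measurable
  then show "(\<lambda>x::'a. sgn x) \<in> borel_measurable (restrict_space borel (-{0}))"
    by (rule measurable_restrict_space1)
qed

lemma compose_sgn_measurable:
  fixes h :: "'a::euclidean_space \<Rightarrow> ennreal"
  assumes "h \<in> borel_measurable sphere_borel"
  shows "(\<lambda>x. h (sgn x) * indicator (-{0}) x) \<in> borel_measurable borel"
  using measurable_compose[OF sgn_measurable_sphere assms]
  by (subst borel_measurable_restrict_space_iff_ennreal[symmetric]) auto

text \<open>
  The integral of \<open>h \<circ> sgn\<close> over a spherical shell, for which polar coordinates take the form of the
  scaling law below.
\<close>

definition shell_integral :: "('a::euclidean_space \<Rightarrow> ennreal) \<Rightarrow> real \<Rightarrow> real \<Rightarrow> ennreal" where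
  "shell_integral h a b = (\<integral>\<^sup>+x. h (sgn x) * indicator {x. a < norm x \<and> norm x \<le> b} x \<partial>lborel)"

lemma shell_integrand_measurable:
  fixes h :: "'a::euclidean_space \<Rightarrow> ennreal"
  assumes h: "h \<in> borel_measurable sphere_borel" and "0 \<le> a"
  shows "(\<lambda>x. h (sgn x) * indicator {x. a < norm x \<and> norm x \<le> b} x) \<in> borel_measurable borel"
proof -
  have "(\<lambda>x. h (sgn x) * indicator (-{0}) x * indicator {x. a < norm x \<and> norm x \<le> b} x) \<in> borel_measurable borel"
    by (intro borel_measurable_times_ennreal compose_sgn_measurable[OF h] borel_measurable_indicator) measurable
  also have "(\<lambda>x. h (sgn x) * indicator (-{0}) x * indicator {x. a < norm x \<and> norm x \<le> b} x)
      = (\<lambda>x. h (sgn x) * indicator {x. a < norm x \<and> norm x \<le> b} x)"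
    using assms(2) by (auto simp: fun_eq_iff indicator_def)
  finally show ?thesis .
qed

lemma nn_integral_sphere_volume:
  fixes h :: "'a::euclidean_space \<Rightarrow> ennreal"
  assumes h: "h \<in> borel_measurable sphere_borel"
  shows "(\<integral>\<^sup>+x. h x \<partial>sphere_volume) = of_nat DIM('a) * shell_integral h 0 1"
proof -
  have s: "(\<lambda>x::'a. x /\<^sub>R norm x) \<in> restrict_space lborel (cball 0 1 - {0}) \<rightarrow>\<^sub>M sphere_borel"
  proof (rule measurable_restrict_space2)
    show "(\<lambda>x::'a. x /\<^sub>R norm x) \<in> space (restrict_space lborel (cball 0 1 - {0})) \<rightarrow> sphere 0 1"
      by (auto simp: space_restrict_space)
    have "(\<lambda>x::'a. x /\<^sub>R norm x) \<in> borel_measurable lborel" by measurable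
    then show "(\<lambda>x::'a. x /\<^sub>R norm x) \<in> borel_measurable (restrict_space lborel (cball 0 1 - {0}))"
      by (rule measurable_restrict_space1)
  qed
  have "(\<integral>\<^sup>+x. h x \<partial>sphere_volume) = of_nat DIM('a) *
     (\<integral>\<^sup>+x. h (x /\<^sub>R norm x) \<partial>restrict_space lborel (cball 0 1 - {0}))"
    unfolding sphere_volume_def
    by (subst nn_integral_scale_measure) (use h s in \<open>auto simp: nn_integral_distr\<close>)
  also have "(\<integral>\<^sup>+x. h (x /\<^sub>R norm x) \<partial>restrict_space lborel (cball 0 1 - {0}))
     = (\<integral>\<^sup>+x. h (x /\<^sub>R norm x) * indicator (cball 0 1 - {0}) x \<partial>lborel)"
    by (rule nn_integral_restrict_space) auto
  also have "\<dots> = shell_integral h 0 1"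
    unfolding shell_integral_def by (intro nn_integral_cong) (auto simp: sgn_div_norm indicator_def)
  finally show ?thesis .
qed

lemma nn_integral_lborel_affine:
  fixes f :: "'a::euclidean_space \<Rightarrow> ennreal"
  assumes f: "f \<in> borel_measurable borel" and c: "0 < c"
  shows "(\<integral>\<^sup>+x. f x \<partial>lborel) = ennreal (c ^ DIM('a)) * (\<integral>\<^sup>+x. f (t + c *\<^sub>R x) \<partial>lborel)"
proof -
  have [measurable]: "(\<lambda>x. f (t + c *\<^sub>R x)) \<in> borel_measurable borel"
    by (rule measurable_compose[OF _ f]) measurable
  have "(\<integral>\<^sup>+x. f x \<partial>lborel) = (\<integral>\<^sup>+x. f x \<partial>density (distr lborel borel (\<lambda>x. t + c *\<^sub>R x)) (\<lambda>_. \<bar>c\<bar>^DIM('a)))"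
    using lborel_affine[of c t] c by simp
  also have "\<dots> = (\<integral>\<^sup>+x. ennreal (c ^ DIM('a)) * f (t + c *\<^sub>R x) \<partial>lborel)"
    using f c by (simp add: nn_integral_density nn_integral_distr)
  also have "\<dots> = ennreal (c ^ DIM('a)) * (\<integral>\<^sup>+x. f (t + c *\<^sub>R x) \<partial>lborel)"
    by (rule nn_integral_cmult) simp
  finally show ?thesis .
qed

lemma shell_integral_scale:
  fixes h :: "'a::euclidean_space \<Rightarrow> ennreal"
  assumes h: "h \<in> borel_measurable sphere_borel" and b: "0 \<le> b"
  shows "shell_integral h 0 b = ennreal (b ^ DIM('a)) * shell_integral h 0 1"
proof (cases "b = 0")
  case True
  have "(\<lambda>x::'a. h (sgn x) * indicator {x. 0 < norm x \<and> norm x \<le> 0} x) = (\<lambda>x. 0)"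
    by (auto simp: fun_eq_iff indicator_def)
  with True show ?thesis by (simp add: shell_integral_def)
next
  case False
  then have b: "0 < b" using b by simp
  have "shell_integral h 0 b = ennreal (b ^ DIM('a)) *
     (\<integral>\<^sup>+x. h (sgn (0 + b *\<^sub>R x)) * indicator {x. 0 < norm x \<and> norm x \<le> b} (0 + b *\<^sub>R x) \<partial>lborel)"
    unfolding shell_integral_def
    by (rule nn_integral_lborel_affine[OF shell_integrand_measurable[OF h] b]) simp
  also have "(\<integral>\<^sup>+x. h (sgn (0 + b *\<^sub>R x)) * indicator {x. 0 < norm x \<and> norm x \<le> b} (0 + b *\<^sub>R x) \<partial>lborel)
     = shell_integral h 0 1"
    unfolding shell_integral_def
    by (intro nn_integral_cong) (use b in \<open>auto simp: sgn_scaleR indicator_def\<close>)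
  finally show ?thesis .
qed

text \<open>
  Polar coordinates: a shell is a difference of two balls, and the integral of \<open>h \<circ> sgn\<close> over a ball
  is homogeneous in the radius.  Finiteness is needed for the subtraction.
\<close>

lemma shell_integral_eq:
  fixes h :: "'a::euclidean_space \<Rightarrow> ennreal"
  assumes h: "h \<in> borel_measurable sphere_borel"
    and fin: "(\<integral>\<^sup>+x. h x \<partial>sphere_volume) < \<infinity>" and ab: "0 \<le> a" "a \<le> b"
  shows "of_nat DIM('a) * shell_integral h a b
    = ennreal (b ^ DIM('a) - a ^ DIM('a)) * (\<integral>\<^sup>+x. h x \<partial>sphere_volume)"
proof -
  let ?n = "DIM('a)"
  have "shell_integral h 0 1 < \<infinity>"
    using fin unfolding nn_integral_sphere_volume[OF h] by (auto simp: ennreal_mult_less_top)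
  then obtain j where j: "0 \<le> j" "shell_integral h 0 1 = ennreal j"
    by (cases "shell_integral h 0 1") auto
  have "shell_integral h 0 b = shell_integral h 0 a + shell_integral h a b"
  proof -
    have "shell_integral h 0 b = (\<integral>\<^sup>+x. h (sgn x) * indicator {x. 0 < norm x \<and> norm x \<le> a} x
        + h (sgn x) * indicator {x. a < norm x \<and> norm x \<le> b} x \<partial>lborel)"
      unfolding shell_integral_def using ab by (intro nn_integral_cong) (auto simp: indicator_def)
    also have "\<dots> = shell_integral h 0 a + shell_integral h a b"
      unfolding shell_integral_def
      by (rule nn_integral_add)
         (use shell_integrand_measurable[OF h, of 0 a] shell_integrand_measurable[OF h ab(1), of b]
           in \<open>simp_all del: zero_less_norm_iff\<close>)
    finally show ?thesis .
  qed
  then have "ennreal (a ^ ?n * j) + shell_integral h a b = ennreal (b ^ ?n * j)"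
    using ab j shell_integral_scale[OF h ab(1)] shell_integral_scale[OF h, of b]
    by (simp add: ennreal_mult)
  also have "\<dots> = ennreal (a ^ ?n * j) + ennreal ((b ^ ?n - a ^ ?n) * j)"
    using ab j by (subst ennreal_plus[symmetric]) (auto simp: algebra_simps intro!: mult_left_mono power_mono)
  finally have "shell_integral h a b = ennreal ((b ^ ?n - a ^ ?n) * j)"
    by (simp add: ennreal_add_left_cancel)
  then show ?thesis
    using ab j power_mono[OF ab(2,1), of ?n]
    by (simp add: nn_integral_sphere_volume[OF h] ennreal_mult mult_ac)
qed

lemma space_sphere_volume [simp]: "space (sphere_volume :: 'a::euclidean_space measure) = sphere 0 1"
  by (simp add: sphere_volume_def space_restrict_space space_scale_measure)

lemma sets_sphere_volume [simp]: "sets (sphere_volume :: 'a::euclidean_space measure) = sets sphere_borel"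
  by (simp add: sphere_volume_def)

lemma finite_sphere_volume: "emeasure (sphere_volume :: 'a::euclidean_space measure) (sphere 0 1) < \<infinity>"
proof -
  have "sphere 0 1 \<in> sets (sphere_volume :: 'a measure)"
    using sets.top[of "sphere_volume :: 'a measure"] unfolding space_sphere_volume .
  then have "emeasure (sphere_volume :: 'a measure) (sphere 0 1) = (\<integral>\<^sup>+x. indicator (sphere 0 1) x \<partial>(sphere_volume :: 'a measure))"
    by simp
  also have "\<dots> = of_nat DIM('a) * shell_integral (indicator (sphere 0 1) :: 'a \<Rightarrow> ennreal) 0 1"
    using sets.top[of "sphere_borel :: 'a measure"]
    by (intro nn_integral_sphere_volume borel_measurable_indicator) (simp add: space_restrict_space)
  finally have eq: "emeasure (sphere_volume :: 'a measure) (sphere 0 1)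
      = of_nat DIM('a) * shell_integral (indicator (sphere 0 1) :: 'a \<Rightarrow> ennreal) 0 1" .
  have "shell_integral (indicator (sphere 0 1) :: 'a \<Rightarrow> ennreal) 0 1 \<le> (\<integral>\<^sup>+x. indicator (cball 0 1) x \<partial>(lborel :: 'a measure))"
    unfolding shell_integral_def by (intro nn_integral_mono) (auto simp: indicator_def)
  also have "\<dots> < \<infinity>" using emeasure_lborel_cball_finite[of "0::'a" 1] by simp
  finally show ?thesis unfolding eq by (simp add: ennreal_mult_less_top of_nat_less_top)
qed

definition chordal_cap :: "'a::euclidean_space \<Rightarrow> real \<Rightarrow> 'a set" where
  "chordal_cap z \<rho> = {x \<in> sphere 0 1. norm (z - x) < \<rho>}"

lemma chordal_cap_measurable: "chordal_cap z \<rho> \<in> sets sphere_borel"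
proof -
  have "chordal_cap z \<rho> = sphere 0 1 \<inter> ball z \<rho>" by (auto simp: chordal_cap_def dist_norm)
  then show ?thesis by (auto simp: sets_restrict_space)
qed

lemma chordal_cap_finite: "emeasure sphere_volume (chordal_cap z \<rho>) < \<infinity>"
proof -
  have "emeasure sphere_volume (chordal_cap z \<rho>) \<le> emeasure sphere_volume (space (sphere_volume :: 'a measure))"
    by (rule emeasure_space)
  also have "\<dots> < \<infinity>" using finite_sphere_volume by simp
  finally show ?thesis .
qed

lemma chordal_cap_shell:
  fixes z :: "'a::euclidean_space"
  assumes "0 < \<rho>" "\<rho> \<le> 1"
  shows "of_nat DIM('a) * emeasure lborel {x. 1 - \<rho> < norm x \<and> norm x \<le> 1 \<and> sgn x \<in> chordal_cap z \<rho>}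
     = ennreal (1 - (1 - \<rho>) ^ DIM('a)) * emeasure sphere_volume (chordal_cap z \<rho>)"
    and "{x. 1 - \<rho> < norm x \<and> norm x \<le> 1 \<and> sgn x \<in> chordal_cap z \<rho>} \<in> sets lborel"
proof -
  let ?h = "indicator (chordal_cap z \<rho>) :: 'a \<Rightarrow> ennreal"
  let ?A = "{x. 1 - \<rho> < norm x \<and> norm x \<le> 1 \<and> sgn x \<in> chordal_cap z \<rho>}"
  have h: "?h \<in> borel_measurable sphere_borel"
    using chordal_cap_measurable by (rule borel_measurable_indicator)
  have int: "(\<integral>\<^sup>+x. ?h x \<partial>sphere_volume) = emeasure sphere_volume (chordal_cap z \<rho>)"
    using chordal_cap_measurable[of z \<rho>] by (intro nn_integral_indicator) simp
  have eq: "(\<lambda>x. ?h (sgn x) * indicator {x. 1 - \<rho> < norm x \<and> norm x \<le> 1} x) = indicator ?A"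
    by (auto simp: indicator_def fun_eq_iff)
  have "(indicator ?A :: 'a \<Rightarrow> ennreal) \<in> borel_measurable lborel"
    unfolding eq[symmetric] measurable_lborel2
    by (rule shell_integrand_measurable[OF h]) (use assms in simp)
  then have "?A \<inter> space lborel \<in> sets lborel" unfolding borel_measurable_indicator_iff .
  then show A: "?A \<in> sets lborel" by (simp only: space_lborel space_borel Int_UNIV_right)
  have "shell_integral ?h (1 - \<rho>) 1 = emeasure lborel ?A"
    unfolding shell_integral_def eq using A by (rule nn_integral_indicator)
  then show "of_nat DIM('a) * emeasure lborel ?A
     = ennreal (1 - (1 - \<rho>) ^ DIM('a)) * emeasure sphere_volume (chordal_cap z \<rho>)"
    using shell_integral_eq[OF h, of "1 - \<rho>" 1] assms chordal_cap_finite[of z \<rho>] by (simp add: int)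
qed

lemma norm_sgn_diff:
  assumes "x \<noteq> 0" shows "norm (sgn x - x) = \<bar>1 - norm (x :: 'a::euclidean_space)\<bar>"
proof -
  have "sgn x - x = (1 - norm x) *\<^sub>R sgn x" using assms by (simp add: sgn_div_norm algebra_simps)
  then show ?thesis using assms by (simp add: norm_sgn)
qed

text \<open>
  The shell of thickness \<open>\<rho>\<close> over a cap of radius \<open>\<rho>\<close> lies in a ball of radius \<open>2 \<rho>\<close>.  Comparing volumes
  costs one factor \<open>\<rho>\<close>, the thickness of the shell.
\<close>

lemma chordal_cap_volume_upper:
  "\<exists>C>0. \<forall>z::'a::euclidean_space. \<forall>\<rho>>0. emeasure sphere_volume (chordal_cap z \<rho>) \<le> ennreal (C * \<rho> ^ (DIM('a) - 1))"
proof -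
  let ?n = "DIM('a)"
  define \<omega> where "\<omega> = unit_ball_vol (real ?n)"
  have \<omega>: "0 < \<omega>" by (simp add: \<omega>_def)
  obtain T where T: "0 \<le> T" "emeasure (sphere_volume :: 'a measure) (sphere 0 1) = ennreal T"
    using finite_sphere_volume[where 'a='a] by (metis ennreal_cases infinity_ennreal_def less_irrefl)
  obtain N where N: "?n = Suc N" using DIM_positive[where 'a='a] by (cases ?n) auto
  define C where "C = real ?n * \<omega> * 2 ^ ?n + T"
  have "emeasure sphere_volume (chordal_cap z \<rho>) \<le> ennreal (C * \<rho> ^ (?n - 1))" if \<rho>: "0 < \<rho>" for z :: 'a and \<rho>
  proof -
    obtain v where v: "0 \<le> v" "emeasure sphere_volume (chordal_cap z \<rho>) = ennreal v"
      using chordal_cap_finite[of z \<rho>] by (metis ennreal_cases infinity_ennreal_def less_irrefl)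
    have "v \<le> C * \<rho> ^ (?n - 1)"
    proof (cases "\<rho> \<le> 1")
      case True
      let ?A = "{x. 1 - \<rho> < norm x \<and> norm x \<le> 1 \<and> sgn x \<in> chordal_cap z \<rho>}"
      have "?A \<subseteq> ball z (2 * \<rho>)"
      proof
        fix x assume x: "x \<in> ?A"
        then have "norm (z - sgn x) < \<rho>" by (simp add: chordal_cap_def)
        moreover have "x \<noteq> 0" using x True by auto
        then have "norm (sgn x - x) < \<rho>" using x by (simp add: norm_sgn_diff)
        ultimately show "x \<in> ball z (2 * \<rho>)"
          using norm_triangle_ineq[of "z - sgn x" "sgn x - x"] by (simp add: dist_norm)
      qed
      then have "emeasure lborel ?A \<le> emeasure lborel (ball z (2 * \<rho>))" by (intro emeasure_mono) auto
      also have "\<dots> = ennreal (\<omega> * (2 * \<rho>) ^ ?n)" using \<rho> by (simp add: emeasure_ball \<omega>_def)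
      finally have "of_nat ?n * emeasure lborel ?A \<le> of_nat ?n * ennreal (\<omega> * (2 * \<rho>) ^ ?n)"
        by (rule mult_left_mono) simp
      then have "ennreal (1 - (1 - \<rho>) ^ ?n) * ennreal v \<le> of_nat ?n * ennreal (\<omega> * (2 * \<rho>) ^ ?n)"
        unfolding chordal_cap_shell(1)[OF \<rho> True, of z] v .
      then have "(1 - (1 - \<rho>) ^ ?n) * v \<le> real ?n * (\<omega> * (2 * \<rho>) ^ ?n)"
        using v \<rho> True \<omega> by (simp add: ennreal_mult[symmetric] ennreal_of_nat_eq_real_of_nat power_le_one)
      moreover have "\<rho> \<le> 1 - (1 - \<rho>) ^ ?n"
        using \<rho> True power_decreasing[of 1 ?n "1 - \<rho>"] by simp
      ultimately have "\<rho> * v \<le> real ?n * (\<omega> * (2 * \<rho>) ^ ?n)"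
        using v by (meson mult_right_mono order_trans)
      also have "\<dots> = \<rho> * (real ?n * \<omega> * 2 ^ ?n * \<rho> ^ (?n - 1))" by (simp add: N power_mult_distrib)
      finally have "v \<le> real ?n * \<omega> * 2 ^ ?n * \<rho> ^ (?n - 1)" using \<rho> by (simp only: mult_le_cancel_left_pos)
      also have "\<dots> \<le> C * \<rho> ^ (?n - 1)" using T \<rho> by (intro mult_right_mono) (auto simp: C_def)
      finally show ?thesis .
    next
      case False
      have "ennreal v \<le> ennreal T"
        unfolding v(2)[symmetric] T(2)[symmetric] using emeasure_space[of sphere_volume "chordal_cap z \<rho>"] by simp
      then have "v * 1 \<le> C * \<rho> ^ (?n - 1)"
        using T v False \<omega> by (intro mult_mono) (auto simp: C_def add_increasing one_le_power)
      then show ?thesis by simp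
    qed
    then show ?thesis using v by (simp add: ennreal_leI)
  qed
  moreover have "0 < C" using \<omega> T by (simp add: C_def add_pos_nonneg)
  ultimately show ?thesis by blast
qed

text \<open>
  Conversely, the shell of thickness \<open>\<rho>\<close> over the cap contains a ball of radius \<open>\<rho> / 8\<close>.
\<close>

lemma chordal_cap_volume_lower:
  "\<exists>c>0. \<forall>z::'a::euclidean_space. \<forall>\<rho>. norm z = 1 \<longrightarrow> 0 < \<rho> \<longrightarrow> \<rho> \<le> 1 \<longrightarrow>
     ennreal (c * \<rho> ^ (DIM('a) - 1)) \<le> emeasure sphere_volume (chordal_cap z \<rho>)"
proof -
  let ?n = "DIM('a)"
  define \<omega> where "\<omega> = unit_ball_vol (real ?n)"
  have \<omega>: "0 < \<omega>" by (simp add: \<omega>_def)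
  obtain N where N: "?n = Suc N" using DIM_positive[where 'a='a] by (cases ?n) auto
  have "ennreal (\<omega> / 8 ^ ?n * \<rho> ^ (?n - 1)) \<le> emeasure sphere_volume (chordal_cap z \<rho>)"
    if z: "norm z = 1" and \<rho>: "0 < \<rho>" "\<rho> \<le> 1" for z :: 'a and \<rho>
  proof -
    obtain v where v: "0 \<le> v" "emeasure sphere_volume (chordal_cap z \<rho>) = ennreal v"
      using chordal_cap_finite[of z \<rho>] by (metis ennreal_cases infinity_ennreal_def less_irrefl)
    let ?A = "{x. 1 - \<rho> < norm x \<and> norm x \<le> 1 \<and> sgn x \<in> chordal_cap z \<rho>}"
    have "ball ((1 - \<rho> / 4) *\<^sub>R z) (\<rho> / 8) \<subseteq> ?A"
    proof
      fix x assume "x \<in> ball ((1 - \<rho> / 4) *\<^sub>R z) (\<rho> / 8)"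
      then have d: "norm ((1 - \<rho> / 4) *\<^sub>R z - x) < \<rho> / 8" by (simp add: dist_norm)
      have nz: "norm ((1 - \<rho> / 4) *\<^sub>R z) = 1 - \<rho> / 4" using z \<rho> by simp
      have x: "1 - 3 * \<rho> / 8 < norm x" "norm x < 1 - \<rho> / 8"
        using norm_triangle_ineq2[of "(1 - \<rho> / 4) *\<^sub>R z" x] norm_triangle_ineq2[of x "(1 - \<rho> / 4) *\<^sub>R z"] d nz
        by (auto simp: norm_minus_commute)
      have "x \<noteq> 0" using x \<rho> by auto
      then have n1: "norm (x - sgn x) < 3 * \<rho> / 8" using x \<rho>
        by (subst norm_minus_commute) (simp add: norm_sgn_diff)
      have "z - (1 - \<rho> / 4) *\<^sub>R z = (\<rho> / 4) *\<^sub>R z" by (simp add: algebra_simps)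
      then have n2: "norm (z - (1 - \<rho> / 4) *\<^sub>R z) = \<rho> / 4" using z \<rho> by simp
      have "norm (z - sgn x) \<le> norm (z - (1 - \<rho> / 4) *\<^sub>R z) + norm ((1 - \<rho> / 4) *\<^sub>R z - x) + norm (x - sgn x)"
        using norm_triangle_ineq[of "z - (1 - \<rho> / 4) *\<^sub>R z" "(1 - \<rho> / 4) *\<^sub>R z - x"]
          norm_triangle_ineq[of "z - x" "x - sgn x"] by simp
      then have "norm (z - sgn x) < \<rho>" using n1 n2 d \<rho> by linarith
      then show "x \<in> ?A" using x \<rho> \<open>x \<noteq> 0\<close> by (simp add: chordal_cap_def norm_sgn)
    qed
    then have "emeasure lborel (ball ((1 - \<rho> / 4) *\<^sub>R z) (\<rho> / 8)) \<le> emeasure lborel ?A"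
      by (intro emeasure_mono chordal_cap_shell(2) \<rho>)
    then have "ennreal (\<omega> * (\<rho> / 8) ^ ?n) \<le> emeasure lborel ?A"
      using \<rho> by (simp add: emeasure_ball \<omega>_def)
    then have "of_nat ?n * ennreal (\<omega> * (\<rho> / 8) ^ ?n) \<le> of_nat ?n * emeasure lborel ?A"
      by (rule mult_left_mono) simp
    then have "of_nat ?n * ennreal (\<omega> * (\<rho> / 8) ^ ?n) \<le> ennreal (1 - (1 - \<rho>) ^ ?n) * ennreal v"
      unfolding chordal_cap_shell(1)[OF \<rho>, of z] v .
    then have "real ?n * (\<omega> * (\<rho> / 8) ^ ?n) \<le> (1 - (1 - \<rho>) ^ ?n) * v"
      using v \<rho> \<omega> by (simp add: ennreal_mult[symmetric] ennreal_of_nat_eq_real_of_nat power_le_one)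
    also have "\<dots> \<le> (real ?n * \<rho>) * v"
      using Bernoulli_inequality[of "- \<rho>" ?n] \<rho> v by (intro mult_right_mono) auto
    finally have "(real ?n * \<rho>) * (\<omega> / 8 ^ ?n * \<rho> ^ (?n - 1)) \<le> (real ?n * \<rho>) * v"
      by (simp add: N power_divide field_simps)
    then have "\<omega> / 8 ^ ?n * \<rho> ^ (?n - 1) \<le> v"
      by (rule mult_left_le_imp_le) (use \<rho> DIM_positive[where 'a='a] in simp)
    then show ?thesis using v by (simp add: ennreal_leI)
  qed
  moreover have "0 < \<omega> / 8 ^ ?n" using \<omega> by simp
  ultimately show ?thesis by blast
qed

section \<open>Local bounds for eigenfunctions and the sufficiency estimate\<close>

text \<open>
  The nonnegative root of the quadratic equation; with \<open>a = n - 2\<close> it is the degree of the harmonic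
  extension.  The bound \<open>\<alpha> \<le> lam\<close> controls \<open>\<bar>x\<bar> powr \<alpha>\<close> near the sphere.
\<close>

lemma harmonic_degree_exists:
  assumes "0 \<le> lam" "0 \<le> a"
  obtains \<alpha> :: real where "0 \<le> \<alpha>" "\<alpha> \<le> lam" "\<alpha> * (\<alpha> + a) = lam\<^sup>2"
proof -
  define s where "s = sqrt (a\<^sup>2 + 4 * lam\<^sup>2)"
  have s2: "s * s = a * a + 4 * (lam * lam)" by (simp add: s_def power2_eq_square)
  have "a \<le> s" unfolding s_def using assms by (intro real_le_rsqrt) auto
  moreover have "s \<le> a + 2 * lam"
    unfolding s_def using assms by (intro real_le_lsqrt) (auto simp: power2_eq_square algebra_simps)
  moreover have "(s - a) / 2 * ((s - a) / 2 + a) = (s * s - a * a) / 4" by (simp add: field_simps)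
  then have "(s - a) / 2 * ((s - a) / 2 + a) = lam\<^sup>2" by (simp add: s2 power2_eq_square)
  ultimately show ?thesis using that[of "(s - a) / 2"] by simp
qed

lemma integral_parabola_weight_pos:
  "0 < integral (cbox (- One) One) (parabola_weight :: 'a::euclidean_space \<Rightarrow> real)"
proof -
  let ?Q = "cbox (- One) One :: 'a set"
  have i: "(parabola_weight :: 'a \<Rightarrow> real) integrable_on ?Q"
    by (intro integrable_continuous parabola_weight_continuous)
  have "0 \<le> integral ?Q parabola_weight"
    by (intro integral_nonneg i) (simp add: parabola_weight_bounds)
  moreover have "integral ?Q parabola_weight \<noteq> 0"
  proof
    assume "integral ?Q parabola_weight = 0"
    then have "(parabola_weight has_integral 0) ?Q" using i by (metis integrable_integral)
    moreover have "box (- One) One \<noteq> ({} :: 'a set)" by (simp add: box_ne_empty inner_minus_left)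
    ultimately have "parabola_weight (0::'a) = 0"
      by (intro has_integral_0_cbox_imp_0[of "- One" One] parabola_weight_continuous)
         (auto simp: parabola_weight_bounds mem_box)
    then show False by (simp add: parabola_weight_def)
  qed
  ultimately show ?thesis by linarith
qed

lemma norm_le_DIM_cbox_One:
  assumes "(y::'a::euclidean_space) \<in> cbox (- One) One" shows "norm y \<le> real DIM('a)"
proof -
  have "norm y \<le> (\<Sum>b\<in>Basis. \<bar>y \<bullet> b\<bar>)" by (rule norm_le_l1)
  also have "\<dots> \<le> (\<Sum>b\<in>(Basis::'a set). 1)"
    using assms by (intro sum_mono) (auto simp: mem_box abs_le_iff minus_le_iff)
  finally show ?thesis by simp
qed

definition ennreal_abs_powr :: "('a::euclidean_space \<Rightarrow> real) \<Rightarrow> real \<Rightarrow> 'a \<Rightarrow> ennreal" where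
  "ennreal_abs_powr f p x = ennreal (\<bar>f x\<bar> powr p)"

lemma ennreal_abs_powr_measurable:
  assumes "sphere_C2 (f :: 'a::euclidean_space \<Rightarrow> real)"
  shows "ennreal_abs_powr f p \<in> borel_measurable sphere_borel"
proof -
  have [measurable]: "f \<in> borel_measurable sphere_borel"
    by (rule borel_measurable_continuous_on_restrict[OF sphere_C2_continuous[OF assms]])
  show ?thesis unfolding ennreal_abs_powr_def[abs_def] by measurable
qed

text \<open>
  The mean value property of the harmonic extension in a ball of radius \<open>\<epsilon> / lam\<close>, followed by
  Jensen's inequality.  In this ball the radial factor is at most
  \<open>(1 + \<epsilon> / lam) powr lam \<le> exp \<epsilon>\<close>.
\<close>

lemma eigenfunction_sub_mean_value:
  fixes f :: "'a::euclidean_space \<Rightarrow> real"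
  assumes dim: "2 \<le> DIM('a)" and p: "1 < p"
    and \<epsilon>: "0 < \<epsilon>" "\<epsilon> \<le> 1 / (2 * real DIM('a))" and lam: "1 \<le> lam"
    and f: "real_eigenfunction lam f" and z: "norm z = 1"
  shows "ennreal (integral (cbox (- One) One) (parabola_weight :: 'a \<Rightarrow> real) * (\<epsilon> / lam) ^ DIM('a)) * ennreal_abs_powr f p z
    \<le> ennreal (exp p) * (\<integral>\<^sup>+x. ennreal_abs_powr f p (sgn x) * indicator (cball z (\<epsilon> / lam)) x \<partial>lborel)"
proof -
  let ?n = "DIM('a)"
  let ?Q = "cbox (- One) One :: 'a set"
  define \<delta> where "\<delta> = \<epsilon> / lam"
  define c where "c = integral ?Q parabola_weight"
  have c: "0 < c" unfolding c_def by (rule integral_parabola_weight_pos)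
  have "\<epsilon> / lam \<le> \<epsilon> / 1" using lam \<epsilon> by (intro divide_left_mono) auto
  then have \<delta>: "0 < \<delta>" "\<delta> * real ?n \<le> 1 / 2" "\<delta> * lam = \<epsilon>"
    using \<epsilon> lam dim by (auto simp: \<delta>_def field_simps)
  have "1 / (2 * real ?n) \<le> 1 / 4" using dim by (intro divide_left_mono) auto
  then have e1: "\<epsilon> \<le> 1 / 4" using \<epsilon> by linarith
  have d1: "\<delta> \<le> 1 / 4" using \<open>\<epsilon> / lam \<le> \<epsilon> / 1\<close> e1 unfolding \<delta>_def by linarith
  obtain \<alpha> where \<alpha>: "0 \<le> \<alpha>" "\<alpha> \<le> lam" "\<alpha> * (\<alpha> + (real ?n - 2)) = lam\<^sup>2"
    using harmonic_degree_exists[of lam "real ?n - 2"] lam dim by auto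
  have C2: "sphere_C2 f" using f by (simp add: real_eigenfunction_def)
  define H where "H x = ennreal_abs_powr f p (sgn x) * indicator (cball z \<delta>) x" for x
  define u where "u y = norm y powr \<alpha> * f (sgn y)" for y
  obtain G D where GD: "\<And>x. x \<noteq> 0 \<Longrightarrow> (u has_derivative (\<lambda>v. G x \<bullet> v)) (at x)"
    "\<And>x. x \<noteq> 0 \<Longrightarrow> (G has_derivative D x) (at x)"
    "\<And>b. continuous_on (-{0}) (\<lambda>x. D x b)" "\<And>x. x \<noteq> 0 \<Longrightarrow> trace_map (D x) = 0"
    using harmonic_extension[OF f, of \<alpha>] \<alpha>(3) unfolding u_def[abs_def] by (auto simp: add_diff_eq)
  have nz: "z + t *\<^sub>R y \<noteq> 0" if "0 \<le> t" "t \<le> \<delta>" "y \<in> ?Q" for t y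
  proof
    assume "z + t *\<^sub>R y = 0"
    then have "norm z = norm (t *\<^sub>R y)" by (metis add_eq_0_iff norm_minus_cancel)
    also have "\<dots> \<le> \<delta> * real ?n"
      using that norm_le_DIM_cbox_One[OF that(3)] by (auto intro!: mult_mono)
    finally show False using z \<delta> by simp
  qed
  have mv: "integral ?Q (\<lambda>y. parabola_weight y * u (z + \<delta> *\<^sub>R y)) = c * u z"
    unfolding c_def
    by (rule weighted_mean_value[where U="-{0}" and G=G and D=D]) (use \<delta> nz GD in auto)
  have uz: "u z = f z" using z by (simp add: u_def)
  have cu: "continuous_on ?Q (\<lambda>y. u (z + \<delta> *\<^sub>R y))"
  proof (rule continuous_on_compose2[of "-{0}" u])
    show "continuous_on (-{0}) u"
      by (auto intro!: continuous_at_imp_continuous_on has_derivative_continuous[OF GD(1)])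
  qed (use nz[of \<delta>] \<delta> in \<open>auto intro!: continuous_intros\<close>)
  have "c * (\<bar>c * u z\<bar> / c) powr p \<le> integral ?Q (\<lambda>y. parabola_weight y * \<bar>u (z + \<delta> *\<^sub>R y)\<bar> powr p)"
    unfolding mv[symmetric]
    by (rule jensen_powr[OF p]) (use cu c in \<open>auto simp: parabola_weight_bounds parabola_weight_continuous c_def\<close>)
  then have J: "c * \<bar>f z\<bar> powr p \<le> integral ?Q (\<lambda>y. parabola_weight y * \<bar>u (z + \<delta> *\<^sub>R y)\<bar> powr p)"
    using c uz by (simp add: abs_mult)
  let ?I = "integral ?Q (\<lambda>y. parabola_weight y * \<bar>u (z + \<delta> *\<^sub>R y)\<bar> powr p)"
  have cup: "continuous_on ?Q (\<lambda>y. \<bar>u (z + \<delta> *\<^sub>R y)\<bar> powr p)"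
    using p by (intro continuous_on_powr' continuous_intros cu) auto
  have "(\<lambda>y. parabola_weight y * \<bar>u (z + \<delta> *\<^sub>R y)\<bar> powr p) integrable_on ?Q"
    by (intro integrable_continuous continuous_on_mult parabola_weight_continuous cup)
  then have "ennreal ?I = (\<integral>\<^sup>+y. ennreal (parabola_weight y * \<bar>u (z + \<delta> *\<^sub>R y)\<bar> powr p) * indicator ?Q y \<partial>lborel)"
    by (intro nn_integral_has_integral_lebesgue'[symmetric]) (auto simp: parabola_weight_bounds integrable_integral)
  also have "\<dots> \<le> (\<integral>\<^sup>+y. ennreal (exp p) * H (z + \<delta> *\<^sub>R y) \<partial>lborel)"
  proof (rule nn_integral_mono)
    fix y
    show "ennreal (parabola_weight y * \<bar>u (z + \<delta> *\<^sub>R y)\<bar> powr p) * indicator ?Q y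
       \<le> ennreal (exp p) * H (z + \<delta> *\<^sub>R y)"
    proof (cases "y \<in> cball 0 1")
      case False
      then show ?thesis by (simp add: parabola_weight_outside)
    next
      case True
      then have y: "norm y \<le> 1" by simp
      have yQ: "y \<in> ?Q" using True cball_subset_cbox_One by blast
      let ?x = "z + \<delta> *\<^sub>R y"
      have x0: "?x \<noteq> 0" using nz[of \<delta> y] yQ \<delta> by simp
      have xc: "?x \<in> cball z \<delta>" using y \<delta> by (simp add: dist_norm)
      have nx: "norm ?x \<le> 1 + \<delta>"
      proof -
        have "norm (\<delta> *\<^sub>R y) \<le> \<delta> * 1" using y \<delta> by (auto intro: mult_left_mono)
        then show ?thesis using norm_triangle_ineq[of z "\<delta> *\<^sub>R y"] z by linarith
      qed
      have "norm ?x powr \<alpha> \<le> (1 + \<delta>) powr \<alpha>" using nx \<alpha> by (intro powr_mono2) auto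
      also have "\<dots> \<le> exp \<delta> powr \<alpha>" using \<alpha> \<delta> by (intro powr_mono2) (auto intro: exp_ge_add_one_self)
      also have "\<dots> = exp (\<delta> * \<alpha>)" by (simp add: powr_def mult.commute)
      also have "\<dots> \<le> exp 1"
        using mult_left_mono[OF \<alpha>(2), of \<delta>] \<delta> e1 by simp
      finally have na: "norm ?x powr \<alpha> \<le> exp 1" .
      have "\<bar>u ?x\<bar> powr p \<le> (exp 1 * \<bar>f (sgn ?x)\<bar>) powr p"
        using na p by (intro powr_mono2) (auto simp: u_def abs_mult intro!: mult_right_mono)
      also have "\<dots> = exp p * \<bar>f (sgn ?x)\<bar> powr p"
      proof -
        have "exp 1 powr p = exp p" by (simp add: powr_def)
        then show ?thesis by (simp add: powr_mult)
      qed
      finally have "parabola_weight y * \<bar>u ?x\<bar> powr p \<le> 1 * (exp p * \<bar>f (sgn ?x)\<bar> powr p)"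
        using parabola_weight_bounds by (intro mult_mono) auto
      then have "ennreal (parabola_weight y * \<bar>u ?x\<bar> powr p) \<le> ennreal (exp p * \<bar>f (sgn ?x)\<bar> powr p)"
        by (intro ennreal_leI) simp
      then show ?thesis using xc yQ by (simp add: H_def ennreal_abs_powr_def ennreal_mult)
    qed
  qed
  finally have le0: "ennreal ?I \<le> (\<integral>\<^sup>+y. ennreal (exp p) * H (z + \<delta> *\<^sub>R y) \<partial>lborel)" .
  have pull: "(\<integral>\<^sup>+y. ennreal (exp p) * H (z + \<delta> *\<^sub>R y) \<partial>lborel)
      = ennreal (exp p) * (\<integral>\<^sup>+y. H (z + \<delta> *\<^sub>R y) \<partial>lborel)"
    and scale: "ennreal (\<delta> ^ ?n) * (\<integral>\<^sup>+y. H (z + \<delta> *\<^sub>R y) \<partial>lborel)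
      = (\<integral>\<^sup>+x. H x \<partial>lborel)"
  proof -
    have "(\<lambda>x. ennreal_abs_powr f p (sgn x) * indicator (-{0}) x * indicator (cball z \<delta>) x) \<in> borel_measurable borel"
      by (intro borel_measurable_times_ennreal[OF compose_sgn_measurable[OF ennreal_abs_powr_measurable[OF C2]]]
          borel_measurable_indicator) simp
    moreover have "0 \<notin> cball z \<delta>" using z d1 by simp
    then have "(\<lambda>x. ennreal_abs_powr f p (sgn x) * indicator (-{0}) x * indicator (cball z \<delta>) x) = H"
      by (auto simp: H_def indicator_def fun_eq_iff)
    ultimately have g: "H \<in> borel_measurable borel" by simp
    have "(\<lambda>y. H (z + \<delta> *\<^sub>R y)) \<in> borel_measurable borel"
      by (rule measurable_compose[OF _ g]) measurable
    then show "(\<integral>\<^sup>+y. ennreal (exp p) * H (z + \<delta> *\<^sub>R y) \<partial>lborel) = ennreal (exp p) * (\<integral>\<^sup>+y. H (z + \<delta> *\<^sub>R y) \<partial>lborel)"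
      by (intro nn_integral_cmult) simp
    show "ennreal (\<delta> ^ ?n) * (\<integral>\<^sup>+y. H (z + \<delta> *\<^sub>R y) \<partial>lborel) = (\<integral>\<^sup>+x. H x \<partial>lborel)"
      by (rule nn_integral_lborel_affine[OF g \<delta>(1), symmetric])
  qed
  have le: "ennreal ?I \<le> ennreal (exp p) * (\<integral>\<^sup>+y. H (z + \<delta> *\<^sub>R y) \<partial>lborel)"
    using le0 unfolding pull .
  have "ennreal (c * \<delta> ^ ?n) * ennreal_abs_powr f p z = ennreal (\<delta> ^ ?n) * ennreal (c * \<bar>f z\<bar> powr p)"
    using c \<delta> by (simp add: ennreal_abs_powr_def ennreal_mult[symmetric] mult_ac)
  also have "\<dots> \<le> ennreal (\<delta> ^ ?n) * ennreal ?I" using J by (intro mult_left_mono ennreal_leI) auto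
  also have "\<dots> \<le> ennreal (\<delta> ^ ?n) * (ennreal (exp p) * (\<integral>\<^sup>+y. H (z + \<delta> *\<^sub>R y) \<partial>lborel))"
    by (rule mult_left_mono[OF le]) simp
  also have "\<dots> = ennreal (exp p) * (\<integral>\<^sup>+x. H x \<partial>lborel)"
    unfolding scale[symmetric] by (rule mult.left_commute)
  finally show ?thesis by (simp add: H_def c_def \<delta>_def)
qed

lemma power_diff_bound:
  fixes a b :: real
  assumes "0 \<le> a" "a \<le> b" "b \<le> 2"
  shows "b ^ n - a ^ n \<le> 2 ^ n * real n * (b - a)"
proof -
  have "norm ((b / 2) ^ n - (a / 2) ^ n) \<le> real n * norm (b / 2 - a / 2)"
    using assms by (intro norm_power_diff) auto
  then have "(b / 2) ^ n - (a / 2) ^ n \<le> real n * (b - a)"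
  proof -
    have "norm (b / 2 - a / 2) = (b - a) / 2" using assms by simp
    then have "\<bar>(b / 2) ^ n - (a / 2) ^ n\<bar> \<le> real n * (b - a) / 2"
      using \<open>norm _ \<le> _\<close> by (simp only: real_norm_def times_divide_eq_right)
    moreover have "0 \<le> real n * (b - a)" using assms by simp
    ultimately show ?thesis by linarith
  qed
  then have "2 ^ n * ((b / 2) ^ n - (a / 2) ^ n) \<le> 2 ^ n * (real n * (b - a))" by (intro mult_left_mono) auto
  then show ?thesis by (simp add: right_diff_distrib power_divide mult.assoc)
qed

text \<open>
  Integrate the sub-mean value inequality against \<open>M\<close> and exchange the integrals: the inner integral
  is the \<open>M\<close>-measure of the part of the sphere within \<open>\<delta> = \<epsilon> / lam\<close> of a point \<open>x\<close>.  It lies in a cap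
  of radius \<open>3 \<delta>\<close> about \<open>sgn x\<close>, and it is empty unless \<open>x\<close> is in a shell of thickness comparable to \<open>\<delta>\<close>,
  over which \<open>f \<circ> sgn\<close> is integrated by polar coordinates.
\<close>

lemma carleson_of_ball_bound:
  fixes M :: "'a::euclidean_space measure" and f :: "'a \<Rightarrow> real"
  assumes dim: "2 \<le> DIM('a)" and p: "1 < p"
    and \<epsilon>: "0 < \<epsilon>" "\<epsilon> \<le> 1 / (2 * real DIM('a))" and lam: "1 \<le> lam"
    and f: "real_eigenfunction lam f"
    and sets: "sets M = sets sphere_borel"
    and K: "0 \<le> K" "\<And>w. norm w = 1 \<Longrightarrow> emeasure M (chordal_cap w (3 * \<epsilon> / lam)) \<le> ennreal (K / lam ^ (DIM('a) - 1))"
  shows "(\<integral>\<^sup>+x. ennreal_abs_powr f p x \<partial>M)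
    \<le> ennreal (3 * 2 ^ DIM('a) * exp p * K / (integral (cbox (- One) One) (parabola_weight :: 'a \<Rightarrow> real) * \<epsilon> ^ (DIM('a) - 1)))
        * (\<integral>\<^sup>+x. ennreal_abs_powr f p x \<partial>sphere_volume)"
proof -
  let ?n = "DIM('a)"
  let ?h = "ennreal_abs_powr f p"
  define \<delta> where "\<delta> = \<epsilon> / lam"
  define c where "c = integral (cbox (- One) One) (parabola_weight :: 'a \<Rightarrow> real)"
  have c: "0 < c" unfolding c_def by (rule integral_parabola_weight_pos)
  have "\<epsilon> / lam \<le> \<epsilon> / 1" using lam \<epsilon> by (intro divide_left_mono) auto
  moreover have "1 / (2 * real ?n) \<le> 1 / 4" using dim by (intro divide_left_mono) auto
  ultimately have "\<delta> \<le> 1 / 4" using \<epsilon>(2) unfolding \<delta>_def by linarith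
  moreover have "0 < \<delta>" using \<epsilon> lam by (simp add: \<delta>_def)
  ultimately have \<delta>: "0 < \<delta>" "\<delta> \<le> 1 / 4" by auto
  have C2: "sphere_C2 f" using f by (simp add: real_eigenfunction_def)
  note h = ennreal_abs_powr_measurable[OF C2, of p]
  have space: "space M = sphere 0 1" using sets_eq_imp_space_eq[OF sets] by (simp add: space_restrict_space)
  have capM: "chordal_cap w \<rho> \<in> sets M" for w \<rho> using chordal_cap_measurable sets by simp
  \<comment> \<open>Finitely many caps cover the sphere, so that Fubini is applicable.\<close>
  interpret M: finite_measure M
  proof
    have "compact (sphere 0 1 :: 'a set)" by simp
    moreover have "sphere 0 1 \<subseteq> (\<Union>w\<in>sphere 0 1. ball w (3 * \<delta>) :: 'a set)" using \<delta> by force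
    ultimately have "\<exists>T\<subseteq>sphere 0 1. finite T \<and> sphere 0 1 \<subseteq> (\<Union>w\<in>T. ball w (3 * \<delta>) :: 'a set)"
      using compactE_image[of "sphere 0 1" "sphere 0 1" "\<lambda>w::'a. ball w (3 * \<delta>)"] open_ball by metis
    then obtain T where T: "T \<subseteq> sphere 0 1" "finite T" "sphere 0 1 \<subseteq> (\<Union>w\<in>T. ball w (3 * \<delta>) :: 'a set)"
      by blast
    have "sphere 0 1 \<subseteq> (\<Union>w\<in>T. chordal_cap w (3 * \<delta>))"
    proof
      fix x :: 'a assume x: "x \<in> sphere 0 1"
      then obtain w where "w \<in> T" "x \<in> ball w (3 * \<delta>)" using T(3) by blast
      then show "x \<in> (\<Union>w\<in>T. chordal_cap w (3 * \<delta>))" using x by (auto simp: chordal_cap_def dist_norm)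
    qed
    then have "emeasure M (space M) \<le> emeasure M (\<Union>w\<in>T. chordal_cap w (3 * \<delta>))"
      unfolding space using capM T(2) by (intro emeasure_mono) auto
    also have "\<dots> \<le> (\<Sum>w\<in>T. emeasure M (chordal_cap w (3 * \<delta>)))"
      using capM T(2) by (intro emeasure_subadditive_finite) auto
    also have "\<dots> \<le> (\<Sum>w\<in>T. ennreal (K / lam ^ (?n - 1)))"
      using T(1) K(2) by (intro sum_mono) (auto simp: \<delta>_def)
    also have "\<dots> < \<infinity>" by (simp add: ennreal_mult_less_top of_nat_less_top)
    finally show "emeasure M (space M) \<noteq> \<infinity>" by simp
  qed
  interpret P: pair_sigma_finite M lborel ..
  define k where "k z x = ?h (sgn x) * indicator (-{0}) x * indicator {(z, x). dist z x \<le> \<delta>} (z, x)" for z x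
  have k: "case_prod k \<in> borel_measurable (M \<Otimes>\<^sub>M lborel)"
  proof -
    have [measurable]: "(\<lambda>z. z) \<in> M \<rightarrow>\<^sub>M borel"
      using measurable_restrict_space1[of "\<lambda>z::'a. z" borel borel "sphere 0 1"] measurable_cong_sets[OF sets refl, of borel] by auto
    have [measurable]: "(\<lambda>x. ?h (sgn x) * indicator (-{0}) x) \<in> borel_measurable borel"
      by (rule compose_sgn_measurable[OF h])
    have "(\<lambda>zx. ?h (sgn (snd zx)) * indicator (-{0}) (snd zx) * (if dist (fst zx) (snd zx) \<le> \<delta> then 1 else 0)) \<in> borel_measurable (M \<Otimes>\<^sub>M lborel)"
      by measurable
    then show ?thesis by (simp add: k_def split_beta' indicator_def of_bool_def)
  qed
  \<comment> \<open>Points within \<open>\<delta>\<close> of \<open>x\<close> lie within \<open>2 \<delta>\<close> of \<open>sgn x\<close>; the shell is open at its inner end, hence \<open>1 - 2 \<delta>\<close>.\<close>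
  have kcap: "(\<integral>\<^sup>+z. k z x \<partial>M) \<le> ennreal (K / lam ^ (?n - 1)) * (?h (sgn x) * indicator {x. 1 - 2 * \<delta> < norm x \<and> norm x \<le> 1 + \<delta>} x)" for x
  proof (cases "\<exists>z\<in>sphere 0 1. dist z x \<le> \<delta>")
    case False
    then have "(\<integral>\<^sup>+z. k z x \<partial>M) = (\<integral>\<^sup>+z. 0 \<partial>M)" by (intro nn_integral_cong) (auto simp: k_def space)
    then show ?thesis by simp
  next
    case True
    then obtain z0 where z0: "norm z0 = 1" "norm (z0 - x) \<le> \<delta>" by (auto simp: dist_norm)
    have nx: "1 - \<delta> \<le> norm x" "norm x \<le> 1 + \<delta>"
      using norm_triangle_ineq2[of z0 x] norm_triangle_ineq2[of x z0] z0 by (auto simp: norm_minus_commute)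
    then have x0: "x \<noteq> 0" using \<delta> by auto
    have sx: "norm (sgn x - x) \<le> \<delta>" using nx by (simp add: norm_sgn_diff[OF x0] abs_le_iff)
    have "(\<integral>\<^sup>+z. k z x \<partial>M) \<le> (\<integral>\<^sup>+z. ?h (sgn x) * indicator (chordal_cap (sgn x) (3 * \<delta>)) z \<partial>M)"
    proof (rule nn_integral_mono)
      fix z assume "z \<in> space M"
      have "z \<in> chordal_cap (sgn x) (3 * \<delta>)" if "dist z x \<le> \<delta>"
        using norm_triangle_ineq[of "sgn x - x" "x - z"] sx that \<open>z \<in> space M\<close> \<delta>
        by (auto simp: chordal_cap_def space dist_norm norm_minus_commute)
      then show "k z x \<le> ?h (sgn x) * indicator (chordal_cap (sgn x) (3 * \<delta>)) z"
        by (auto simp: k_def indicator_def)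
    qed
    also have "\<dots> = ?h (sgn x) * emeasure M (chordal_cap (sgn x) (3 * \<delta>))"
      by (rule nn_integral_cmult_indicator[OF capM])
    also have "\<dots> \<le> ?h (sgn x) * ennreal (K / lam ^ (?n - 1))"
      using K(2)[of "sgn x"] x0 by (intro mult_left_mono) (auto simp: norm_sgn \<delta>_def)
    also have "\<dots> = ennreal (K / lam ^ (?n - 1)) * (?h (sgn x) * indicator {x. 1 - 2 * \<delta> < norm x \<and> norm x \<le> 1 + \<delta>} x)"
      using nx \<delta> by (simp add: mult.commute)
    finally show ?thesis .
  qed
  have fin: "(\<integral>\<^sup>+x. ?h x \<partial>sphere_volume) < \<infinity>"
  proof -
    obtain B where B: "\<forall>x\<in>sphere 0 1. \<bar>f x\<bar> \<le> B"
      using compact_imp_bounded[OF compact_continuous_image[OF sphere_C2_continuous[OF C2] compact_sphere]]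
      by (auto simp: bounded_iff)
    have "(\<integral>\<^sup>+x. ?h x \<partial>sphere_volume) \<le> (\<integral>\<^sup>+x. ennreal (B powr p) \<partial>(sphere_volume :: 'a measure))"
      using B p by (intro nn_integral_mono) (auto simp: ennreal_abs_powr_def intro!: ennreal_leI powr_mono2)
    also have "\<dots> < \<infinity>" using finite_sphere_volume[where 'a='a] by (simp add: ennreal_mult_less_top)
    finally show ?thesis .
  qed
  let ?I = "\<integral>\<^sup>+x. ?h x \<partial>sphere_volume"
  have "ennreal (c * \<delta> ^ ?n) * (\<integral>\<^sup>+z. ?h z \<partial>M) = (\<integral>\<^sup>+z. ennreal (c * \<delta> ^ ?n) * ?h z \<partial>M)"
    using h by (intro nn_integral_cmult[symmetric]) (simp add: measurable_cong_sets[OF sets refl])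
  also have "\<dots> \<le> (\<integral>\<^sup>+z. ennreal (exp p) * (\<integral>\<^sup>+x. k z x \<partial>lborel) \<partial>M)"
  proof (rule nn_integral_mono)
    fix z assume "z \<in> space M"
    then have z: "norm z = 1" by (simp add: space)
    have "(\<integral>\<^sup>+x. ?h (sgn x) * indicator (cball z \<delta>) x \<partial>lborel) = (\<integral>\<^sup>+x. k z x \<partial>lborel)"
      using z \<delta> by (intro nn_integral_cong) (auto simp: k_def indicator_def)
    then show "ennreal (c * \<delta> ^ ?n) * ?h z \<le> ennreal (exp p) * (\<integral>\<^sup>+x. k z x \<partial>lborel)"
      using eigenfunction_sub_mean_value[OF dim p \<epsilon> lam f z] by (simp add: c_def \<delta>_def)
  qed
  also have "\<dots> = ennreal (exp p) * (\<integral>\<^sup>+z. \<integral>\<^sup>+x. k z x \<partial>lborel \<partial>M)"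
    by (intro nn_integral_cmult lborel.borel_measurable_nn_integral k)
  also have "(\<integral>\<^sup>+z. \<integral>\<^sup>+x. k z x \<partial>lborel \<partial>M) = (\<integral>\<^sup>+x. \<integral>\<^sup>+z. k z x \<partial>M \<partial>lborel)"
    by (rule P.Fubini'[OF k, symmetric])
  also have "ennreal (exp p) * (\<integral>\<^sup>+x. \<integral>\<^sup>+z. k z x \<partial>M \<partial>lborel)
    \<le> ennreal (exp p) * (\<integral>\<^sup>+x. ennreal (K / lam ^ (?n - 1)) * (?h (sgn x) * indicator {x. 1 - 2 * \<delta> < norm x \<and> norm x \<le> 1 + \<delta>} x) \<partial>lborel)"
    by (intro mult_left_mono nn_integral_mono kcap) simp
  also have "(\<integral>\<^sup>+x. ennreal (K / lam ^ (?n - 1)) * (?h (sgn x) * indicator {x. 1 - 2 * \<delta> < norm x \<and> norm x \<le> 1 + \<delta>} x) \<partial>lborel)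
     = ennreal (K / lam ^ (?n - 1)) * shell_integral ?h (1 - 2 * \<delta>) (1 + \<delta>)"
    unfolding shell_integral_def using shell_integrand_measurable[OF h, of "1 - 2 * \<delta>"] \<delta>
    by (intro nn_integral_cmult) simp
  finally have 1: "ennreal (c * \<delta> ^ ?n) * (\<integral>\<^sup>+z. ?h z \<partial>M)
     \<le> ennreal (exp p) * (ennreal (K / lam ^ (?n - 1)) * shell_integral ?h (1 - 2 * \<delta>) (1 + \<delta>))" .
  obtain i where i: "0 \<le> i" "?I = ennreal i" using fin by (metis ennreal_cases infinity_ennreal_def less_irrefl)
  have "of_nat ?n * shell_integral ?h (1 - 2 * \<delta>) (1 + \<delta>) = ennreal ((1 + \<delta>) ^ ?n - (1 - 2 * \<delta>) ^ ?n) * ?I"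
    using \<delta> by (intro shell_integral_eq[OF h fin]) auto
  also have "\<dots> \<le> ennreal (2 ^ ?n * real ?n * (3 * \<delta>)) * ?I"
    using power_diff_bound[of "1 - 2 * \<delta>" "1 + \<delta>" ?n] \<delta> by (intro mult_right_mono ennreal_leI) auto
  also have "\<dots> = of_nat ?n * ennreal (2 ^ ?n * (3 * \<delta>) * i)"
    using \<delta> i by (simp add: ennreal_mult[symmetric] ennreal_of_nat_eq_real_of_nat mult_ac)
  finally have sh: "shell_integral ?h (1 - 2 * \<delta>) (1 + \<delta>) \<le> ennreal (2 ^ ?n * (3 * \<delta>) * i)"
    by (subst (asm) ennreal_mult_le_mult_iff) (auto simp: of_nat_less_top less_top[symmetric])
  have "ennreal (c * \<delta> ^ ?n) * (\<integral>\<^sup>+z. ?h z \<partial>M)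
     \<le> ennreal (exp p) * (ennreal (K / lam ^ (?n - 1)) * ennreal (2 ^ ?n * (3 * \<delta>) * i))"
    by (rule order_trans[OF 1]) (intro mult_left_mono sh; simp)
  also have "\<dots> = ennreal (exp p * (K / lam ^ (?n - 1) * (2 ^ ?n * (3 * \<delta>) * i)))"
    using \<delta> i K lam by (simp add: ennreal_mult[symmetric])
  also have "exp p * (K / lam ^ (?n - 1) * (2 ^ ?n * (3 * \<delta>) * i))
     = c * \<delta> ^ ?n * (3 * 2 ^ ?n * exp p * K / (c * \<epsilon> ^ (?n - 1)) * i)"
  proof -
    obtain N where N: "?n = Suc N" using DIM_positive[where 'a='a] by (cases ?n) auto
    have "lam \<noteq> 0" "\<epsilon> \<noteq> 0" using lam \<epsilon> by auto
    then show ?thesis using c unfolding N \<delta>_def by (simp add: field_simps power_divide)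
  qed
  also have "ennreal \<dots> = ennreal (c * \<delta> ^ ?n) * ennreal (3 * 2 ^ ?n * exp p * K / (c * \<epsilon> ^ (?n - 1)) * i)"
    using c \<delta> i K \<epsilon> by (intro ennreal_mult) auto
  finally have "(\<integral>\<^sup>+z. ?h z \<partial>M) \<le> ennreal (3 * 2 ^ ?n * exp p * K / (c * \<epsilon> ^ (?n - 1)) * i)"
    using c \<delta> by (subst (asm) ennreal_mult_le_mult_iff) (auto simp: less_top[symmetric])
  also have "\<dots> = ennreal (3 * 2 ^ ?n * exp p * K / (c * \<epsilon> ^ (?n - 1))) * ennreal i"
    using c i K \<epsilon> by (intro ennreal_mult) auto
  finally show ?thesis by (simp add: c_def i(2))
qed

section \<open>Gegenbauer polynomials\<close>

text \<open>
  The coefficients of the power series in \<open>1 - t\<close> of the solution of the Gegenbauer equation that is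
  regular at \<open>t = 1\<close> and equal to \<open>1\<close> there.
\<close>

definition gegenbauer_coeff :: "real \<Rightarrow> real \<Rightarrow> nat \<Rightarrow> real" where
  "gegenbauer_coeff m L j = (\<Prod>i<j. (real i * (real i + m - 1) - L) / ((real i + 1) * (2 * real i + m)))"

text \<open>
  The equation for \<open>q (x \<bullet> z)\<close> to be an eigenfunction with eigenvalue \<open>L\<close> on a sphere of dimension \<open>m\<close>.
\<close>

definition gegenbauer :: "real \<Rightarrow> real \<Rightarrow> real poly \<Rightarrow> bool" where
  "gegenbauer m L q \<longleftrightarrow> (\<forall>t. (1 - t\<^sup>2) * poly (pderiv (pderiv q)) t - m * t * poly (pderiv q) t + L * poly q t = 0)"

text \<open>
  The recursion for the coefficients terminates at the index \<open>k\<close>, because \<open>L\<close> is the \<open>k\<close>-th eigenvalue.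
\<close>

lemma gegenbauer_series_exists:
  assumes m: "0 < m" and L: "L = real k * (real k + m - 1)"
  shows "\<exists>q. gegenbauer m L q \<and> poly q 1 = 1"
proof -
  define c where "c = gegenbauer_coeff m L"
  have c0: "c 0 = 1" by (simp add: c_def gegenbauer_coeff_def)
  have rec: "(real j + 1) * (2 * real j + m) * c (Suc j) = (real j * (real j + m - 1) - L) * c j" for j
  proof -
    have "(real j + 1) * (2 * real j + m) \<noteq> 0" using m by (simp add: add_nonneg_pos less_imp_neq[symmetric])
    then show ?thesis by (simp add: c_def gegenbauer_coeff_def)
  qed
  have cz: "c j = 0" if "k < j" for j
    unfolding c_def gegenbauer_coeff_def
    by (rule prod_zero) (use that L in \<open>auto intro!: bexI[of _ k]\<close>)
  define P where "P = (\<Sum>j\<le>k. monom (c j) j)"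
  have coeffP: "coeff P j = c j" for j
  proof -
    have "coeff P j = (\<Sum>i\<le>k. if i = j then c i else 0)" by (simp add: P_def coeff_sum)
    also have "\<dots> = (if j \<le> k then c j else 0)" by (simp add: sum.delta)
    finally show ?thesis using cz[of j] by auto
  qed
  have eq: "pCons 0 (smult 2 (pderiv (pderiv P))) - pCons 0 (pCons 0 (pderiv (pderiv P)))
       + smult m (pderiv P) - pCons 0 (smult m (pderiv P)) + smult L P = 0" (is "?Q = 0")
  proof (rule poly_eqI)
    fix j
    show "coeff ?Q j = coeff 0 j"
    proof (cases j)
      case 0
      then show ?thesis using rec[of 0] by (simp add: coeff_pderiv coeffP)
    next
      case (Suc i)
      have "coeff (pCons 0 (pCons 0 (pderiv (pderiv P)))) (Suc i) = real i * (real i + 1) * c (Suc i)"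
        by (cases i) (auto simp: coeff_pderiv coeffP)
      then show ?thesis using rec[of "Suc i"] Suc
        by (simp add: coeff_pderiv coeffP algebra_simps)
    qed
  qed
  define q where "q = pcompose P [:1, -1:]"
  have pd: "pderiv [:1, -1::real:] = [:-1:]" by (simp add: pderiv_pCons)
  have q1: "pderiv q = - pcompose (pderiv P) [:1, -1:]"
    by (simp add: q_def pderiv_pcompose pd)
  have q2: "pderiv (pderiv q) = pcompose (pderiv (pderiv P)) [:1, -1:]"
    by (simp add: q1 pderiv_minus pderiv_pcompose pd)
  have "gegenbauer m L q"
    unfolding gegenbauer_def
  proof
    fix t
    have "poly ?Q (1 - t) = 0" by (simp only: eq poly_0)
    then show "(1 - t\<^sup>2) * poly (pderiv (pderiv q)) t - m * t * poly (pderiv q) t + L * poly q t = 0"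
      unfolding q2 unfolding q1 by (simp add: q_def poly_pcompose power2_eq_square algebra_simps)
  qed
  moreover have "poly q 1 = 1"
    by (simp add: q_def poly_pcompose poly_0_coeff_0 coeffP c0)
  ultimately show ?thesis by blast
qed

text \<open>
  The even and the odd part of a solution \<open>q\<close> are solutions, and they do not both vanish at \<open>1\<close>.  The
  symmetry of the resulting polynomial makes the two poles of the sphere equivalent.
\<close>

lemma gegenbauer_symmetric_exists:
  assumes m: "0 < m" and L: "L = real k * (real k + m - 1)"
  obtains q where "gegenbauer m L q" "poly q 1 = 1" "\<And>t. \<bar>poly q (- t)\<bar> = \<bar>poly q t\<bar>"
proof -
  obtain q where q: "gegenbauer m L q" "poly q 1 = 1"
    using gegenbauer_series_exists[OF assms] by blast
  define r where "r = pcompose q [:0, -1:]"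
  have r: "poly r t = poly q (- t)" for t by (simp add: r_def poly_pcompose)
  have pd: "pderiv [:0, -1::real:] = [:-1:]" by (simp add: pderiv_pCons)
  have r1: "pderiv r = - pcompose (pderiv q) [:0, -1:]"
    by (simp add: r_def pderiv_pcompose pd)
  have r2: "pderiv (pderiv r) = pcompose (pderiv (pderiv q)) [:0, -1:]"
    by (simp add: r1 pderiv_minus pderiv_pcompose pd)
  \<comment> \<open>The sign selects the even or the odd part, whichever does not vanish at \<open>1\<close>.\<close>
  obtain s :: real where s: "s = 1 \<or> s = -1" "poly q 1 + s * poly q (- 1) \<noteq> 0"
  proof (cases "poly q 1 + poly q (- 1) = 0")
    case True then show ?thesis using that[of "-1"] q(2) by simp
  next
    case False then show ?thesis using that[of 1] by simp
  qed
  define N where "N = poly q 1 + s * poly q (- 1)"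
  define p where "p = smult (1 / N) (q + smult s r)"
  have pp: "poly p t = (poly q t + s * poly q (- t)) / N" for t by (simp add: p_def r)
  have p1: "poly (pderiv p) t = (poly (pderiv q) t - s * poly (pderiv q) (- t)) / N" for t
    by (simp add: p_def pderiv_smult pderiv_add r1 poly_pcompose)
  have p2: "poly (pderiv (pderiv p)) t = (poly (pderiv (pderiv q)) t + s * poly (pderiv (pderiv q)) (- t)) / N" for t
    by (simp add: p_def pderiv_smult pderiv_add r2 poly_pcompose)
  show ?thesis
  proof (rule that[of p])
    show "gegenbauer m L p"
      unfolding gegenbauer_def
    proof
      fix t
      have 1: "(1 - t\<^sup>2) * poly (pderiv (pderiv q)) t - m * t * poly (pderiv q) t + L * poly q t = 0"
        and 2: "(1 - t\<^sup>2) * poly (pderiv (pderiv q)) (-t) + m * t * poly (pderiv q) (-t) + L * poly q (-t) = 0"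
        using q(1)[unfolded gegenbauer_def, rule_format, of t]
          q(1)[unfolded gegenbauer_def, rule_format, of "-t"] by simp_all
      have "(1 - t\<^sup>2) * poly (pderiv (pderiv p)) t - m * t * poly (pderiv p) t + L * poly p t
        = (1 / N) * (((1 - t\<^sup>2) * poly (pderiv (pderiv q)) t - m * t * poly (pderiv q) t + L * poly q t)
           + s * ((1 - t\<^sup>2) * poly (pderiv (pderiv q)) (-t) + m * t * poly (pderiv q) (-t) + L * poly q (-t)))"
        unfolding p2 p1 pp by (simp add: algebra_simps add_divide_distrib diff_divide_distrib)
      then show "(1 - t\<^sup>2) * poly (pderiv (pderiv p)) t - m * t * poly (pderiv p) t + L * poly p t = 0"
        by (simp only: 1 2) simp
    qed
    show "poly p 1 = 1" using s(2) by (simp add: pp N_def)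
    fix t
    have "poly p (- t) = s * poly p t" using s(1) by (auto simp: pp add_divide_distrib diff_divide_distrib)
    then show "\<bar>poly p (- t)\<bar> = \<bar>poly p t\<bar>" using s(1) by auto
  qed
qed

text \<open>
  The left-hand side is nondecreasing on \<open>{0..1}\<close>, as the equation reduces its derivative to
  \<open>2 (m - 1) t (q')\<^sup>2\<close>, and it equals \<open>L\<close> at \<open>t = 1\<close>.
\<close>

lemma gegenbauer_energy:
  assumes m: "1 \<le> m" and L: "0 < L" and q: "gegenbauer m L q" "poly q 1 = 1" and t: "0 \<le> t" "t \<le> 1"
  shows "L * (poly q t)\<^sup>2 + (1 - t\<^sup>2) * (poly (pderiv q) t)\<^sup>2 \<le> L"
proof -
  define E where "E t = L * (poly q t)\<^sup>2 + (1 - t\<^sup>2) * (poly (pderiv q) t)\<^sup>2" for t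
  have "E t \<le> E 1"
  proof (rule DERIV_nonneg_imp_nondecreasing[OF t(2)])
    fix x assume x: "t \<le> x" "x \<le> 1"
    let ?p = "poly q x" and ?p1 = "poly (pderiv q) x" and ?p2 = "poly (pderiv (pderiv q)) x"
    have "(E has_real_derivative L * (2 * ?p * ?p1) + ((- 2 * x) * ?p1\<^sup>2 + (1 - x\<^sup>2) * (2 * ?p1 * ?p2))) (at x)"
      unfolding E_def by (auto intro!: derivative_eq_intros)
    moreover have "L * (2 * ?p * ?p1) + ((- 2 * x) * ?p1\<^sup>2 + (1 - x\<^sup>2) * (2 * ?p1 * ?p2)) =
       2 * ?p1 * ((1 - x\<^sup>2) * ?p2 - m * x * ?p1 + L * ?p) + 2 * (m - 1) * x * ?p1\<^sup>2"
      by (simp add: power2_eq_square algebra_simps)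
    moreover have "(1 - x\<^sup>2) * ?p2 - m * x * ?p1 + L * ?p = 0"
      using q(1) by (simp add: gegenbauer_def)
    moreover have "0 \<le> 2 * (m - 1) * x * ?p1\<^sup>2" using m x t by simp
    ultimately show "\<exists>y. (E has_real_derivative y) (at x) \<and> 0 \<le> y" by auto
  qed
  then show ?thesis by (simp add: E_def q(2))
qed

lemma gegenbauer_le_1:
  assumes "1 \<le> m" "0 < L" "gegenbauer m L q" "poly q 1 = 1" "0 \<le> t" "t \<le> 1"
  shows "\<bar>poly q t\<bar> \<le> 1"
proof -
  have "0 \<le> (1 - t\<^sup>2) * (poly (pderiv q) t)\<^sup>2"
    using assms by (intro mult_nonneg_nonneg) (auto simp: power_le_one)
  then have "L * (poly q t)\<^sup>2 \<le> L * 1" using gegenbauer_energy[OF assms] by linarith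
  then have "(poly q t)\<^sup>2 \<le> 1" using assms(2) by (simp only: mult_le_cancel_left_pos)
  then show ?thesis by (simp add: abs_square_le_1)
qed

lemma gegenbauer_angular_derivative:
  assumes "1 \<le> m" "0 < L" "gegenbauer m L q" "poly q 1 = 1" "0 \<le> \<theta>" "\<theta> \<le> pi / 2"
  shows "\<bar>sin \<theta> * poly (pderiv q) (cos \<theta>)\<bar> \<le> sqrt L"
proof -
  have c: "0 \<le> cos \<theta>" "cos \<theta> \<le> 1" using assms(5,6) by (auto intro!: cos_ge_zero)
  have "0 \<le> L * (poly q (cos \<theta>))\<^sup>2" using assms(2) by simp
  then have "(sin \<theta> * poly (pderiv q) (cos \<theta>))\<^sup>2 \<le> L"
    using gegenbauer_energy[OF assms(1-4) c] unfolding power_mult_distrib sin_squared_eq by linarith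
  then show ?thesis using real_sqrt_le_mono real_sqrt_abs by metis
qed

lemma gegenbauer_near_pole:
  assumes q: "1 \<le> m" "0 < L" "gegenbauer m L q" "poly q 1 = 1" and \<theta>: "0 \<le> \<theta>" "\<theta> \<le> pi / 2"
  shows "1 - sqrt L * \<theta> \<le> poly q (cos \<theta>)"
proof (cases "\<theta> = 0")
  case False
  have d: "((\<lambda>x. poly q (cos x)) has_real_derivative - (sin x * poly (pderiv q) (cos x))) (at x)" for x
    by (auto intro!: derivative_eq_intros)
  obtain x where x: "0 < x" "x < \<theta>"
    and e: "poly q (cos \<theta>) - poly q (cos 0) = (\<theta> - 0) * - (sin x * poly (pderiv q) (cos x))"
    using MVT2[of 0 \<theta> "\<lambda>x. poly q (cos x)" "\<lambda>x. - (sin x * poly (pderiv q) (cos x))"] d False \<theta>(1) by auto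
  have "sin x * poly (pderiv q) (cos x) \<le> sqrt L"
    using gegenbauer_angular_derivative[OF q, of x] x \<theta> by linarith
  then have "\<theta> * (sin x * poly (pderiv q) (cos x)) \<le> \<theta> * sqrt L" using \<theta> by (intro mult_left_mono)
  then show ?thesis using e q(4) by (simp add: mult.commute)
qed (use q in simp)

text \<open>
  In the angle \<open>\<theta>\<close>, put \<open>g \<theta> = q (cos \<theta>)\<close> and \<open>a = M / 2\<close>.  Liouville's substitution \<open>v = (sin \<theta>)\<^sup>a g\<close>
  removes the first-order term: \<open>v'' + Q v = 0\<close> with \<open>Q = L + a\<^sup>2 - a (a - 1) / (sin \<theta>)\<^sup>2\<close>.  The energy
  \<open>W = (v')\<^sup>2 + Q v\<^sup>2\<close> satisfies \<open>W' = Q' v\<^sup>2\<close>.  Where \<open>lam sin \<theta> \<ge> 2 a\<close>, one has \<open>Q \<ge> 3 L / 4\<close>, and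
  \<open>Q'\<close> is so small that \<open>W\<close> times the bounded factor \<open>exp (2 a\<^sup>2 / (L (sin \<theta>)\<^sup>2))\<close> is nonincreasing.
  At the starting angle, where \<open>lam sin \<theta> = 2 a\<close>, the energy is controlled by \<open>gegenbauer_energy\<close>,
  and for smaller angles \<open>\<bar>g\<bar> \<le> 1\<close> is enough.
  Writing \<open>W\<close> as \<open>(sin \<theta>)\<^sup>M\<close> times a function \<open>B\<close> avoids the half-integral power.
\<close>

lemma gegenbauer_decay:
  assumes M: "1 \<le> M" and lam: "0 < lam" and q: "gegenbauer (real M + 1) (lam\<^sup>2) q" "poly q 1 = 1"
    and \<theta>: "0 \<le> \<theta>" "\<theta> \<le> pi / 2"
  shows "(lam * sin \<theta>) ^ M * (poly q (cos \<theta>))\<^sup>2 \<le> 16 * real M ^ M"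
proof (cases "real M \<le> lam * sin \<theta>")
  case False
  have s: "0 \<le> sin \<theta>" using \<theta> by (intro sin_ge_zero) auto
  have "\<bar>poly q (cos \<theta>)\<bar> \<le> 1"
    using M lam q \<theta> by (intro gegenbauer_le_1[of "real M + 1" "lam\<^sup>2"] cos_ge_zero) auto
  then have "(poly q (cos \<theta>))\<^sup>2 \<le> 1" by (simp add: abs_square_le_1)
  moreover have "(lam * sin \<theta>) ^ M \<le> real M ^ M" using False s lam by (intro power_mono) auto
  ultimately have "(lam * sin \<theta>) ^ M * (poly q (cos \<theta>))\<^sup>2 \<le> real M ^ M * 1"
    by (intro mult_mono) auto
  then show ?thesis by (simp add: order_trans[of _ "real M ^ M"])
next
  case True
  define a where "a = real M / 2"
  define L where "L = lam\<^sup>2"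
  have a: "1 / 2 \<le> a" using M by (simp add: a_def)
  have L: "0 < L" using lam by (simp add: L_def)
  have sqL: "sqrt L = lam" using lam by (simp add: L_def)
  obtain N where N: "M = Suc N" using M by (cases M) auto
  define s0 where "s0 = real M / lam"
  have "real M \<le> lam" using True mult_left_mono[OF sin_le_one, of lam \<theta>] lam by linarith
  then have s0: "0 < s0" "s0 \<le> 1" using M lam by (auto simp: s0_def)
  define \<theta>0 where "\<theta>0 = arcsin s0"
  have sin0: "sin \<theta>0 = s0" using s0 by (simp add: \<theta>0_def)
  have t0: "0 \<le> \<theta>0" "\<theta>0 \<le> pi / 2" using s0 arcsin_le_arcsin[of 0 s0] arcsin_ubound[of s0]
    by (auto simp: \<theta>0_def)
  have t0': "0 < \<theta>0" using t0(1) sin0 s0(1) by (cases "\<theta>0 = 0") auto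
  have "s0 \<le> sin \<theta>" using True lam by (simp add: s0_def field_simps)
  then have t0le: "\<theta>0 \<le> \<theta>"
    using sin_mono_le_eq[of \<theta>0 \<theta>] t0 \<theta> sin0 by auto
  define g where "g x = poly q (cos x)" for x
  define h where "h x = - (sin x * poly (pderiv q) (cos x))" for x
  define k where "k x = - (2 * a * (cos x / sin x) * h x) - L * g x" for x
  define B where "B x = (h x)\<^sup>2 + 2 * a * (cos x / sin x) * (g x * h x) + (L + a / (sin x)\<^sup>2) * (g x)\<^sup>2" for x
  define W where "W x = sin x ^ M * B x" for x
  define X where "X x = exp (2 * a\<^sup>2 / (L * (sin x)\<^sup>2))" for x
  have range: "0 < sin x \<and> 0 \<le> cos x \<and> s0 \<le> sin x" if "\<theta>0 \<le> x" "x \<le> pi / 2" for x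
  proof -
    have "sin \<theta>0 \<le> sin x" using that t0 by (intro sin_monotone_2pi_le) auto
    then show ?thesis using that t0 s0 sin0 by (auto intro!: cos_ge_zero)
  qed
  have dg: "(g has_real_derivative h x) (at x)" for x
    unfolding g_def[abs_def] h_def by (auto intro!: derivative_eq_intros)
  have dh: "(h has_real_derivative k x) (at x)" if "sin x \<noteq> 0" for x
  proof -
    have "(h has_real_derivative - (cos x * poly (pderiv q) (cos x)
           + sin x * (poly (pderiv (pderiv q)) (cos x) * - sin x))) (at x)"
      unfolding h_def[abs_def] by (auto intro!: derivative_eq_intros)
    moreover have "(sin x)\<^sup>2 * poly (pderiv (pderiv q)) (cos x)
        = (2 * a + 1) * cos x * poly (pderiv q) (cos x) - L * poly q (cos x)"
      using q(1)[unfolded gegenbauer_def, rule_format, of "cos x"]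
      unfolding sin_squared_eq a_def L_def by (simp add: algebra_simps)
    moreover from this have "- (cos x * poly (pderiv q) (cos x)
           + sin x * (poly (pderiv (pderiv q)) (cos x) * - sin x)) = k x"
      using that by (simp add: k_def h_def g_def power2_eq_square algebra_simps)
    ultimately show ?thesis by (simp only:)
  qed
  \<comment> \<open>The identity \<open>W' = Q' v\<^sup>2\<close>; the terms with \<open>h\<^sup>2\<close> and \<open>g h\<close> cancel.\<close>
  have dW: "(W has_real_derivative 2 * a * (a - 1) * cos x / (sin x) ^ 3 * (sin x ^ M * (g x)\<^sup>2)) (at x)"
    if s: "sin x \<noteq> 0" for x
  proof -
    have dcot: "((\<lambda>x. cos x / sin x) has_real_derivative - 1 / (sin x)\<^sup>2) (at x)"
    proof -
      have "((\<lambda>x. cos x / sin x) has_real_derivative (- sin x * sin x - cos x * cos x) / (sin x * sin x)) (at x)"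
        using s by (auto intro!: derivative_eq_intros)
      moreover have "- sin x * sin x - cos x * cos x = -1"
        using sin_cos_squared_add[of x] by (simp add: power2_eq_square)
      ultimately show ?thesis by (simp add: power2_eq_square)
    qed
    have dis: "((\<lambda>x. a / (sin x)\<^sup>2) has_real_derivative - (2 * a * cos x / (sin x) ^ 3)) (at x)"
      using s by (auto intro!: derivative_eq_intros simp: power2_eq_square power3_eq_cube mult_ac)
    define ct where "ct x = cos x / sin x" for x :: real
    define iq where "iq x = a / (sin x)\<^sup>2" for x
    have B: "B = (\<lambda>x. (h x)\<^sup>2 + 2 * a * ct x * (g x * h x) + (L + iq x) * (g x)\<^sup>2)"
      by (simp add: B_def ct_def iq_def fun_eq_iff)
    have dB: "(B has_real_derivative
        2 * h x * k x
        + 2 * a * ((- 1 / (sin x)\<^sup>2) * (g x * h x) + (cos x / sin x) * (h x * h x + g x * k x))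
        + (- (2 * a * cos x / (sin x) ^ 3) * (g x)\<^sup>2 + (L + a / (sin x)\<^sup>2) * (2 * g x * h x))) (at x)"
      (is "(B has_real_derivative ?B') _")
      unfolding B
      by (rule dcot[folded ct_def] dis[folded iq_def] dg dh[OF s] derivative_eq_intros refl)+
         (simp add: ct_def iq_def algebra_simps add_divide_distrib)
    have dp: "((\<lambda>x. sin x ^ M) has_real_derivative 2 * a * sin x ^ N * cos x) (at x)"
      by (rule DERIV_cong[OF DERIV_power[OF DERIV_sin]]) (simp add: N a_def)
    have "(W has_real_derivative 2 * a * sin x ^ N * cos x * B x + sin x ^ M * ?B') (at x)"
      unfolding W_def[abs_def] by (rule derivative_eq_intros dp dB refl)+ simp
    moreover have "2 * a * sin x ^ N * cos x * B x + sin x ^ M * ?B'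
        = sin x ^ N * (2 * a * cos x * B x + sin x * ?B')"
      by (simp add: N algebra_simps)
    moreover have "2 * a * cos x * B x + sin x * ?B' = 2 * a * (a - 1) * cos x / (sin x)\<^sup>2 * (g x)\<^sup>2"
      unfolding B_def k_def using s by (simp add: field_simps power2_eq_square power3_eq_cube)
    moreover have "sin x ^ N * (2 * a * (a - 1) * cos x / (sin x)\<^sup>2 * (g x)\<^sup>2)
       = 2 * a * (a - 1) * cos x / (sin x) ^ 3 * (sin x ^ M * (g x)\<^sup>2)"
      using s by (simp add: N power2_eq_square power3_eq_cube)
    ultimately show ?thesis by simp
  qed
  \<comment> \<open>Completing the square: \<open>W\<close> dominates \<open>Q v\<^sup>2\<close>.\<close>
  have Wlow: "3 / 4 * L * (sin x ^ M * (g x)\<^sup>2) \<le> W x" if s: "0 < sin x" "s0 \<le> sin x" for x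
  proof -
    have "B x = (h x + a * (cos x / sin x) * g x)\<^sup>2 + (L + (a - a\<^sup>2 * (cos x)\<^sup>2) / (sin x)\<^sup>2) * (g x)\<^sup>2"
      unfolding B_def using s by (simp add: field_simps power2_eq_square)
    moreover have "3 / 4 * L \<le> L + (a - a\<^sup>2 * (cos x)\<^sup>2) / (sin x)\<^sup>2"
    proof -
      have "a\<^sup>2 * (cos x)\<^sup>2 \<le> a\<^sup>2 * 1" by (intro mult_left_mono) (auto simp: abs_square_le_1)
      then have "- (a\<^sup>2) \<le> a - a\<^sup>2 * (cos x)\<^sup>2" using a by linarith
      then have "- (a\<^sup>2) / (sin x)\<^sup>2 \<le> (a - a\<^sup>2 * (cos x)\<^sup>2) / (sin x)\<^sup>2"
        by (rule divide_right_mono) simp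
      moreover have "a\<^sup>2 / (sin x)\<^sup>2 \<le> a\<^sup>2 / s0\<^sup>2"
        using s s0 by (intro divide_left_mono power_mono) auto
      moreover have "a\<^sup>2 / s0\<^sup>2 = L / 4"
        using M lam by (simp add: a_def s0_def L_def power_divide)
      ultimately show ?thesis unfolding minus_divide_left[symmetric] by linarith
    qed
    then have "3 / 4 * L * (g x)\<^sup>2 \<le> (L + (a - a\<^sup>2 * (cos x)\<^sup>2) / (sin x)\<^sup>2) * (g x)\<^sup>2"
      by (rule mult_right_mono) simp
    ultimately have "3 / 4 * L * (g x)\<^sup>2 \<le> B x" by (simp add: add_increasing)
    then have "sin x ^ M * (3 / 4 * L * (g x)\<^sup>2) \<le> W x"
      unfolding W_def using s by (intro mult_left_mono) auto
    then show ?thesis by (simp add: algebra_simps)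
  qed
  have "W \<theta> * X \<theta> \<le> W \<theta>0 * X \<theta>0"
  proof (rule DERIV_nonpos_imp_nonincreasing[OF t0le])
    fix x assume x: "\<theta>0 \<le> x" "x \<le> \<theta>"
    then have s: "0 < sin x" "0 \<le> cos x" "s0 \<le> sin x" using range[of x] \<theta> by auto
    have "(X has_real_derivative X x * - (4 * a\<^sup>2 * cos x / (L * (sin x) ^ 3))) (at x)"
      unfolding X_def[abs_def] using s L
      by (auto intro!: derivative_eq_intros simp: power2_eq_square power3_eq_cube field_simps)
    from DERIV_mult[OF dW this] s
    have "((\<lambda>x. W x * X x) has_real_derivative
       X x * (2 * a * (a - 1) * cos x / (sin x) ^ 3 * (sin x ^ M * (g x)\<^sup>2)
         - 4 * a\<^sup>2 * cos x / (L * (sin x) ^ 3) * W x)) (at x)"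
      by (simp add: algebra_simps)
    moreover have "2 * a * (a - 1) * cos x / (sin x) ^ 3 * (sin x ^ M * (g x)\<^sup>2)
         \<le> 4 * a\<^sup>2 * cos x / (L * (sin x) ^ 3) * W x"
    proof -
      have v: "0 \<le> sin x ^ M * (g x)\<^sup>2" using s by simp
      have "2 * a * (a - 1) * cos x / (sin x) ^ 3 * (sin x ^ M * (g x)\<^sup>2)
        \<le> 3 * a\<^sup>2 * cos x / (sin x) ^ 3 * (sin x ^ M * (g x)\<^sup>2)"
        using s a v by (intro mult_right_mono divide_right_mono) (auto simp: power2_eq_square algebra_simps)
      also have "\<dots> = 4 * a\<^sup>2 * cos x / (L * (sin x) ^ 3) * (3 / 4 * L * (sin x ^ M * (g x)\<^sup>2))"
        using L by simp
      also have "\<dots> \<le> 4 * a\<^sup>2 * cos x / (L * (sin x) ^ 3) * W x"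
        using s L by (intro mult_left_mono Wlow) auto
      finally show ?thesis .
    qed
    moreover have "0 < X x" by (simp add: X_def)
    ultimately show "\<exists>y. ((\<lambda>x. W x * X x) has_real_derivative y) (at x) \<and> y \<le> 0"
      by (meson mult_le_0_iff diff_le_0_iff_le less_imp_le)
  qed
  moreover have "W \<theta> \<le> W \<theta> * X \<theta>"
  proof -
    have "0 < sin \<theta>" "s0 \<le> sin \<theta>" using range[of \<theta>] t0le \<theta> by auto
    then have "0 \<le> W \<theta>" using Wlow[of \<theta>] L by (smt (verit) mult_nonneg_nonneg zero_le_power zero_le_power2 divide_nonneg_nonneg)
    moreover have "1 \<le> X \<theta>" using L by (simp add: X_def)
    ultimately show ?thesis by (simp add: mult_left_le mult_le_cancel_left1)
  qed
  moreover have "X \<theta>0 \<le> 2"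
  proof -
    have "2 * a\<^sup>2 / (L * (sin \<theta>0)\<^sup>2) = 1 / 2"
      using M lam by (simp add: sin0 s0_def a_def L_def power_divide)
    then show ?thesis using exp_half_le2 by (simp add: X_def)
  qed
  moreover have "0 \<le> W \<theta>0 \<and> W \<theta>0 \<le> 4 * L * s0 ^ M"
  proof -
    have h0: "\<bar>h \<theta>0\<bar> \<le> lam"
      using gegenbauer_angular_derivative[OF _ _ q t0] M lam by (simp add: h_def)
    have g0: "\<bar>g \<theta>0\<bar> \<le> 1"
      unfolding g_def using M lam q t0 by (intro gegenbauer_le_1[of "real M + 1" "lam\<^sup>2"] cos_ge_zero) auto
    have c0: "0 \<le> cos \<theta>0" "cos \<theta>0 \<le> 1" using t0 by (auto intro!: cos_ge_zero)
    have h2: "(h \<theta>0)\<^sup>2 \<le> L" using h0 lam by (simp add: L_def abs_le_square_iff[symmetric])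
    have g2: "(g \<theta>0)\<^sup>2 \<le> 1" using g0 by (simp add: abs_square_le_1)
    have gh: "g \<theta>0 * h \<theta>0 \<le> 1 * lam"
      using mult_mono[OF g0 h0] by (simp add: abs_mult[symmetric])
    have "2 * a * (cos \<theta>0 / sin \<theta>0) * (g \<theta>0 * h \<theta>0) \<le> 2 * a * (cos \<theta>0 / sin \<theta>0) * (1 * lam)"
      using a c0 s0 sin0 gh by (intro mult_left_mono) auto
    also have "\<dots> \<le> 2 * a * (1 / sin \<theta>0) * (1 * lam)"
      using a c0 s0 sin0 lam by (intro mult_right_mono mult_left_mono divide_right_mono) auto
    also have "\<dots> = L" using M lam by (simp add: sin0 s0_def a_def L_def power2_eq_square)
    finally have b2: "2 * a * (cos \<theta>0 / sin \<theta>0) * (g \<theta>0 * h \<theta>0) \<le> L" .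
    have "a / (sin \<theta>0)\<^sup>2 = L / (4 * a)"
      using M lam by (simp add: sin0 s0_def a_def L_def power_divide power2_eq_square)
    also have "\<dots> \<le> L / 1" using a L by (intro divide_left_mono) auto
    finally have "(L + a / (sin \<theta>0)\<^sup>2) * (g \<theta>0)\<^sup>2 \<le> (2 * L) * 1"
      using g2 L a by (intro mult_mono) auto
    then have "B \<theta>0 \<le> 4 * L" unfolding B_def using h2 b2 by linarith
    then have "W \<theta>0 \<le> s0 ^ M * (4 * L)" unfolding W_def sin0 using s0 by (intro mult_left_mono) auto
    moreover have "0 \<le> W \<theta>0" using Wlow[of \<theta>0] sin0 s0 L
      by (smt (verit) mult_nonneg_nonneg zero_le_power zero_le_power2 divide_nonneg_nonneg)
    ultimately show ?thesis by (simp add: mult_ac)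
  qed
  ultimately have "W \<theta> \<le> 4 * L * s0 ^ M * 2"
    using mult_mono[of "W \<theta>0" "4 * L * s0 ^ M" "X \<theta>0" 2] L s0 by (auto simp: X_def)
  moreover have "3 / 4 * L * (sin \<theta> ^ M * (g \<theta>)\<^sup>2) \<le> W \<theta>"
    using Wlow[of \<theta>] range[of \<theta>] t0le \<theta> by auto
  ultimately have "L * (3 / 4 * (sin \<theta> ^ M * (g \<theta>)\<^sup>2)) \<le> L * (8 * s0 ^ M)" by (simp add: mult_ac)
  then have "3 / 4 * (sin \<theta> ^ M * (g \<theta>)\<^sup>2) \<le> 8 * s0 ^ M" using L by (simp only: mult_le_cancel_left_pos)
  moreover have "0 \<le> s0 ^ M" using s0 by simp
  ultimately have "sin \<theta> ^ M * (g \<theta>)\<^sup>2 \<le> 16 * s0 ^ M" by linarith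
  then have "lam ^ M * (sin \<theta> ^ M * (g \<theta>)\<^sup>2) \<le> lam ^ M * (16 * s0 ^ M)" using lam by (intro mult_left_mono) auto
  also have "lam ^ M * (16 * s0 ^ M) = 16 * real M ^ M" using lam by (simp add: s0_def power_divide)
  finally show ?thesis by (simp add: power_mult_distrib g_def mult.assoc)
qed

section \<open>Integrals of zonal functions\<close>

definition polar_dist :: "'a::euclidean_space \<Rightarrow> 'a \<Rightarrow> real" where
  "polar_dist z x = min (norm (z - x)) (norm (z + x))"

text \<open>
  The chordal distance to a pole is at most \<open>2 sin \<theta>\<close> on the hemisphere about this pole, and the
  symmetry of \<open>q\<close> carries the bound from one hemisphere to the other.
\<close>

lemma gegenbauer_polar_decay:
  fixes x z :: "'a::euclidean_space"
  assumes M: "1 \<le> M" and lam: "0 < lam"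
    and q: "gegenbauer (real M + 1) (lam\<^sup>2) q" "poly q 1 = 1" "\<And>t. \<bar>poly q (- t)\<bar> = \<bar>poly q t\<bar>"
    and x: "norm x = 1" and z: "norm z = 1"
  shows "\<bar>poly q (x \<bullet> z)\<bar> \<le> 1"
    and "(lam * polar_dist z x) ^ M * (poly q (x \<bullet> z))\<^sup>2 \<le> 16 * (2 * real M) ^ M"
proof -
  have main: "\<bar>poly q (x \<bullet> w)\<bar> \<le> 1 \<and> (lam * norm (w - x)) ^ M * (poly q (x \<bullet> w))\<^sup>2 \<le> 16 * (2 * real M) ^ M"
    if w: "norm w = 1" and pos: "0 \<le> x \<bullet> w" for w :: 'a
  proof -
    define t where "t = x \<bullet> w"
    have t: "0 \<le> t" "t \<le> 1" using pos sphere_inner_bounds[OF x w] by (auto simp: t_def)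
    have L: "0 < lam\<^sup>2" using lam by simp
    have le1: "\<bar>poly q t\<bar> \<le> 1" using gegenbauer_le_1[OF _ L q(1,2) t] M by simp
    define \<theta> where "\<theta> = arccos t"
    have \<theta>: "0 \<le> \<theta>" "\<theta> \<le> pi / 2" "cos \<theta> = t"
      using t arccos_le_pi2[of t] by (auto simp: \<theta>_def arccos_lbound)
    have s: "sin \<theta> = sqrt (1 - t\<^sup>2)" using t by (simp add: \<theta>_def sin_arccos)
    have "x \<bullet> x = 1" "w \<bullet> w = 1" using x w by (simp_all add: dot_square_norm)
    then have "(norm (w - x))\<^sup>2 = 2 - 2 * t"
      unfolding power2_norm_eq_inner by (simp add: inner_diff_left inner_diff_right inner_commute t_def)
    also have "\<dots> \<le> 2 * ((1 - t) * (1 + t))"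
      using t by (simp add: algebra_simps mult_left_le)
    also have "\<dots> = 2 * (1 - t\<^sup>2)" by (simp add: algebra_simps power2_eq_square)
    also have "\<dots> \<le> 4 * (1 - t\<^sup>2)" using t by (simp add: power_le_one)
    also have "\<dots> = (2 * sin \<theta>)\<^sup>2" using t unfolding s by (simp add: power_mult_distrib power_le_one)
    finally have "norm (w - x) \<le> 2 * sin \<theta>"
      by (rule power2_le_imp_le) (use \<theta> in \<open>simp add: sin_ge_zero\<close>)
    then have "lam * norm (w - x) \<le> 2 * (lam * sin \<theta>)" using lam by simp
    then have "(lam * norm (w - x)) ^ M \<le> (2 * (lam * sin \<theta>)) ^ M" using lam by (intro power_mono) auto
    then have "(lam * norm (w - x)) ^ M * (poly q t)\<^sup>2 \<le> (2 * (lam * sin \<theta>)) ^ M * (poly q t)\<^sup>2"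
      by (rule mult_right_mono) simp
    also have "\<dots> = 2 ^ M * ((lam * sin \<theta>) ^ M * (poly q (cos \<theta>))\<^sup>2)"
      by (simp add: \<theta>(3) power_mult_distrib)
    also have "\<dots> \<le> 2 ^ M * (16 * real M ^ M)"
      by (intro mult_left_mono gegenbauer_decay[OF M lam q(1,2) \<theta>(1,2)]) simp
    also have "\<dots> = 16 * (2 * real M) ^ M" by (simp add: power_mult_distrib)
    finally show ?thesis using le1 by (simp add: t_def)
  qed
  have "\<bar>poly q (x \<bullet> z)\<bar> \<le> 1 \<and> (lam * polar_dist z x) ^ M * (poly q (x \<bullet> z))\<^sup>2 \<le> 16 * (2 * real M) ^ M"
  proof (cases "0 \<le> x \<bullet> z")
    case True
    have "(lam * polar_dist z x) ^ M \<le> (lam * norm (z - x)) ^ M"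
      using lam by (intro power_mono mult_left_mono) (auto simp: polar_dist_def)
    then have "(lam * polar_dist z x) ^ M * (poly q (x \<bullet> z))\<^sup>2 \<le> (lam * norm (z - x)) ^ M * (poly q (x \<bullet> z))\<^sup>2"
      by (rule mult_right_mono) simp
    then show ?thesis using main[OF z True] by linarith
  next
    case False
    have n: "norm (- z - x) = norm (z + x)" by (metis minus_add_distrib norm_minus_cancel uminus_add_conv_diff diff_conv_add_uminus)
    have "\<bar>poly q (x \<bullet> (- z))\<bar> = \<bar>poly q (x \<bullet> z)\<bar>" using q(3)[of "x \<bullet> z"] by simp
    then have sq: "(poly q (x \<bullet> (- z)))\<^sup>2 = (poly q (x \<bullet> z))\<^sup>2" by (metis power2_abs)
    have "(lam * polar_dist z x) ^ M \<le> (lam * norm (- z - x)) ^ M"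
      unfolding n using lam by (intro power_mono mult_left_mono) (auto simp: polar_dist_def)
    then have "(lam * polar_dist z x) ^ M * (poly q (x \<bullet> z))\<^sup>2 \<le> (lam * norm (- z - x)) ^ M * (poly q (x \<bullet> z))\<^sup>2"
      by (rule mult_right_mono) simp
    then show ?thesis using main[of "- z"] z False sq \<open>\<bar>poly q (x \<bullet> (- z))\<bar> = _\<close> by (simp add: sq)
  qed
  then show "\<bar>poly q (x \<bullet> z)\<bar> \<le> 1"
    "(lam * polar_dist z x) ^ M * (poly q (x \<bullet> z))\<^sup>2 \<le> 16 * (2 * real M) ^ M" by auto
qed

lemma powr_le_of_decay:
  fixes B d v q :: real
  assumes "0 < d" "d ^ M * v\<^sup>2 \<le> B" "0 \<le> q" "0 < B"
  shows "\<bar>v\<bar> powr q \<le> B powr (q / 2) * d powr (- (real M * q / 2))"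
proof -
  have "\<bar>v\<bar> powr q = (v\<^sup>2) powr (q / 2)"
  proof (cases "v = 0")
    case False
    then have "v\<^sup>2 = \<bar>v\<bar> powr 2" by simp
    then show ?thesis by (simp only: powr_powr) simp
  qed simp
  also have "\<dots> \<le> (B / d ^ M) powr (q / 2)"
    by (rule powr_mono2) (use assms in \<open>simp_all add: pos_le_divide_eq mult.commute\<close>)
  also have "\<dots> = B powr (q / 2) * d powr (- (real M * q / 2))"
  proof -
    have "(d ^ M) powr (q / 2) = d powr (real M * q / 2)"
      unfolding powr_realpow[OF assms(1), of M, symmetric] powr_powr by simp
    moreover have "(B / d ^ M) powr (q / 2) = B powr (q / 2) / (d ^ M) powr (q / 2)"
      by (rule powr_divide)
    ultimately show ?thesis by (simp add: powr_minus_divide)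
  qed
  finally show ?thesis .
qed

text \<open>
  The sphere is covered by the sets \<open>A j\<close> where the distance to the poles is less than \<open>2\<^sup>j / lam\<close>.  On the
  part of \<open>A j\<close> outside \<open>A (j - 1)\<close> the integrand is of order \<open>2 powr (- M q j / 2)\<close>, and \<open>A j\<close> has volume of
  order \<open>(2\<^sup>j / lam)\<close> to the power \<open>M + 1\<close>.  The hypothesis on \<open>q\<close> says that the resulting geometric series
  has ratio less than \<open>1\<close>.
\<close>

lemma zonal_powr_integral:
  fixes M :: nat and q :: real
  assumes M: "1 \<le> M" and dim: "DIM('a::euclidean_space) = M + 2" and q: "2 * (real M + 1) / real M < q"
  shows "\<exists>C>0. \<forall>lam\<ge>1. \<forall>P. \<forall>z::'a. gegenbauer (real M + 1) (lam\<^sup>2) P \<longrightarrow> poly P 1 = 1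
     \<longrightarrow> (\<forall>t. \<bar>poly P (- t)\<bar> = \<bar>poly P t\<bar>) \<longrightarrow> norm z = 1
     \<longrightarrow> (\<integral>\<^sup>+x. ennreal (\<bar>poly P (x \<bullet> z)\<bar> powr q) \<partial>sphere_volume) \<le> ennreal (C / lam ^ (M + 1))"
proof -
  have M0: "0 < real M" using M by simp
  have "0 < 2 * (real M + 1) / real M" using M0 by (intro divide_pos_pos) auto
  then have q0: "0 < q" using q by linarith
  obtain C1 where C1: "0 < C1" "\<And>z::'a. \<And>\<rho>. 0 < \<rho> \<Longrightarrow> emeasure sphere_volume (chordal_cap z \<rho>) \<le> ennreal (C1 * \<rho> ^ (M + 1))"
    using chordal_cap_volume_upper[where 'a='a] dim by auto
  define \<gamma> where "\<gamma> = real M * q / 2"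
  have \<gamma>: "real M + 1 < \<gamma>" using q M0 by (simp add: \<gamma>_def field_simps)
  define B where "B = 16 * (2 * real M) ^ M"
  have B: "0 < B" using M0 by (simp add: B_def)
  define B1 where "B1 = 1 + B powr (q / 2) * 2 powr \<gamma>"
  have B1: "1 \<le> B1" by (simp add: B1_def)
  define r where "r = 2 powr (- \<gamma>)"
  define s where "s = r * 2 ^ (M + 1)"
  have r0: "0 < r" by (simp add: r_def)
  have "s = 2 powr (real M + 1 - \<gamma>)"
    unfolding s_def r_def by (simp add: powr_realpow[symmetric] powr_add[symmetric] algebra_simps del: power_Suc)
  then have s: "0 < s" "s < 1" using \<gamma> powr_less_mono[of "real M + 1 - \<gamma>" 0 2] by (auto simp del: powr_less_cancel_iff)
  define C where "C = 2 * C1 * B1 * (1 / (1 - s))"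
  have C: "0 < C" using C1 B1 s by (simp add: C_def)
  have "(\<integral>\<^sup>+x. ennreal (\<bar>poly P (x \<bullet> z)\<bar> powr q) \<partial>sphere_volume) \<le> ennreal (C / lam ^ (M + 1))"
    if lam: "1 \<le> lam" and P: "gegenbauer (real M + 1) (lam\<^sup>2) P" "poly P 1 = 1" "\<And>t. \<bar>poly P (- t)\<bar> = \<bar>poly P t\<bar>"
      and z: "norm z = 1" for lam P and z :: 'a
  proof -
    define A where "A j = chordal_cap z (2 ^ j / lam) \<union> chordal_cap (- z) (2 ^ j / lam)" for j :: nat
    have Ameas: "A j \<in> sets sphere_volume" for j
      unfolding A_def using chordal_cap_measurable by (intro sets.Un) auto
    have Avol: "emeasure sphere_volume (A j) \<le> ennreal (2 * C1 * (2 ^ j / lam) ^ (M + 1))" for j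
    proof -
      have "emeasure sphere_volume (A j) \<le> emeasure sphere_volume (chordal_cap z (2 ^ j / lam)) + emeasure sphere_volume (chordal_cap (- z) (2 ^ j / lam))"
        unfolding A_def using chordal_cap_measurable by (intro emeasure_subadditive) auto
      also have "\<dots> \<le> ennreal (C1 * (2 ^ j / lam) ^ (M + 1)) + ennreal (C1 * (2 ^ j / lam) ^ (M + 1))"
        using lam by (intro add_mono C1(2)) auto
      also have "\<dots> = ennreal (2 * C1 * (2 ^ j / lam) ^ (M + 1))"
        using C1 lam by (subst ennreal_plus[symmetric]) auto
      finally show ?thesis .
    qed
    have Aiff: "x \<in> A j \<longleftrightarrow> lam * polar_dist z x < 2 ^ j" if "norm x = 1" for x j
    proof -
      have n: "norm (- z - x) = norm (z + x)" by (metis minus_add_distrib norm_minus_cancel uminus_add_conv_diff diff_conv_add_uminus)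
      show ?thesis using that lam
        by (auto simp: A_def chordal_cap_def polar_dist_def n field_simps min_less_iff_disj min_mult_distrib_left)
    qed
    have point: "ennreal (\<bar>poly P (x \<bullet> z)\<bar> powr q) \<le> (\<Sum>j. ennreal (B1 * r ^ j) * indicator (A j) x)"
      if "x \<in> space sphere_volume" for x
    proof -
      have x: "norm x = 1" using that by simp
      note decay = gegenbauer_polar_decay[OF M _ P x z]
      obtain j0 where "lam * polar_dist z x < 2 ^ j0" using real_arch_pow[of 2] by auto
      then have ex: "lam * polar_dist z x < 2 ^ (LEAST j. lam * polar_dist z x < 2 ^ j)"
        by (rule LeastI)
      \<comment> \<open>The first dyadic level that contains \<open>x\<close>; for \<open>j > 0\<close> the distance to the poles is at least \<open>2 ^ (j - 1) / lam\<close>.\<close>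
      define j where "j = (LEAST j. lam * polar_dist z x < 2 ^ j)"
      have xA: "x \<in> A j" using ex Aiff[OF x] by (simp add: j_def)
      have "\<bar>poly P (x \<bullet> z)\<bar> powr q \<le> B1 * r ^ j"
      proof (cases j)
        case 0
        have "\<bar>poly P (x \<bullet> z)\<bar> powr q \<le> 1 powr q" using decay(1) lam q0 by (intro powr_mono2) auto
        then show ?thesis using B1 0 by simp
      next
        case (Suc i)
        have "i < j" using Suc by simp
        then have ge: "2 ^ i \<le> lam * polar_dist z x" unfolding j_def using not_less_Least by force
        have "(2 ^ i) ^ M * (poly P (x \<bullet> z))\<^sup>2 \<le> (lam * polar_dist z x) ^ M * (poly P (x \<bullet> z))\<^sup>2"
          using ge by (intro mult_right_mono power_mono) auto
        also have "\<dots> \<le> B" using decay(2) lam by (simp add: B_def)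
        finally have "\<bar>poly P (x \<bullet> z)\<bar> powr q \<le> B powr (q / 2) * (2 ^ i) powr (- \<gamma>)"
          unfolding \<gamma>_def using B q0 by (intro powr_le_of_decay) auto
        also have "(2 ^ i :: real) powr (- \<gamma>) = 2 powr \<gamma> * r ^ j"
        proof -
          have "(2 ^ i :: real) powr (- \<gamma>) = r ^ i"
            unfolding r_def by (simp add: powr_realpow[symmetric] powr_powr mult.commute)
          moreover have "2 powr \<gamma> * r = 1" by (simp add: r_def powr_add[symmetric])
          ultimately show ?thesis by (simp add: Suc mult.assoc[symmetric])
        qed
        also have "B powr (q / 2) * (2 powr \<gamma> * r ^ j) \<le> B1 * r ^ j"
          using r0 by (simp add: B1_def algebra_simps)
        finally show ?thesis .
      qed
      define F where "F i = ennreal (B1 * r ^ i) * indicator (A i) x" for i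
      have "ennreal (\<bar>poly P (x \<bullet> z)\<bar> powr q) \<le> F j"
        using xA \<open>_ \<le> B1 * r ^ j\<close> by (simp add: F_def ennreal_leI)
      also have "F j = (\<Sum>i\<in>{j}. F i)" by simp
      also have "\<dots> \<le> (\<Sum>i. F i)" by (rule sum_le_suminf) auto
      finally show ?thesis by (simp only: F_def)
    qed
    have "(\<integral>\<^sup>+x. ennreal (\<bar>poly P (x \<bullet> z)\<bar> powr q) \<partial>sphere_volume)
       \<le> (\<integral>\<^sup>+x. (\<Sum>j. ennreal (B1 * r ^ j) * indicator (A j) x) \<partial>sphere_volume)"
      by (rule nn_integral_mono) (rule point)
    also have "\<dots> = (\<Sum>j. \<integral>\<^sup>+x. ennreal (B1 * r ^ j) * indicator (A j) x \<partial>sphere_volume)"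
      by (intro nn_integral_suminf borel_measurable_times_ennreal borel_measurable_const borel_measurable_indicator Ameas)
    also have "\<dots> = (\<Sum>j. ennreal (B1 * r ^ j) * emeasure sphere_volume (A j))"
      by (simp only: nn_integral_cmult_indicator[OF Ameas])
    also have "\<dots> \<le> (\<Sum>j. ennreal (2 * C1 * B1 / lam ^ (M + 1) * s ^ j))"
    proof (rule suminf_le)
      fix j
      have "ennreal (B1 * r ^ j) * emeasure sphere_volume (A j) \<le> ennreal (B1 * r ^ j) * ennreal (2 * C1 * (2 ^ j / lam) ^ (M + 1))"
        by (intro mult_left_mono Avol) simp
      also have "\<dots> = ennreal (B1 * r ^ j * (2 * C1 * (2 ^ j / lam) ^ (M + 1)))"
        using B1 r0 C1 lam by (intro ennreal_mult[symmetric]) auto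
      also have "B1 * r ^ j * (2 * C1 * (2 ^ j / lam) ^ (M + 1)) = 2 * C1 * B1 / lam ^ (M + 1) * s ^ j"
        by (simp add: s_def power_mult_distrib power_divide power_mult[symmetric] mult_ac del: power_Suc power_add)
      finally show "ennreal (B1 * r ^ j) * emeasure sphere_volume (A j) \<le> ennreal (2 * C1 * B1 / lam ^ (M + 1) * s ^ j)" .
    qed auto
    also have "\<dots> = ennreal (\<Sum>j. 2 * C1 * B1 / lam ^ (M + 1) * s ^ j)"
      using C1 B1 lam s by (intro suminf_ennreal2 summable_mult summable_geometric) auto
    also have "(\<Sum>j. 2 * C1 * B1 / lam ^ (M + 1) * s ^ j) = 2 * C1 * B1 / lam ^ (M + 1) * (1 / (1 - s))"
      using s by (subst suminf_mult) (auto simp: suminf_geometric)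
    also have "\<dots> = C / lam ^ (M + 1)" by (simp add: C_def)
    finally show ?thesis .
  qed
  with C show ?thesis by blast
qed

section \<open>The eigenvalues of the Laplacian\<close>

text \<open>
  A radial cut-off that is supported in an annulus away from the origin, where \<open>f \<circ> sgn\<close> is singular.
\<close>

definition annulus_weight :: "'a::euclidean_space \<Rightarrow> real" where
  "annulus_weight x = (max 0 (1 - ((norm x)\<^sup>2 - 2)\<^sup>2))\<^sup>2"

text \<open>
  Up to a constant factor this is the integral of \<open>F\<close> over the sphere, in a form to which the Euclidean
  divergence theorem applies.  The factor \<open>1 / \<bar>x\<bar>\<^sup>2\<close> is the one relating the Laplacian of \<open>f \<circ> sgn\<close> to that
  of \<open>f\<close>.
\<close>

definition annulus_mean :: "('a::euclidean_space \<Rightarrow> real) \<Rightarrow> real" where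
  "annulus_mean F = integral (cbox (- 2 *\<^sub>R One) (2 *\<^sub>R One)) (\<lambda>x. annulus_weight x / (norm x)\<^sup>2 * F (sgn x))"

definition annulus :: "'a::euclidean_space set" where
  "annulus = {x. 1 \<le> (norm x)\<^sup>2 \<and> (norm x)\<^sup>2 \<le> 3}"

lemma annulus_weight_outside: "x \<notin> annulus \<Longrightarrow> annulus_weight x = 0"
proof -
  assume "x \<notin> annulus"
  then have "1 < \<bar>(norm x)\<^sup>2 - 2\<bar>" by (auto simp: annulus_def)
  then have "1 \<le> ((norm x)\<^sup>2 - 2)\<^sup>2"
    using power_mono[of 1 "\<bar>(norm x)\<^sup>2 - 2\<bar>" 2] by simp
  then show ?thesis by (simp add: annulus_weight_def)
qed

lemma compact_annulus: "compact (annulus :: 'a::euclidean_space set)"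
proof -
  have "bounded (annulus :: 'a set)"
    unfolding bounded_iff
  proof (intro exI ballI)
    fix x :: 'a assume "x \<in> annulus"
    then have "(norm x)\<^sup>2 \<le> 2\<^sup>2" by (simp add: annulus_def)
    then show "norm x \<le> 2" by (rule power2_le_imp_le) simp
  qed
  moreover have "closed (annulus :: 'a set)"
    unfolding annulus_def by (intro closed_Collect_conj closed_Collect_le continuous_intros)
  ultimately show ?thesis by (simp add: compact_eq_bounded_closed)
qed

lemma annulus_nonzero: "annulus \<subseteq> -{0}" by (auto simp: annulus_def)

lemma cball_2_subset_cbox: "norm (x::'a::euclidean_space) \<le> 2 \<Longrightarrow> x \<in> cbox (- 2 *\<^sub>R One) (2 *\<^sub>R One)"
proof -
  assume "norm x \<le> 2"
  then have "\<bar>x \<bullet> i\<bar> \<le> 2" if "i \<in> Basis" for i using Basis_le_norm[OF that, of x] by simp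
  then show ?thesis by (auto simp: mem_box abs_le_iff minus_le_iff)
qed

lemma annulus_subset_cbox: "annulus \<subseteq> cbox (- 2 *\<^sub>R One) (2 *\<^sub>R One :: 'a::euclidean_space)"
proof
  fix x :: 'a assume "x \<in> annulus"
  then have "(norm x)\<^sup>2 \<le> 2\<^sup>2" by (simp add: annulus_def)
  then have "norm x \<le> 2" by (rule power2_le_imp_le) simp
  then show "x \<in> cbox (- 2 *\<^sub>R One) (2 *\<^sub>R One)" by (rule cball_2_subset_cbox)
qed

lemma annulus_weight_continuous: "continuous_on S annulus_weight"
  unfolding annulus_weight_def[abs_def] by (intro continuous_intros)

lemma has_derivative_annulus_weight:
  "(annulus_weight has_derivative (\<lambda>v. - 8 * max 0 (1 - ((norm x)\<^sup>2 - 2)\<^sup>2) * ((norm x)\<^sup>2 - 2) * (x \<bullet> v))) (at x)"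
proof -
  have "((\<lambda>y::'a. 1 - (y \<bullet> y - 2)\<^sup>2) has_derivative (\<lambda>v. - 4 * (x \<bullet> x - 2) * (x \<bullet> v))) (at x)"
    by (auto intro!: derivative_eq_intros simp: inner_commute fun_eq_iff algebra_simps)
  from DERIV_compose_FDERIV[OF DERIV_max0_power2 this] show ?thesis
    unfolding annulus_weight_def[abs_def] power2_norm_eq_inner
    by (rule has_derivative_eq_rhs) (simp add: fun_eq_iff algebra_simps)
qed

lemma annulus_integrand_continuous:
  fixes F :: "'a::euclidean_space \<Rightarrow> real"
  assumes "continuous_on (sphere 0 1) F"
  shows "continuous_on UNIV (\<lambda>x. annulus_weight x / (norm x)\<^sup>2 * F (sgn x))"
proof -
  have "continuous_on (-{0}) (\<lambda>x. annulus_weight x / (norm x)\<^sup>2 * F (sgn x))"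
    by (intro continuous_intros annulus_weight_continuous
        continuous_on_compose2[OF assms continuous_on_sgn_punctured])
       (auto simp: norm_sgn split: if_splits)
  moreover have "continuous_on (ball 0 1) (\<lambda>x. annulus_weight x / (norm x)\<^sup>2 * F (sgn x))"
  proof (rule continuous_on_eq[of _ "\<lambda>_. 0"])
    fix x :: 'a assume "x \<in> ball 0 1"
    then have "(norm x)\<^sup>2 < 1" using abs_square_less_1[of "norm x"] by simp
    then have "x \<notin> annulus" by (simp add: annulus_def)
    then show "0 = annulus_weight x / (norm x)\<^sup>2 * F (sgn x)" by (simp add: annulus_weight_outside)
  qed simp
  ultimately have "continuous_on (-{0} \<union> ball 0 1) (\<lambda>x. annulus_weight x / (norm x)\<^sup>2 * F (sgn x))"
    by (intro continuous_on_open_Un) auto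
  moreover have "-{0} \<union> ball 0 1 = (UNIV :: 'a set)" by auto
  ultimately show ?thesis by simp
qed

lemma annulus_integrand_integrable:
  fixes F :: "'a::euclidean_space \<Rightarrow> real"
  assumes "continuous_on (sphere 0 1) F"
  shows "(\<lambda>x. annulus_weight x / (norm x)\<^sup>2 * F (sgn x)) integrable_on cbox a b"
  by (intro integrable_continuous continuous_on_subset[OF annulus_integrand_continuous[OF assms]]) simp

lemma annulus_mean_add:
  assumes "continuous_on (sphere 0 1) F" "continuous_on (sphere 0 1) G"
  shows "annulus_mean (\<lambda>x. F x + G x) = annulus_mean F + annulus_mean G"
  unfolding annulus_mean_def distrib_left
  by (intro integral_add annulus_integrand_integrable assms)

lemma annulus_mean_cmult: "annulus_mean (\<lambda>x. c * F x) = c * annulus_mean F"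
  unfolding annulus_mean_def mult.left_commute[of _ c] by (rule integral_mult_right)

lemma annulus_mean_bound:
  assumes "continuous_on (sphere 0 1) F" "continuous_on (sphere 0 1) G" "\<And>x. x \<in> sphere 0 1 \<Longrightarrow> \<bar>F x\<bar> \<le> G x"
  shows "\<bar>annulus_mean F\<bar> \<le> annulus_mean G"
proof -
  have "norm (annulus_mean F) \<le> annulus_mean G"
    unfolding annulus_mean_def
  proof (intro integral_norm_bound_integral annulus_integrand_integrable assms)
    fix x :: 'a
    show "norm (annulus_weight x / (norm x)\<^sup>2 * F (sgn x)) \<le> annulus_weight x / (norm x)\<^sup>2 * G (sgn x)"
    proof (cases "x = 0")
      case False
      then have "\<bar>F (sgn x)\<bar> \<le> G (sgn x)" by (intro assms(3)) (simp add: norm_sgn)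
      then show ?thesis by (auto simp: abs_mult annulus_weight_def intro!: mult_left_mono divide_right_mono)
    qed simp
  qed
  then show ?thesis by simp
qed

text \<open>
  Green's identity: apply the divergence theorem to the weight times \<open>f \<nabla>g - g \<nabla>f\<close>, where the
  functions are extended radially.  The gradient of the weight is radial and these fields are tangential,
  so the weight contributes nothing.
\<close>

lemma laplace_beltrami_symmetric:
  fixes f g :: "'a::euclidean_space \<Rightarrow> real"
  assumes f: "sphere_C2 f" and g: "sphere_C2 g"
  shows "annulus_mean (\<lambda>x. f x * laplace_beltrami g x - g x * laplace_beltrami f x) = 0"
proof -
  obtain A where A: "\<And>x. x \<noteq> 0 \<Longrightarrow> (ext_grad f has_derivative A x) (at x)"
    "\<And>b. continuous_on (-{0}) (\<lambda>x. A x b)"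
    "\<And>x. x \<noteq> 0 \<Longrightarrow> trace_map (A x) = laplace_beltrami f (sgn x) / (norm x)\<^sup>2"
    using sphere_C2_hessian[OF f] by blast
  obtain B where B: "\<And>x. x \<noteq> 0 \<Longrightarrow> (ext_grad g has_derivative B x) (at x)"
    "\<And>b. continuous_on (-{0}) (\<lambda>x. B x b)"
    "\<And>x. x \<noteq> 0 \<Longrightarrow> trace_map (B x) = laplace_beltrami g (sgn x) / (norm x)\<^sup>2"
    using sphere_C2_hessian[OF g] by blast
  note gf = sphere_C2_has_gradient[OF f] and gg = sphere_C2_has_gradient[OF g]
  define X where "X x = f (sgn x) *\<^sub>R ext_grad g x - g (sgn x) *\<^sub>R ext_grad f x" for x
  define X' where "X' x v = (f (sgn x) *\<^sub>R B x v + (ext_grad f x \<bullet> v) *\<^sub>R ext_grad g x)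
      - (g (sgn x) *\<^sub>R A x v + (ext_grad g x \<bullet> v) *\<^sub>R ext_grad f x)" for x v
  \<comment> \<open>The gradient of the weight at \<open>x\<close> is \<open>c x\<close> times \<open>x\<close>.\<close>
  define c where "c x = - 8 * max 0 (1 - ((norm x)\<^sup>2 - 2)\<^sup>2) * ((norm x)\<^sup>2 - 2)" for x :: 'a
  define F' where "F' x v = annulus_weight x *\<^sub>R X' x v + c x *\<^sub>R ((x \<bullet> v) *\<^sub>R X x)" for x v
  have ce: "continuous_on (-{0}) (ext_grad f)" "continuous_on (-{0}) (ext_grad g)"
    by (auto intro!: continuous_at_imp_continuous_on has_derivative_continuous[OF A(1)] has_derivative_continuous[OF B(1)])
  have "((\<lambda>x. if x \<in> annulus then \<Sum>b\<in>Basis. F' x b \<bullet> b else 0) has_integral 0) UNIV"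
  proof (rule integral_divergence_eq_0[OF _ compact_annulus annulus_nonzero])
    fix x :: 'a assume "x \<in> -{0}"
    then have x: "x \<noteq> 0" by simp
    have "(X has_derivative X' x) (at x)"
      unfolding X_def[abs_def] X'_def[abs_def]
      by (intro has_derivative_diff has_derivative_scaleR gf(2) gg(2) A(1) B(1) x)
    from has_derivative_scaleR[OF has_derivative_annulus_weight this]
    show "((\<lambda>x. annulus_weight x *\<^sub>R X x) has_derivative F' x) (at x)"
      unfolding F'_def[abs_def] c_def by simp
  next
    fix b :: 'a
    have "continuous_on (-{0}) (\<lambda>x. F' x b \<bullet> b)"
      unfolding F'_def X_def X'_def c_def
      by (intro continuous_intros annulus_weight_continuous ce A(2) B(2) sphere_C2_ext_continuous f g)
    then show "continuous_on annulus (\<lambda>x. F' x b \<bullet> b)"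
      by (rule continuous_on_subset) (rule annulus_nonzero)
  qed (auto simp: annulus_weight_outside)
  moreover have "(if x \<in> annulus then \<Sum>b\<in>Basis. F' x b \<bullet> b else 0)
      = (if x \<in> cbox (- 2 *\<^sub>R One) (2 *\<^sub>R One) then annulus_weight x / (norm x)\<^sup>2 *
          (f (sgn x) * laplace_beltrami g (sgn x) - g (sgn x) * laplace_beltrami f (sgn x)) else 0)" for x
  proof (cases "x \<in> annulus")
    case True
    then have x: "x \<noteq> 0" using annulus_nonzero by blast
    have "x \<bullet> X x = 0" using gf(1)[OF x] gg(1)[OF x] by (simp add: X_def inner_diff_right)
    moreover have "trace_map (X' x) = (f (sgn x) * laplace_beltrami g (sgn x) - g (sgn x) * laplace_beltrami f (sgn x)) / (norm x)\<^sup>2"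
      unfolding X'_def[abs_def] trace_map_simps A(3)[OF x] B(3)[OF x]
      by (simp add: inner_commute diff_divide_distrib)
    ultimately have "trace_map (F' x) = annulus_weight x / (norm x)\<^sup>2 *
          (f (sgn x) * laplace_beltrami g (sgn x) - g (sgn x) * laplace_beltrami f (sgn x))"
      unfolding F'_def[abs_def] trace_map_simps by simp
    then show ?thesis using True annulus_subset_cbox by (auto simp: trace_map_def)
  qed (auto simp: annulus_weight_outside)
  ultimately have "((\<lambda>x. if x \<in> cbox (- 2 *\<^sub>R One) (2 *\<^sub>R One) then annulus_weight x / (norm x)\<^sup>2 *
          (f (sgn x) * laplace_beltrami g (sgn x) - g (sgn x) * laplace_beltrami f (sgn x)) else 0) has_integral 0) UNIV"
    by simp
  then show ?thesis unfolding has_integral_restrict_UNIV annulus_mean_def by (rule integral_unique)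
qed

text \<open>
  Green's identity for \<open>f\<close> and the zonal function \<open>(x \<bullet> w)\<^sup>j\<close>, whose Laplacian is a combination of
  the powers \<open>j - 2\<close> and \<open>j\<close>.  For \<open>j < 2\<close> the right-hand side is zero.
\<close>

lemma laplace_moment_recurrence:
  fixes f :: "'a::euclidean_space \<Rightarrow> real"
  assumes f: "real_eigenfunction lam f" and w: "norm w = 1"
  shows "(lam\<^sup>2 - real j * (real j + real DIM('a) - 2)) * annulus_mean (\<lambda>x. f x * (x \<bullet> w) ^ j)
    = - (real j * (real j - 1)) * annulus_mean (\<lambda>x. f x * (x \<bullet> w) ^ (j - 2))"
proof -
  let ?n = "real DIM('a)"
  have C2: "sphere_C2 f" and eig: "\<And>x. x \<in> sphere 0 1 \<Longrightarrow> laplace_beltrami f x = - (lam\<^sup>2) * f x"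
    using f by (auto simp: real_eigenfunction_def)
  have cf: "continuous_on (sphere 0 1) f" by (rule sphere_C2_continuous[OF C2])
  define g where "g x = poly (monom 1 j) (x \<bullet> w)" for x
  have g: "g x = (x \<bullet> w) ^ j" for x by (simp add: g_def poly_monom)
  have gC2: "sphere_C2 g" unfolding g_def[abs_def] by (rule zonal_calculus(1)[OF w])
  have Lg: "laplace_beltrami g x = real j * (real j - 1) * (x \<bullet> w) ^ (j - 2)
     - real j * (real j + ?n - 2) * (x \<bullet> w) ^ j" if "x \<in> sphere 0 1" for x
  proof -
    have e1: "poly (pderiv (monom 1 j)) t * t = real j * t ^ j" for t :: real
      by (cases j) (auto simp: pderiv_monom poly_monom)
    have e2: "poly (pderiv (pderiv (monom 1 j))) t = real j * (real j - 1) * t ^ (j - 2)"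
      "real j * (real j - 1) * t ^ (j - 2) * t\<^sup>2 = real j * (real j - 1) * t ^ j" for t :: real
      by (cases j; cases "j - 1"; auto simp: pderiv_monom poly_monom power2_eq_square)+
    have "laplace_beltrami g x = (1 - (x \<bullet> w)\<^sup>2) * (real j * (real j - 1) * (x \<bullet> w) ^ (j - 2))
        - (?n - 1) * (poly (pderiv (monom 1 j)) (x \<bullet> w) * (x \<bullet> w))"
      unfolding g_def[abs_def] zonal_calculus(2)[OF w that] e2(1) by (simp add: mult_ac)
    also have "\<dots> = real j * (real j - 1) * (x \<bullet> w) ^ (j - 2) - real j * (real j - 1) * (x \<bullet> w) ^ (j - 2) * (x \<bullet> w)\<^sup>2
        - (?n - 1) * (real j * (x \<bullet> w) ^ j)"
      unfolding e1 by (simp add: algebra_simps)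
    finally show ?thesis unfolding e2(2) by (simp add: algebra_simps)
  qed
  have "0 = annulus_mean (\<lambda>x. f x * laplace_beltrami g x - g x * laplace_beltrami f x)"
    by (rule laplace_beltrami_symmetric[OF C2 gC2, symmetric])
  also have "\<dots> = annulus_mean (\<lambda>x. (real j * (real j - 1)) * (f x * (x \<bullet> w) ^ (j - 2))
      + (lam\<^sup>2 - real j * (real j + ?n - 2)) * (f x * (x \<bullet> w) ^ j))"
    unfolding annulus_mean_def
  proof (rule integral_cong)
    fix x :: 'a
    show "annulus_weight x / (norm x)\<^sup>2 * (f (sgn x) * laplace_beltrami g (sgn x) - g (sgn x) * laplace_beltrami f (sgn x))
      = annulus_weight x / (norm x)\<^sup>2 * ((real j * (real j - 1)) * (f (sgn x) * (sgn x \<bullet> w) ^ (j - 2))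
      + (lam\<^sup>2 - real j * (real j + ?n - 2)) * (f (sgn x) * (sgn x \<bullet> w) ^ j))"
    proof (cases "x = 0")
      case False
      then have "sgn x \<in> sphere 0 1" by (simp add: norm_sgn)
      then show ?thesis by (simp add: Lg eig g algebra_simps)
    qed simp
  qed
  also have "\<dots> = (real j * (real j - 1)) * annulus_mean (\<lambda>x. f x * (x \<bullet> w) ^ (j - 2))
      + (lam\<^sup>2 - real j * (real j + ?n - 2)) * annulus_mean (\<lambda>x. f x * (x \<bullet> w) ^ j)"
    by (subst annulus_mean_add) (auto simp: annulus_mean_cmult intro!: continuous_intros cf)
  finally show ?thesis by simp
qed

text \<open>
  The continuous functions orthogonal to \<open>f\<close>; they form a uniformly closed subspace.
\<close>

definition annulus_orthogonal :: "('a::euclidean_space \<Rightarrow> real) \<Rightarrow> ('a \<Rightarrow> real) \<Rightarrow> bool" where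
  "annulus_orthogonal f F \<longleftrightarrow> continuous_on (sphere 0 1) F \<and> annulus_mean (\<lambda>x. f x * F x) = 0"

lemma annulus_orthogonal_add:
  assumes "continuous_on (sphere 0 1) f" "annulus_orthogonal f F" "annulus_orthogonal f G"
  shows "annulus_orthogonal f (\<lambda>x. F x + G x)"
  using assms annulus_mean_add[of "\<lambda>x. f x * F x" "\<lambda>x. f x * G x"]
  by (auto simp: annulus_orthogonal_def distrib_left intro!: continuous_intros)

lemma annulus_orthogonal_cmult:
  assumes "annulus_orthogonal f F"
  shows "annulus_orthogonal f (\<lambda>x. c * F x)"
  using assms by (auto simp: annulus_orthogonal_def mult.left_commute[of _ c] annulus_mean_cmult intro!: continuous_intros)

lemma annulus_orthogonal_uniform_limit:
  fixes f :: "'a::euclidean_space \<Rightarrow> real"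
  assumes f: "continuous_on (sphere 0 1) f" and F: "continuous_on (sphere 0 1) F"
    and approx: "\<And>e. 0 < e \<Longrightarrow> \<exists>G. annulus_orthogonal f G \<and> (\<forall>x\<in>sphere 0 1. \<bar>F x - G x\<bar> < e)"
  shows "annulus_orthogonal f F"
proof -
  define b where "b = annulus_mean (\<lambda>x. \<bar>f x\<bar>)"
  have bound: "\<bar>annulus_mean (\<lambda>x. f x * F x)\<bar> \<le> e * b" if e: "0 < e" for e
  proof -
    obtain G where G: "annulus_orthogonal f G" "\<forall>x\<in>sphere 0 1. \<bar>F x - G x\<bar> < e" using approx[OF e] by blast
    have cG: "continuous_on (sphere 0 1) G" using G(1) by (simp add: annulus_orthogonal_def)
    have "annulus_mean (\<lambda>x. f x * (F x - G x) + f x * G x) = annulus_mean (\<lambda>x. f x * (F x - G x)) + annulus_mean (\<lambda>x. f x * G x)"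
      by (intro annulus_mean_add continuous_intros f F cG)
    then have "annulus_mean (\<lambda>x. f x * F x) = annulus_mean (\<lambda>x. f x * (F x - G x))"
      using G(1) by (simp add: annulus_orthogonal_def distrib_left[symmetric])
    also have "\<bar>\<dots>\<bar> \<le> annulus_mean (\<lambda>x. e * \<bar>f x\<bar>)"
    proof (intro annulus_mean_bound continuous_intros f F cG)
      fix x :: 'a assume "x \<in> sphere 0 1"
      then have "\<bar>F x - G x\<bar> \<le> e" using G(2) less_imp_le by blast
      then have "\<bar>f x\<bar> * \<bar>F x - G x\<bar> \<le> \<bar>f x\<bar> * e" by (rule mult_left_mono) simp
      then show "\<bar>f x * (F x - G x)\<bar> \<le> e * \<bar>f x\<bar>" by (simp add: abs_mult mult.commute)
    qed
    finally show ?thesis by (simp add: annulus_mean_cmult b_def)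
  qed
  have "\<bar>b\<bar> \<le> b" unfolding b_def by (intro annulus_mean_bound continuous_intros f) auto
  then have B: "0 \<le> b" by linarith
  have "\<bar>annulus_mean (\<lambda>x. f x * F x)\<bar> \<le> 0"
  proof (rule field_le_epsilon)
    fix e :: real assume e: "0 < e"
    have "\<bar>annulus_mean (\<lambda>x. f x * F x)\<bar> \<le> (e / (b + 1)) * b"
      by (rule bound) (use B e in simp)
    also have "\<dots> \<le> e" using B e by (simp add: divide_le_eq)
    finally show "\<bar>annulus_mean (\<lambda>x. f x * F x)\<bar> \<le> 0 + e" by simp
  qed
  then show ?thesis using F by (simp add: annulus_orthogonal_def)
qed

text \<open>
  The span of the exponentials \<open>x \<mapsto> exp (x \<bullet> y)\<close> is an algebra, and it consists of sums of functions
  of one variable \<open>x \<bullet> y\<close>.  It mediates between the powers \<open>(x \<bullet> w)\<^sup>j\<close> and all continuous functions.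
\<close>

inductive exp_span :: "('a::euclidean_space \<Rightarrow> real) \<Rightarrow> bool" where
  exp: "exp_span (\<lambda>x. c * exp (x \<bullet> y))"
| add: "exp_span F \<Longrightarrow> exp_span G \<Longrightarrow> exp_span (\<lambda>x. F x + G x)"

lemma exp_span_mult: "exp_span F \<Longrightarrow> exp_span G \<Longrightarrow> exp_span (\<lambda>x. F x * G x)"
proof (induction F rule: exp_span.induct)
  case (exp c y)
  show ?case using exp
  proof (induction G rule: exp_span.induct)
    case (exp d y')
    have "(\<lambda>x. c * exp (x \<bullet> y) * (d * exp (x \<bullet> y'))) = (\<lambda>x. (c * d) * exp (x \<bullet> (y + y')))"
      by (simp add: inner_add_right exp_add mult_ac fun_eq_iff)
    then show ?case by (simp only: exp_span.exp)
  next
    case (add F G)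
    then show ?case using exp_span.add by (simp add: distrib_left)
  qed
next
  case (add F1 F2)
  then show ?case using exp_span.add by (simp add: distrib_right)
qed

text \<open>
  Otherwise the moment recurrence makes \<open>f\<close> orthogonal to all powers \<open>(x \<bullet> w)\<^sup>j\<close>, hence by Weierstrass
  approximation to all functions of \<open>x \<bullet> w\<close>, in particular to the exponentials, hence by
  Stone-Weierstrass to every continuous function and to itself.
\<close>

proposition eigenvalue_quantised:
  fixes f :: "'a::euclidean_space \<Rightarrow> real"
  assumes f: "real_eigenfunction lam f" and x0: "x0 \<in> sphere 0 1" "f x0 \<noteq> 0"
  obtains j :: nat where "lam\<^sup>2 = real j * (real j + real DIM('a) - 2)"
proof (rule ccontr)
  assume "\<not> thesis"
  then have ne: "lam\<^sup>2 - real j * (real j + real DIM('a) - 2) \<noteq> 0" for j using that by auto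
  have C2: "sphere_C2 f" using f by (simp add: real_eigenfunction_def)
  have cf: "continuous_on (sphere 0 1) f" by (rule sphere_C2_continuous[OF C2])
  have moments: "annulus_orthogonal f (\<lambda>x. (x \<bullet> w) ^ j)" if w: "norm w = 1" for w j
  proof (induction j rule: less_induct)
    case (less j)
    have "real j * (real j - 1) * annulus_mean (\<lambda>x. f x * (x \<bullet> w) ^ (j - 2)) = 0"
    proof (cases "j < 2")
      case True then show ?thesis by (cases j) auto
    next
      case False then show ?thesis using less[of "j - 2"] by (simp add: annulus_orthogonal_def)
    qed
    then have "- (real j * (real j - 1) * annulus_mean (\<lambda>x. f x * (x \<bullet> w) ^ (j - 2))) = 0"
      by (simp only: neg_equal_0_iff_equal)
    then have "(lam\<^sup>2 - real j * (real j + real DIM('a) - 2)) * annulus_mean (\<lambda>x. f x * (x \<bullet> w) ^ j) = 0"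
      unfolding laplace_moment_recurrence[OF f w, of j] minus_mult_left[symmetric] .
    then have "annulus_mean (\<lambda>x. f x * (x \<bullet> w) ^ j) = 0"
      using ne[of j] unfolding mult_eq_0_iff by blast
    then show ?case by (auto simp: annulus_orthogonal_def intro!: continuous_intros)
  qed
  \<comment> \<open>Weierstrass approximation of \<open>\<phi>\<close> by polynomials in one variable.\<close>
  have ridge: "annulus_orthogonal f (\<lambda>x. \<phi> (x \<bullet> w))" if w: "norm w = 1" and \<phi>: "continuous_on {-1..1} \<phi>" for w \<phi>
  proof (rule annulus_orthogonal_uniform_limit[OF cf])
    have b: "x \<bullet> w \<in> {-1..1}" if "x \<in> sphere 0 1" for x
      using Cauchy_Schwarz_ineq2[of x w] that w by (auto simp: abs_le_iff)
    show "continuous_on (sphere 0 1) (\<lambda>x. \<phi> (x \<bullet> w))"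
      by (rule continuous_on_compose2[OF \<phi>]) (use b in \<open>auto intro!: continuous_intros\<close>)
    fix e :: real assume "0 < e"
    obtain g where g: "real_polynomial_function g" "\<And>t. t \<in> {-1..1} \<Longrightarrow> \<bar>\<phi> t - g t\<bar> < e"
      using Stone_Weierstrass_real_polynomial_function[OF _ \<phi> \<open>0 < e\<close>] by auto
    then obtain a N where gs: "g = (\<lambda>t. \<Sum>i\<le>N. a i * t ^ i)"
      by (auto simp: real_polynomial_function_iff_sum)
    have "annulus_orthogonal f (\<lambda>x. \<Sum>i\<le>N. a i * (x \<bullet> w) ^ i)"
    proof (induction N)
      case 0 then show ?case using annulus_orthogonal_cmult[OF moments[OF w, of 0]] by simp
    next
      case (Suc N) then show ?case using annulus_orthogonal_add[OF cf _ annulus_orthogonal_cmult[OF moments[OF w]]] by (simp del: power_Suc)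
    qed
    then have "annulus_orthogonal f (\<lambda>x. g (x \<bullet> w))" unfolding gs .
    moreover have "\<forall>x\<in>sphere 0 1. \<bar>\<phi> (x \<bullet> w) - g (x \<bullet> w)\<bar> < e" using g(2)[OF b] by blast
    ultimately show "\<exists>G. annulus_orthogonal f G \<and> (\<forall>x\<in>sphere 0 1. \<bar>\<phi> (x \<bullet> w) - G x\<bar> < e)" by blast
  qed
  have span: "annulus_orthogonal f F" if "exp_span F" for F using that
  proof (induction F rule: exp_span.induct)
    case (exp c y)
    have "annulus_orthogonal f (\<lambda>x. exp (x \<bullet> y))"
    proof (cases "y = 0")
      case True
      have "norm x0 = 1" using x0 by simp
      from moments[OF this, of 0] show ?thesis using True by simp
    next
      case False
      have "annulus_orthogonal f (\<lambda>x. exp (norm y * (x \<bullet> sgn y)))"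
        by (rule ridge) (use False in \<open>auto simp: norm_sgn intro!: continuous_intros\<close>)
      moreover have "norm y * (x \<bullet> sgn y) = x \<bullet> y" for x
        using False by (simp add: sgn_div_norm mult.assoc[symmetric])
      ultimately show ?thesis by (simp only:)
    qed
    then show ?case by (rule annulus_orthogonal_cmult)
  next
    case (add F G)
    show ?case by (rule annulus_orthogonal_add[OF cf add.IH])
  qed
  have "annulus_orthogonal f f"
  proof (rule annulus_orthogonal_uniform_limit[OF cf cf])
    fix e :: real assume e: "0 < e"
    have "\<exists>G. exp_span G \<and> (\<forall>x\<in>sphere 0 1. \<bar>f x - G x\<bar> < e)"
    proof (rule Stone_Weierstrass_HOL[OF compact_sphere _ _ _ _ _ cf e])
      show "exp_span (\<lambda>_::'a. c)" for c :: real using exp_span.exp[of c "0::'a"] by simp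
      fix x y :: 'a assume "x \<in> sphere 0 1 \<and> y \<in> sphere 0 1 \<and> x \<noteq> y"
      then have "(x - y) \<bullet> (x - y) \<noteq> 0" by simp
      then have "x \<bullet> (x - y) \<noteq> y \<bullet> (x - y)" by (simp add: inner_diff_left)
      then have "exp (x \<bullet> (x - y)) \<noteq> exp (y \<bullet> (x - y))" unfolding exp_inj_iff .
      then show "\<exists>F. exp_span F \<and> F x \<noteq> F y"
        using exp_span.exp[of 1 "x - y"] by (intro exI[of _ "\<lambda>z. 1 * exp (z \<bullet> (x - y))"]) simp
    qed (use span exp_span.add exp_span_mult in \<open>auto simp: annulus_orthogonal_def\<close>)
    then show "\<exists>G. annulus_orthogonal f G \<and> (\<forall>x\<in>sphere 0 1. \<bar>f x - G x\<bar> < e)" using span by blast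
  qed
  then have zero: "annulus_mean (\<lambda>x. f x * f x) = 0" by (simp add: annulus_orthogonal_def)
  let ?Q = "cbox (- 2 *\<^sub>R One) (2 *\<^sub>R One) :: 'a set"
  have cff: "continuous_on (sphere 0 1) (\<lambda>x. f x * f x)" by (intro continuous_intros cf)
  have "((\<lambda>x. annulus_weight x / (norm x)\<^sup>2 * (f (sgn x) * f (sgn x))) has_integral 0) ?Q"
    using zero annulus_integrand_integrable[OF cff] unfolding annulus_mean_def
    by (metis (no_types, lifting) integrable_integral)
  note int = this
  have ne_box: "box (- 2 *\<^sub>R One) (2 *\<^sub>R One) \<noteq> ({} :: 'a set)" by (simp add: box_ne_empty inner_minus_left)
  have mem: "sqrt 2 *\<^sub>R x0 \<in> ?Q"
    using x0 by (intro cball_2_subset_cbox) (simp add: real_sqrt_le_iff[of 2 4, simplified])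
  have cont: "continuous_on ?Q (\<lambda>x. annulus_weight x / (norm x)\<^sup>2 * (f (sgn x) * f (sgn x)))"
    by (rule continuous_on_subset[OF annulus_integrand_continuous[OF cff] subset_UNIV])
  have "annulus_weight (sqrt 2 *\<^sub>R x0) / (norm (sqrt 2 *\<^sub>R x0))\<^sup>2 * (f (sgn (sqrt 2 *\<^sub>R x0)) * f (sgn (sqrt 2 *\<^sub>R x0))) = 0"
    by (rule has_integral_0_cbox_imp_0[OF cont _ int ne_box mem]) (simp add: annulus_weight_def)
  then show False using x0 by (simp add: annulus_weight_def sgn_scaleR)
qed

section \<open>The equivalence\<close>

lemma eigenfunction_parts:
  assumes "eigenfunction lam e"
  shows "real_eigenfunction lam (\<lambda>x. Re (e x))" "real_eigenfunction lam (\<lambda>x. Im (e x))"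
proof -
  have "laplace_beltrami (\<lambda>y. Re (e y)) x = - (lam\<^sup>2) * Re (e x) \<and> laplace_beltrami (\<lambda>y. Im (e y)) x = - (lam\<^sup>2) * Im (e x)"
    if "x \<in> sphere 0 1" for x
  proof -
    have eq: "- Complex (laplace_beltrami (\<lambda>y. Re (e y)) x) (laplace_beltrami (\<lambda>y. Im (e y)) x)
          = of_real (lam\<^sup>2) * e x" using assms that by (auto simp: eigenfunction_def)
    from arg_cong[OF eq, of Re] arg_cong[OF eq, of Im] show ?thesis by simp
  qed
  then show "real_eigenfunction lam (\<lambda>x. Re (e x))" "real_eigenfunction lam (\<lambda>x. Im (e x))"
    using assms by (auto simp: eigenfunction_def real_eigenfunction_def)
qed

lemma cmod_powr_le:
  assumes "0 \<le> p"
  shows "cmod w powr p \<le> 2 powr p * (\<bar>Re w\<bar> powr p + \<bar>Im w\<bar> powr p)"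
proof -
  define b where "b = max \<bar>Re w\<bar> \<bar>Im w\<bar>"
  have "cmod w \<le> 2 * b" using cmod_le[of w] by (auto simp: b_def)
  then have "cmod w powr p \<le> (2 * b) powr p" using assms by (intro powr_mono2) auto
  also have "\<dots> = 2 powr p * b powr p" by (simp add: powr_mult)
  also have "b powr p \<le> \<bar>Re w\<bar> powr p + \<bar>Im w\<bar> powr p" by (auto simp: b_def max_def)
  finally show ?thesis by (simp add: mult_left_mono)
qed

lemma eigenfunction_carleson_from_parts:
  fixes e :: "'a::euclidean_space \<Rightarrow> complex"
  assumes p: "0 < p" and sets: "sets M = sets sphere_borel" and K: "0 \<le> K"
    and e: "eigenfunction lam e"
    and real: "\<And>f. real_eigenfunction lam f \<Longrightarrow>
      (\<integral>\<^sup>+x. ennreal_abs_powr f p x \<partial>M) \<le> ennreal K * (\<integral>\<^sup>+x. ennreal_abs_powr f p x \<partial>sphere_volume)"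
  shows "(\<integral>\<^sup>+x. ennreal (cmod (e x) powr p) \<partial>M)
    \<le> ennreal (2 powr p * 2 * K) * (\<integral>\<^sup>+x. ennreal (cmod (e x) powr p) \<partial>sphere_volume)"
proof -
  let ?R = "\<lambda>x. Re (e x)" and ?J = "\<lambda>x. Im (e x)"
  let ?I = "\<integral>\<^sup>+x. ennreal (cmod (e x) powr p) \<partial>sphere_volume"
  note parts = eigenfunction_parts[OF e]
  have meas: "ennreal_abs_powr f p \<in> borel_measurable M" if "real_eigenfunction lam f" for f
    using ennreal_abs_powr_measurable[of f p] that sets by (simp add: real_eigenfunction_def measurable_cong_sets[OF sets refl])
  have "(\<integral>\<^sup>+x. ennreal (cmod (e x) powr p) \<partial>M) \<le> (\<integral>\<^sup>+x. ennreal (2 powr p) * (ennreal_abs_powr ?R p x + ennreal_abs_powr ?J p x) \<partial>M)"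
    using cmod_powr_le[of p] p
    by (intro nn_integral_mono) (simp add: ennreal_abs_powr_def ennreal_plus[symmetric] ennreal_mult[symmetric] ennreal_leI del: ennreal_plus)
  also have "\<dots> = ennreal (2 powr p) * ((\<integral>\<^sup>+x. ennreal_abs_powr ?R p x \<partial>M) + (\<integral>\<^sup>+x. ennreal_abs_powr ?J p x \<partial>M))"
    using meas[OF parts(1)] meas[OF parts(2)] by (simp add: nn_integral_cmult nn_integral_add)
  also have "\<dots> \<le> ennreal (2 powr p) * (ennreal K * ?I + ennreal K * ?I)"
  proof (intro mult_left_mono add_mono)
    show "(\<integral>\<^sup>+x. ennreal_abs_powr ?R p x \<partial>M) \<le> ennreal K * ?I"
      by (rule order_trans[OF real[OF parts(1)]])
         (use p in \<open>auto intro!: mult_left_mono nn_integral_mono ennreal_leI powr_mono2 abs_Re_le_cmod simp: ennreal_abs_powr_def\<close>)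
    show "(\<integral>\<^sup>+x. ennreal_abs_powr ?J p x \<partial>M) \<le> ennreal K * ?I"
      by (rule order_trans[OF real[OF parts(2)]])
         (use p in \<open>auto intro!: mult_left_mono nn_integral_mono ennreal_leI powr_mono2 abs_Im_le_cmod simp: ennreal_abs_powr_def\<close>)
  qed simp
  also have "\<dots> = ennreal (2 powr p * 2 * K) * ?I"
  proof -
    have "ennreal K * ?I + ennreal K * ?I = ennreal (2 * K) * ?I"
      using K by (simp add: distrib_right[symmetric] ennreal_plus[symmetric] del: ennreal_plus)
    then show ?thesis using K by (simp add: ennreal_mult mult.assoc)
  qed
  finally show ?thesis .
qed

text \<open>
  The radius \<open>r / lam\<close> in the sparseness condition is beyond control, but a smaller mean value ball is
  always possible: \<open>\<epsilon> \<le> r / 12\<close> puts the cap of radius \<open>3 \<epsilon> / lam\<close> inside the geodesic ball of radius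
  \<open>r / lam\<close>.
\<close>

proposition relatively_sparse_imp_Lp_Carleson:
  fixes \<mu> :: "real \<Rightarrow> 'a::euclidean_space measure"
  assumes dim: "2 \<le> DIM('a)" and p: "1 < p"
    and sets: "\<And>lam. 1 \<le> lam \<Longrightarrow> sets (\<mu> lam) = sets sphere_borel"
    and sparse: "relatively_sparse \<mu>"
  shows "Lp_Carleson p \<mu>"
proof -
  let ?n = "DIM('a)"
  obtain r C where r: "0 < r" and C: "0 < C"
    and ratio: "\<And>lam z. lam \<in> frequencies TYPE('a) \<Longrightarrow> z \<in> sphere 0 1 \<Longrightarrow>
        emeasure (\<mu> lam) (geodesic_ball z (r / lam)) / emeasure sphere_volume (geodesic_ball z (r / lam)) \<le> ennreal C"
    using sparse unfolding relatively_sparse_def by blast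
  obtain C1 where C1: "0 < C1" "\<And>z::'a. \<And>\<rho>. 0 < \<rho> \<Longrightarrow> emeasure sphere_volume (chordal_cap z \<rho>) \<le> ennreal (C1 * \<rho> ^ (?n - 1))"
    using chordal_cap_volume_upper[where 'a='a] by auto
  define \<epsilon> where "\<epsilon> = min (r / 12) (1 / (2 * real ?n))"
  have \<epsilon>: "0 < \<epsilon>" "\<epsilon> \<le> 1 / (2 * real ?n)" "12 * \<epsilon> \<le> r" using r dim by (auto simp: \<epsilon>_def)
  define K where "K = C * C1 * r ^ (?n - 1)"
  have K: "0 < K" using C C1 r by (simp add: K_def)
  define c where "c = integral (cbox (- One) One) (parabola_weight :: 'a \<Rightarrow> real)"
  have c: "0 < c" unfolding c_def by (rule integral_parabola_weight_pos)
  define K' where "K' = 3 * 2 ^ ?n * exp p * K / (c * \<epsilon> ^ (?n - 1))"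
  have K': "0 < K'" using c K \<epsilon> by (simp add: K'_def)
  have "(\<integral>\<^sup>+x. ennreal (cmod (e x) powr p) \<partial>\<mu> lam) \<le> ennreal (2 powr p * 2 * K') * (\<integral>\<^sup>+x. ennreal (cmod (e x) powr p) \<partial>sphere_volume)"
    if lam: "1 \<le> lam" and e: "eigenfunction lam e" for lam and e :: "'a \<Rightarrow> complex"
  proof -
    have freq: "lam \<in> frequencies TYPE('a)" using lam e by (auto simp: frequencies_def)
    have cap: "emeasure (\<mu> lam) (chordal_cap w (3 * \<epsilon> / lam)) \<le> ennreal (K / lam ^ (?n - 1))" if w: "norm w = 1" for w :: 'a
    proof -
      let ?G = "geodesic_ball w (r / lam)"
      have "3 * \<epsilon> / lam \<le> r / lam / 4" using divide_right_mono[OF \<epsilon>(3), of lam] lam by simp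
      then have "chordal_cap w (3 * \<epsilon> / lam) \<subseteq> ?G"
        using chordal_subset_geodesic_ball[OF w dim, of "r / lam"] by (force simp: chordal_cap_def)
      then have "emeasure (\<mu> lam) (chordal_cap w (3 * \<epsilon> / lam)) \<le> emeasure (\<mu> lam) ?G"
        using geodesic_ball_measurable[OF w dim] sets[OF lam] by (intro emeasure_mono) auto
      also have "\<dots> \<le> ennreal C * emeasure sphere_volume ?G"
      proof -
        have fin: "emeasure sphere_volume ?G < \<infinity>"
        proof -
          have "emeasure sphere_volume ?G \<le> emeasure sphere_volume (space (sphere_volume :: 'a measure))" by (rule emeasure_space)
          then show ?thesis using finite_sphere_volume[where 'a='a] by (simp add: le_less_trans)
        qed
        have q: "emeasure (\<mu> lam) ?G / emeasure sphere_volume ?G \<le> ennreal C" using ratio[OF freq, of w] w by simp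
        show ?thesis
        proof (cases "emeasure sphere_volume ?G = 0")
          case True
          then show ?thesis using q by (auto split: if_splits simp: top_unique)
        next
          case False
          have "emeasure (\<mu> lam) ?G = emeasure (\<mu> lam) ?G / emeasure sphere_volume ?G * emeasure sphere_volume ?G"
            using False fin by (simp add: ennreal_divide_times)
          also have "\<dots> \<le> ennreal C * emeasure sphere_volume ?G" by (rule mult_right_mono[OF q]) simp
          finally show ?thesis .
        qed
      qed
      also have "\<dots> \<le> ennreal C * ennreal (C1 * (r / lam) ^ (?n - 1))"
      proof (rule mult_left_mono)
        have "?G \<subseteq> chordal_cap w (r / lam)"
          using geodesic_ball_subset_chordal[OF w dim, of "r / lam"] by (simp add: chordal_cap_def)
        then have "emeasure sphere_volume ?G \<le> emeasure sphere_volume (chordal_cap w (r / lam))"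
          using chordal_cap_measurable[of w] by (intro emeasure_mono) auto
        also have "\<dots> \<le> ennreal (C1 * (r / lam) ^ (?n - 1))" using r lam by (intro C1(2)) auto
        finally show "emeasure sphere_volume ?G \<le> ennreal (C1 * (r / lam) ^ (?n - 1))" .
      qed simp
      also have "\<dots> = ennreal (K / lam ^ (?n - 1))"
        using C C1 r lam by (simp add: ennreal_mult[symmetric] K_def power_divide mult.assoc)
      finally show ?thesis .
    qed
    have p0: "0 < p" using p by simp
    show ?thesis
    proof (rule eigenfunction_carleson_from_parts[OF p0 sets[OF lam] less_imp_le[OF K'] e])
      fix f :: "'a \<Rightarrow> real" assume "real_eigenfunction lam f"
      from carleson_of_ball_bound[OF dim p \<epsilon>(1,2) lam this sets[OF lam] less_imp_le[OF K] cap]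
      show "(\<integral>\<^sup>+x. ennreal_abs_powr f p x \<partial>\<mu> lam) \<le> ennreal K' * (\<integral>\<^sup>+x. ennreal_abs_powr f p x \<partial>sphere_volume)"
        by (simp add: K'_def c_def)
    qed
  qed
  moreover have "0 < 2 powr p * 2 * K'" using K' by simp
  ultimately show ?thesis unfolding Lp_Carleson_def by blast
qed

lemma frequency_integer_degree:
  assumes "lam \<in> frequencies TYPE('a::euclidean_space)"
  obtains j :: nat where "lam\<^sup>2 = real j * (real j + real DIM('a) - 2)"
proof -
  obtain e :: "'a \<Rightarrow> complex" where e: "eigenfunction lam e" using assms by (auto simp: frequencies_def)
  then obtain x where x: "x \<in> sphere 0 1" "e x \<noteq> 0" by (auto simp: eigenfunction_def)
  then have "Re (e x) \<noteq> 0 \<or> Im (e x) \<noteq> 0" by (simp add: complex_eq_iff)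
  then show ?thesis
    using eigenvalue_quantised[OF eigenfunction_parts(1)[OF e] x(1)]
      eigenvalue_quantised[OF eigenfunction_parts(2)[OF e] x(1)] that by metis
qed

lemma zonal_eigenfunction:
  fixes z :: "'a::euclidean_space"
  assumes z: "norm z = 1" and P: "gegenbauer (real DIM('a) - 1) (lam\<^sup>2) P" "poly P 1 = 1"
  shows "eigenfunction lam (\<lambda>x. complex_of_real (poly P (x \<bullet> z)))"
  unfolding eigenfunction_def
proof (intro conjI ballI)
  show "sphere_C2 (\<lambda>x. Re (complex_of_real (poly P (x \<bullet> z))))" using zonal_calculus(1)[OF z, of P] by simp
  show "sphere_C2 (\<lambda>x. Im (complex_of_real (poly P (x \<bullet> z))))" using zonal_calculus(1)[OF z, of 0] by simp
  show "\<exists>x\<in>sphere 0 1. complex_of_real (poly P (x \<bullet> z)) \<noteq> 0"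
    using z P(2) by (intro bexI[of _ z]) (auto simp: dot_square_norm)
  fix x :: 'a assume x: "x \<in> sphere 0 1"
  have "laplace_beltrami (\<lambda>x. poly P (x \<bullet> z)) x = - (lam\<^sup>2 * poly P (x \<bullet> z))"
    unfolding zonal_calculus(2)[OF z x] using P(1)[unfolded gegenbauer_def, rule_format, of "x \<bullet> z"] by linarith
  moreover have "laplace_beltrami (\<lambda>x::'a. 0) x = 0" using zonal_calculus(2)[OF z x, of 0] by simp
  ultimately show "- Complex (laplace_beltrami (\<lambda>y. Re (complex_of_real (poly P (y \<bullet> z)))) x)
         (laplace_beltrami (\<lambda>y. Im (complex_of_real (poly P (y \<bullet> z)))) x) =
        complex_of_real (lam\<^sup>2) * complex_of_real (poly P (x \<bullet> z))"
    by (simp add: complex_eq_iff)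
qed

text \<open>
  Test the Carleson inequality on the zonal eigenfunction about \<open>z\<close>.  It is at least \<open>1 / 2\<close> on the
  geodesic ball of radius \<open>1 / (2 lam)\<close>, and the integral of its \<open>p\<close>-th power is comparable to the volume
  of this ball.
\<close>

proposition Lp_Carleson_imp_relatively_sparse:
  fixes \<mu> :: "real \<Rightarrow> 'a::euclidean_space measure"
  assumes M: "1 \<le> M" and dim: "DIM('a) = M + 2" and p: "2 * (real M + 1) / real M < p"
    and sets: "\<And>lam. 1 \<le> lam \<Longrightarrow> sets (\<mu> lam) = sets sphere_borel"
    and carleson: "Lp_Carleson p \<mu>"
  shows "relatively_sparse \<mu>"
proof -
  have "0 < 2 * (real M + 1) / real M" using M by (intro divide_pos_pos) auto
  then have p0: "0 < p" using p by linarith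
  have dim2: "2 \<le> DIM('a)" using dim by simp
  obtain C where C: "0 < C" and carl: "\<And>lam (e :: 'a \<Rightarrow> complex). 1 \<le> lam \<Longrightarrow> eigenfunction lam e \<Longrightarrow>
        (\<integral>\<^sup>+x. ennreal (cmod (e x) powr p) \<partial>\<mu> lam) \<le> ennreal C * (\<integral>\<^sup>+x. ennreal (cmod (e x) powr p) \<partial>sphere_volume)"
    using carleson unfolding Lp_Carleson_def by blast
  obtain C2 where C2: "0 < C2" and zon: "\<And>lam P (z::'a). 1 \<le> lam \<Longrightarrow> gegenbauer (real M + 1) (lam\<^sup>2) P \<Longrightarrow> poly P 1 = 1
     \<Longrightarrow> (\<forall>t. \<bar>poly P (- t)\<bar> = \<bar>poly P t\<bar>) \<Longrightarrow> norm z = 1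
     \<Longrightarrow> (\<integral>\<^sup>+x. ennreal (\<bar>poly P (x \<bullet> z)\<bar> powr p) \<partial>sphere_volume) \<le> ennreal (C2 / lam ^ (M + 1))"
    using zonal_powr_integral[OF M dim p] by metis
  obtain c where c: "0 < c" and low: "\<And>(z::'a) \<rho>. norm z = 1 \<Longrightarrow> 0 < \<rho> \<Longrightarrow> \<rho> \<le> 1 \<Longrightarrow>
     ennreal (c * \<rho> ^ (M + 1)) \<le> emeasure sphere_volume (chordal_cap z \<rho>)"
    using chordal_cap_volume_lower[where 'a='a] dim by auto
  define K where "K = 2 powr p * C * C2 * 8 ^ (M + 1) / c"
  have K: "0 < K" using C C2 c by (simp add: K_def)
  have "emeasure (\<mu> lam) (geodesic_ball z (1 / 2 / lam)) / emeasure sphere_volume (geodesic_ball z (1 / 2 / lam)) \<le> ennreal K"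
    if freq: "lam \<in> frequencies TYPE('a)" and "z \<in> sphere 0 1" for lam and z :: 'a
  proof -
    have lam: "1 \<le> lam" using freq by (simp add: frequencies_def)
    have z: "norm z = 1" using \<open>z \<in> sphere 0 1\<close> by simp
    let ?G = "geodesic_ball z (1 / 2 / lam)"
    obtain k :: nat where k: "lam\<^sup>2 = real k * (real k + real DIM('a) - 2)" using frequency_integer_degree[OF freq] .
    have "lam\<^sup>2 = real k * (real k + (real M + 1) - 1)" using k dim by simp
    then obtain P where P: "gegenbauer (real M + 1) (lam\<^sup>2) P" "poly P 1 = 1" "\<And>t. \<bar>poly P (- t)\<bar> = \<bar>poly P t\<bar>"
      using gegenbauer_symmetric_exists[of "real M + 1" "lam\<^sup>2" k] by auto
    let ?e = "\<lambda>x. complex_of_real (poly P (x \<bullet> z))"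
    have eig: "eigenfunction lam ?e"
    proof (rule zonal_eigenfunction[OF z _ P(2)])
      have "real DIM('a) - 1 = real M + 1" using dim by simp
      then show "gegenbauer (real DIM('a) - 1) (lam\<^sup>2) P" using P(1) by (simp only:)
    qed
    have Gmeas: "?G \<in> sets (\<mu> lam)" using geodesic_ball_measurable[OF z dim2] sets[OF lam] by simp
    have half: "1 / 2 \<le> poly P (x \<bullet> z)" if "x \<in> ?G" for x
    proof -
      have x: "norm x = 1" "arccos (z \<bullet> x) < 1 / 2 / lam" using that geodesic_ball_eq[OF z dim2] by auto
      define \<theta> where "\<theta> = arccos (z \<bullet> x)"
      have b: "-1 \<le> z \<bullet> x" "z \<bullet> x \<le> 1" by (rule sphere_inner_bounds[OF z x(1)])+
      have "lam * \<theta> \<le> 1 / 2" using x(2) lam by (simp add: \<theta>_def field_simps)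
      have "0 \<le> \<theta>" using b by (simp add: \<theta>_def arccos_lbound)
      moreover have "\<theta> \<le> pi / 2"
      proof -
        have "\<theta> \<le> lam * \<theta>" using lam \<open>0 \<le> \<theta>\<close> mult_right_mono[of 1 lam \<theta>] by simp
        then show ?thesis using \<open>lam * \<theta> \<le> 1 / 2\<close> pi_gt3 by linarith
      qed
      ultimately have "1 - sqrt (lam\<^sup>2) * \<theta> \<le> poly P (cos \<theta>)"
        using lam P by (intro gegenbauer_near_pole[of "real M + 1"]) auto
      then show ?thesis using \<open>lam * \<theta> \<le> 1 / 2\<close> b lam by (simp add: \<theta>_def inner_commute)
    qed
    have "ennreal ((1 / 2) powr p) * emeasure (\<mu> lam) ?G = (\<integral>\<^sup>+x. ennreal ((1 / 2) powr p) * indicator ?G x \<partial>\<mu> lam)"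
      by (rule nn_integral_cmult_indicator[OF Gmeas, symmetric])
    also have "\<dots> \<le> (\<integral>\<^sup>+x. ennreal (cmod (?e x) powr p) \<partial>\<mu> lam)"
    proof (rule nn_integral_mono)
      fix x
      show "ennreal ((1 / 2) powr p) * indicator ?G x \<le> ennreal (cmod (?e x) powr p)"
      proof (cases "x \<in> ?G")
        case True
        have "(1 / 2) powr p \<le> \<bar>poly P (x \<bullet> z)\<bar> powr p" using half[OF True] p0 by (intro powr_mono2) auto
        then show ?thesis using True by (simp add: ennreal_leI)
      qed simp
    qed
    also have "\<dots> \<le> ennreal C * (\<integral>\<^sup>+x. ennreal (cmod (?e x) powr p) \<partial>sphere_volume)"
      by (rule carl[OF lam eig])
    also have "\<dots> \<le> ennreal C * ennreal (C2 / lam ^ (M + 1))"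
      using zon[OF lam P(1,2) _ z] P(3) by (intro mult_left_mono) auto
    finally have "ennreal (2 powr p) * (ennreal ((1 / 2) powr p) * emeasure (\<mu> lam) ?G) \<le> ennreal (2 powr p) * (ennreal C * ennreal (C2 / lam ^ (M + 1)))"
      by (rule mult_left_mono) simp
    moreover have "ennreal (2 powr p) * (ennreal ((1 / 2) powr p) * emeasure (\<mu> lam) ?G) = emeasure (\<mu> lam) ?G"
      by (simp add: mult.assoc[symmetric] ennreal_mult[symmetric] powr_mult[symmetric])
    ultimately have up: "emeasure (\<mu> lam) ?G \<le> ennreal (2 powr p * C * C2 / lam ^ (M + 1))"
      using C C2 lam by (simp add: ennreal_mult[symmetric] mult.assoc)
    have "ennreal (c * (1 / (8 * lam)) ^ (M + 1)) \<le> emeasure sphere_volume (chordal_cap z (1 / (8 * lam)))"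
      using lam by (intro low z) (auto simp: field_simps)
    also have "\<dots> \<le> emeasure sphere_volume ?G"
    proof (rule emeasure_mono)
      show "chordal_cap z (1 / (8 * lam)) \<subseteq> ?G"
        using chordal_subset_geodesic_ball[OF z dim2, of "1 / 2 / lam"] by (simp add: chordal_cap_def)
      show "?G \<in> sets sphere_volume" using geodesic_ball_measurable[OF z dim2] by simp
    qed
    finally have dn: "ennreal (c * (1 / (8 * lam)) ^ (M + 1)) \<le> emeasure sphere_volume ?G" .
    have cpos: "0 < c * (1 / (8 * lam)) ^ (M + 1)" using c lam by simp
    have "2 powr p * C * C2 / lam ^ (M + 1) = c * (1 / (8 * lam)) ^ (M + 1) * K"
      using c lam by (simp add: K_def power_divide power_mult_distrib del: power_Suc power_add)
    then have "emeasure (\<mu> lam) ?G \<le> ennreal (c * (1 / (8 * lam)) ^ (M + 1)) * ennreal K"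
      using up K cpos by (simp add: ennreal_mult[symmetric] less_imp_le)
    also have "\<dots> \<le> emeasure sphere_volume ?G * ennreal K" by (rule mult_right_mono[OF dn]) simp
    finally have "emeasure (\<mu> lam) ?G \<le> emeasure sphere_volume ?G * ennreal K" .
    moreover have "0 < emeasure sphere_volume ?G" using dn cpos by (metis ennreal_less_zero_iff less_le_trans)
    ultimately show ?thesis by (intro divide_le_posI_ennreal)
  qed
  then show ?thesis
    unfolding relatively_sparse_def using K by (intro exI[of _ "1 / 2"] exI[of _ K]) auto
qed

theorem theorem7:
  fixes m :: nat and p :: real and \<mu> :: "real \<Rightarrow> (real ^ 'n) measure"
  assumes "m \<ge> 2" and "CARD('n) = m + 1"
    and "2 * real m / (real m - 1) < p"
    and "\<And>lam. lam \<ge> 1 \<Longrightarrow> sets (\<mu> lam) = sets (restrict_space borel (sphere 0 1))"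
  shows "relatively_sparse \<mu> \<longleftrightarrow> Lp_Carleson p \<mu>"
proof
  obtain M where M: "m = M + 1" "1 \<le> M" using assms(1) by (cases m) auto
  have p: "2 * (real M + 1) / real M < p" using assms(3) M by (simp add: add.commute)
  have "1 \<le> 2 * (real M + 1) / real M" using M by (simp add: field_simps)
  then have "1 < p" using p by linarith
  then show "Lp_Carleson p \<mu>" if "relatively_sparse \<mu>"
    using that assms(1,2,4) by (intro relatively_sparse_imp_Lp_Carleson) auto
  show "relatively_sparse \<mu>" if "Lp_Carleson p \<mu>"
    using that M assms(2,4) p by (intro Lp_Carleson_imp_relatively_sparse[of M]) auto
qed

end
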